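(* Let $T<\infty$ be a fixed time horizon and assume: (A1) for all $0\le t\le T$, $g_t(x)>0$ for every $x\in\mathbb X$, and $\sup_{0\le t\le T}|g_t|_\infty<\infty$; (A2) $\sup_{1\le t\le T}|\vartheta_t|_\infty<\infty$ and $\sup_{0\le t\le T}|\omega_t|_\infty<\infty$. Then there exist constants $0<B<\infty$ and $0<C<\infty$ (depending on $T$) such that for all $N\ge 1$, all $\epsilon>0$, and all $h\in\mathcal F_b(\mathbb X^{T+1})$, $$\mathbb P\big[\,|\phi^N_{0:T|T}(h)-\phi_{0:T|T}(h)|\ge\epsilon\,\big]\le B\,e^{-CN\epsilon^2/\operatorname{osc}^2(h)} .$$ In addition, for all $1\le t\le T$, $$N^{-1}\sum_{\ell=1}^N\omega_t^\ell\,\mathcal L_{t,T}(\xi_t^\ell,\mathbf 1)\ \longrightarrow\ \frac{\phi_{t-1}[\mathcal L_{t-1,T}(\cdot,\mathbf 1)]}{\phi_{t-1}(\vartheta_t)}\quad\text{in probability as }N\to\infty .$$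
   Context: Model. $(\mathbb X,\mathcal B(\mathbb X))$ and $(\mathbb Y,\mathcal B(\mathbb Y))$ are Polish spaces with their Borel $\sigma$-algebras; $\mathcal F_b(\mathbb X^d)$ is the set of bounded measurable real functions on $\mathbb X^d$; $|f|_\infty$ is the supremum norm, $\operatorname{osc}(f)=\sup_{x,x'}|f(x)-f(x')|$, $\operatorname{osc}^2(f)=(\operatorname{osc}(f))^2$, $\mathbf 1$ is the constant function $1$, and $x_{m:n}=(x_m,\dots,x_n)$. $\chi$ is a probability measure on $\mathbb X$ (initial law), $M$ is a Markov kernel on $\mathbb X$ with transition density $m$ with respect to a $\sigma$-finite measure $\nu$: $M(x,dx')=m(x,x')\,dx'$, where $dx'$ stands for $\nu(dx')$. $g:\mathbb X\times\mathbb Y\to[0,\infty)$ is the likelihood (density of an observation given the state). The observations $y_0,\dots,y_T$ are fixed and $g_t(x)=g(x,y_t)$. The joint smoothing distribution is $$\phi_{0:T|T}(h)=\frac{\int\cdots\int\chi(dx_0)\prod_{u=1}^T g_{u-1}(x_{u-1})M(x_{u-1},dx_u)\,g_T(x_T)\,h(x_{0:T})}{\int\cdots\int\chi(dx_0)\prod_{u=1}^T g_{u-1}(x_{u-1})M(x_{u-1},dx_u)\,g_T(x_T)},\quad h\in\mathcal F_b(\mathbb X^{T+1}),$$ the denominator being assumed positive. The filter $\phi_t$ is the marginal law of $x_t$ under $\phi_{0:t|t}$ (defined by the same formula with $T$ replaced by $t$). Particle filter. $\rho_0$ is a probability measure on $\mathbb X$ with $\chi\ll\rho_0$; for $t\ge1$,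 $\vartheta_t:\mathbb X\to(0,\infty)$ is measurable (adjustment multipliers), and $P_t$ is a Markov kernel with density $p_t$ with respect to $\nu$, with $p_t(x,x')>0$ whenever $m(x,x')g_t(x')>0$. Weight functions: $\omega_0(x)=\frac{d\chi}{d\rho_0}(x)g_0(x)$ and $\omega_t(x,x')=\frac{m(x,x')g_t(x')}{\vartheta_t(x)p_t(x,x')}$, $t\ge1$. For each $N\geq 1$: $\xi_0^1,\dots,\xi_0^N$ are i.i.d. with law $\rho_0$ and $\omega_0^i=\omega_0(\xi_0^i)$; for $t\ge1$, conditionally on all particles and weights up to time $t-1$, the pairs $(I_t^i,\xi_t^i)$, $i=1,\dots,N$, are i.i.d. on $\{1,\dots,N\}\times\mathbb X$ with law proportional to $(j,dx)\mapsto\omega_{t-1}^j\vartheta_t(\xi_{t-1}^j)P_t(\xi_{t-1}^j,dx)$, and $\omega_t^i=\omega_t(\xi_{t-1}^{I_t^i},\xi_t^i)$. Put $\Omega_t=\sum_{i=1}^N\omega_t^i$ and $\phi_t^N(f)=\Omega_t^{-1}\sum_{i=1}^N\omega_t^if(\xi_t^i)$. FFBS estimator. For a probability measure $\eta$ on $\mathbb X$, the backward kernel is $\mathrm B_\eta(x,f)=\frac{\int\eta(dx')m(x',x)f(x')}{\int\eta(dx')m(x',x)}$. The forward filtering backward smoothing estimator is $$\phi^N_{0:T|T}(h)=\int\cdots\int\phi_T^N(dx_T)\,\mathrm B_{\phi^N_{T-1}}(x_T,dx_{T-1})\cdots\mathrm B_{\phi_0^N}(x_1,dx_0)\,h(x_{0:T}).$$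 Finally, for $0\le t<T$ and $x_t\in\mathbb X$, $\mathcal L_{t,T}(x_t,\mathbf 1)=\int\cdots\int\prod_{u=t+1}^T M(x_{u-1},dx_u)g_u(x_u)$, and $\mathcal L_{T,T}(\cdot,\mathbf 1)=1$. *)

theory Defs
  imports "HOL-Probability.Probability"
begin

section \<open>Functions on path space\<close>

text \<open>
  A path \<open>x\<^sub>0, \<dots>, x\<^sub>n\<close> is an extensional function on \<open>{..n}\<close>, i.e. a point of the product
  space below.
\<close>

abbreviation path_space :: "nat \<Rightarrow> (nat \<Rightarrow> 'x :: polish_space) measure" where
  "path_space n \<equiv> Pi\<^sub>M {..n} (\<lambda>_. borel)"

definition bounded_measurable :: "'a measure \<Rightarrow> ('a \<Rightarrow> real) set" where
  "bounded_measurable A = {f \<in> borel_measurable A. bounded (f ` space A)}"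

definition sup_norm :: "('a \<Rightarrow> real) \<Rightarrow> ennreal" where
  "sup_norm f = (SUP x. ennreal \<bar>f x\<bar>)"

definition osc :: "'a set \<Rightarrow> ('a \<Rightarrow> real) \<Rightarrow> real" where
  "osc A f = (SUP (x, x') \<in> A \<times> A. \<bar>f x - f x'\<bar>)"

text \<open>The probability space may change along the sequence.\<close>

definition tendsto_in_probability ::
  "(nat \<Rightarrow> 'w measure) \<Rightarrow> (nat \<Rightarrow> 'w \<Rightarrow> real) \<Rightarrow> real \<Rightarrow> bool" where
  "tendsto_in_probability P X c \<longleftrightarrow>
    (\<forall>\<epsilon>>0. (\<lambda>N. measure (P N) {w \<in> space (P N). \<epsilon> \<le> \<bar>X N w - c\<bar>}) \<longlonglongrightarrow> 0)"


section \<open>The model and the ingredients of the particle filter\<close>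

text \<open>
  In the usual notation: \<open>init_law\<close> is \<open>\<chi>\<close>; \<open>trans_kernel\<close> is \<open>M\<close>, with density \<open>trans_dens\<close>, i.e. \<open>m\<close>,
  with respect to \<open>ref_meas\<close>, i.e. \<open>\<nu>\<close>; \<open>init_prop\<close> is \<open>\<rho>\<^sub>0\<close>; \<open>init_dens\<close> is a version of
  \<open>d\<chi>/d\<rho>\<^sub>0\<close>; \<open>adj_mult t\<close> is \<open>\<vartheta>\<^sub>t\<close>; \<open>prop_kernel t\<close> is \<open>P\<^sub>t\<close>, with density \<open>prop_dens t\<close>,
  i.e. \<open>p\<^sub>t\<close>.
\<close>

record ('x, 'y) smc_model =
  init_law :: "'x measure"
  ref_meas :: "'x measure"
  trans_kernel :: "'x \<Rightarrow> 'x measure"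
  trans_dens :: "'x \<Rightarrow> 'x \<Rightarrow> real"
  likelihood :: "'x \<Rightarrow> 'y \<Rightarrow> real"
  observation :: "nat \<Rightarrow> 'y"
  init_prop :: "'x measure"
  init_dens :: "'x \<Rightarrow> real"
  adj_mult :: "nat \<Rightarrow> 'x \<Rightarrow> real"
  prop_kernel :: "nat \<Rightarrow> 'x \<Rightarrow> 'x measure"
  prop_dens :: "nat \<Rightarrow> 'x \<Rightarrow> 'x \<Rightarrow> real"

definition lik_at :: "('x, 'y) smc_model \<Rightarrow> nat \<Rightarrow> 'x \<Rightarrow> real" where
  "lik_at S t x = likelihood S x (observation S t)"

definition markov_kernel_density ::
  "'x measure \<Rightarrow> ('x \<Rightarrow> 'x measure) \<Rightarrow> ('x :: polish_space \<Rightarrow> 'x \<Rightarrow> real) \<Rightarrow> bool" where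
  "markov_kernel_density \<nu> K k \<longleftrightarrow>
     K \<in> borel \<rightarrow>\<^sub>M prob_algebra borel \<and>
     (\<lambda>(x, x'). k x x') \<in> borel_measurable (borel \<Otimes>\<^sub>M borel) \<and>
     (\<forall>x x'. 0 \<le> k x x') \<and>
     (\<forall>x. K x = density \<nu> (\<lambda>x'. ennreal (k x x')))"

text \<open>
  For a path \<open>x\<close> up to time \<open>t\<close>, \<open>forward_integral S n t x h\<close> is the iterated integral
  \<open>\<integral>\<dots>\<integral> (\<Prod>u=t+1..t+n. M(x\<^sub>u\<^sub>-\<^sub>1, dx\<^sub>u) g\<^sub>u(x\<^sub>u)) h(x\<^sub>0, \<dots>, x\<^sub>t\<^sub>+\<^sub>n)\<close>.
\<close>

primrec forward_integral ::
  "('x, 'y) smc_model \<Rightarrow> nat \<Rightarrow> nat \<Rightarrow> (nat \<Rightarrow> 'x) \<Rightarrow> ((nat \<Rightarrow> 'x) \<Rightarrow> real) \<Rightarrow> real" where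
  "forward_integral S 0 t x h = h x"
| "forward_integral S (Suc n) t x h =
     (\<integral>x'. lik_at S (Suc t) x' * forward_integral S n (Suc t) (x(Suc t := x')) h
        \<partial>trans_kernel S (x t))"

definition unnormalised_smoothing ::
  "('x, 'y) smc_model \<Rightarrow> nat \<Rightarrow> ((nat \<Rightarrow> 'x) \<Rightarrow> real) \<Rightarrow> real" where
  "unnormalised_smoothing S T h =
     (\<integral>x\<^sub>0. lik_at S 0 x\<^sub>0 * forward_integral S T 0 ((\<lambda>_. undefined)(0 := x\<^sub>0)) h \<partial>init_law S)"

definition joint_smoothing ::
  "('x, 'y) smc_model \<Rightarrow> nat \<Rightarrow> ((nat \<Rightarrow> 'x) \<Rightarrow> real) \<Rightarrow> real" where
  "joint_smoothing S T h = unnormalised_smoothing S T h / unnormalised_smoothing S T (\<lambda>_. 1)"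

definition filter_expectation ::
  "('x, 'y) smc_model \<Rightarrow> nat \<Rightarrow> ('x \<Rightarrow> real) \<Rightarrow> real" where
  "filter_expectation S t f = joint_smoothing S t (\<lambda>x. f (x t))"

text \<open>This is \<open>\<L>\<^sub>t\<^sub>,\<^sub>T(x, 1)\<close>.\<close>

definition lik_to_go :: "('x, 'y) smc_model \<Rightarrow> nat \<Rightarrow> nat \<Rightarrow> 'x \<Rightarrow> real" where
  "lik_to_go S t T x = forward_integral S (T - t) t ((\<lambda>_. undefined)(t := x)) (\<lambda>_. 1)"

text \<open>
  The density equation for \<open>init_dens\<close> expresses \<open>\<chi> \<lless> \<rho>\<^sub>0\<close> together with the choice of a
  version of \<open>d\<chi>/d\<rho>\<^sub>0\<close>; \<open>RN_deriv\<close> would fix one arbitrary version, possibly unbounded on a null set.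
\<close>

definition standing_assumptions ::
  "('x :: polish_space, 'y :: polish_space) smc_model \<Rightarrow> nat \<Rightarrow> bool" where
  "standing_assumptions S T \<longleftrightarrow>
     init_law S \<in> space (prob_algebra borel) \<and>
     sets (ref_meas S) = sets borel \<and> sigma_finite_measure (ref_meas S) \<and>
     markov_kernel_density (ref_meas S) (trans_kernel S) (trans_dens S) \<and>
     (\<lambda>(x, y). likelihood S x y) \<in> borel_measurable (borel \<Otimes>\<^sub>M borel) \<and>
     (\<forall>x y. 0 \<le> likelihood S x y) \<and>
     0 < unnormalised_smoothing S T (\<lambda>_. 1) \<and>
     init_prop S \<in> space (prob_algebra borel) \<and>
     init_dens S \<in> borel_measurable borel \<and> (\<forall>x. 0 \<le> init_dens S x) \<and>
     init_law S = density (init_prop S) (\<lambda>x. ennreal (init_dens S x)) \<and>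
     (\<forall>t\<in>{1..T}.
        adj_mult S t \<in> borel_measurable borel \<and> (\<forall>x. 0 < adj_mult S t x) \<and>
        markov_kernel_density (ref_meas S) (prop_kernel S t) (prop_dens S t) \<and>
        (\<forall>x x'. 0 < trans_dens S x x' * lik_at S t x' \<longrightarrow> 0 < prop_dens S t x x'))"

definition init_weight_fun :: "('x, 'y) smc_model \<Rightarrow> 'x \<Rightarrow> real" where
  "init_weight_fun S x = init_dens S x * lik_at S 0 x"

text \<open>
  Where \<open>prop_dens S t x x' = 0\<close> the numerator vanishes as well, and the value of the quotient
  is \<open>0\<close>.
\<close>

definition weight_fun :: "('x, 'y) smc_model \<Rightarrow> nat \<Rightarrow> 'x \<Rightarrow> 'x \<Rightarrow> real" where
  "weight_fun S t x x' =
     trans_dens S x x' * lik_at S t x' / (adj_mult S t x * prop_dens S t x x')"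


section \<open>The particle filter\<close>

text \<open>
  Here \<open>\<xi> t i\<close> and \<open>I t i\<close> are the position and the ancestor index of particle \<open>i \<in> {1..N}\<close> at time
  \<open>t\<close>, for one realisation of the system.
\<close>

definition weight ::
  "('x, 'y) smc_model \<Rightarrow> (nat \<Rightarrow> nat \<Rightarrow> 'x) \<Rightarrow> (nat \<Rightarrow> nat \<Rightarrow> nat) \<Rightarrow> nat \<Rightarrow> nat \<Rightarrow> real" where
  "weight S \<xi> I t i =
     (if t = 0 then init_weight_fun S (\<xi> 0 i)
      else weight_fun S t (\<xi> (t - 1) (I t i)) (\<xi> t i))"

definition total_weight ::
  "('x, 'y) smc_model \<Rightarrow> nat \<Rightarrow> (nat \<Rightarrow> nat \<Rightarrow> 'x) \<Rightarrow> (nat \<Rightarrow> nat \<Rightarrow> nat) \<Rightarrow> nat \<Rightarrow> real" where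
  "total_weight S N \<xi> I t = (\<Sum>i=1..N. weight S \<xi> I t i)"

text \<open>
  All weights can vanish simultaneously with positive probability, and the normalised weights are
  then 0/0. In that case they are taken uniform, so that the particle filter is always a probability
  measure.
\<close>

definition normalised_weight ::
  "('x, 'y) smc_model \<Rightarrow> nat \<Rightarrow> (nat \<Rightarrow> nat \<Rightarrow> 'x) \<Rightarrow> (nat \<Rightarrow> nat \<Rightarrow> nat) \<Rightarrow> nat \<Rightarrow> nat \<Rightarrow> real" where
  "normalised_weight S N \<xi> I t i =
     (if total_weight S N \<xi> I t = 0 then 1 / real N
      else weight S \<xi> I t i / total_weight S N \<xi> I t)"

definition particle_filter ::
  "('x :: polish_space, 'y) smc_model \<Rightarrow> nat \<Rightarrow> (nat \<Rightarrow> nat \<Rightarrow> 'x) \<Rightarrow> (nat \<Rightarrow> nat \<Rightarrow> nat) \<Rightarrow>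
     nat \<Rightarrow> 'x measure" where
  "particle_filter S N \<xi> I t =
     distr (point_measure {1..N} (\<lambda>i. ennreal (normalised_weight S N \<xi> I t i))) borel (\<xi> t)"

lemma integral_particle_filter:
  fixes f :: "'x :: polish_space \<Rightarrow> real"
  assumes "f \<in> borel_measurable borel"
    and "\<And>i. i \<in> {1..N} \<Longrightarrow> 0 \<le> normalised_weight S N \<xi> I t i"
  shows "(\<integral>x. f x \<partial>particle_filter S N \<xi> I t) = (\<Sum>i=1..N. normalised_weight S N \<xi> I t i * f (\<xi> t i))"
  unfolding particle_filter_def
  using assms
  by (subst integral_distr, simp_all add: measurable_point_measure_eq1 del: One_nat_def)
    (subst lebesgue_integral_point_measure_finite, auto)

text \<open>
  Probability of \<open>A \<subseteq> {1..N} \<times> \<X>\<close> under the law proportional to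
  \<open>(j, dx) \<mapsto> \<omega>\<^sub>t\<^sub>-\<^sub>1\<^sup>j \<vartheta>\<^sub>t(\<xi>\<^sub>t\<^sub>-\<^sub>1\<^sup>j) P\<^sub>t(\<xi>\<^sub>t\<^sub>-\<^sub>1\<^sup>j, dx)\<close>.
\<close>

definition selection_mutation_prob ::
  "('x, 'y) smc_model \<Rightarrow> nat \<Rightarrow> (nat \<Rightarrow> nat \<Rightarrow> 'x) \<Rightarrow> (nat \<Rightarrow> nat \<Rightarrow> nat) \<Rightarrow> nat \<Rightarrow>
     (nat \<times> 'x) set \<Rightarrow> real" where
  "selection_mutation_prob S N \<xi> I t A =
     (\<Sum>j=1..N. weight S \<xi> I (t - 1) j * adj_mult S t (\<xi> (t - 1) j) *
        measure (prop_kernel S t (\<xi> (t - 1) j)) {x. (j, x) \<in> A}) /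
     (\<Sum>j=1..N. weight S \<xi> I (t - 1) j * adj_mult S t (\<xi> (t - 1) j))"

text \<open>The \<sigma>-algebra generated by all particles and weights up to time \<open>t\<close>.\<close>

definition particle_history ::
  "('x :: polish_space, 'y) smc_model \<Rightarrow> nat \<Rightarrow> 'w measure \<Rightarrow> ('w \<Rightarrow> nat \<Rightarrow> nat \<Rightarrow> 'x) \<Rightarrow>
     ('w \<Rightarrow> nat \<Rightarrow> nat \<Rightarrow> nat) \<Rightarrow> nat \<Rightarrow> 'w measure" where
  "particle_history S N P \<xi> I t =
     vimage_algebra (space P)
       (\<lambda>w. \<lambda>(s, i) \<in> {..t} \<times> {1..N}. (\<xi> w s i, weight S (\<xi> w) (I w) s i))
       (Pi\<^sub>M ({..t} \<times> {1..N}) (\<lambda>_. borel \<Otimes>\<^sub>M borel))"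

text \<open>
  The last clause says that, conditionally on the history up to time \<open>t - 1\<close>, the pairs
  \<open>(I t i, \<xi> t i)\<close> for \<open>i \<in> {1..N}\<close> are i.i.d. with the selection-mutation law. That law
  exists only if its total mass is positive; nothing is required otherwise.
\<close>

definition particle_system ::
  "('x :: polish_space, 'y) smc_model \<Rightarrow> nat \<Rightarrow> nat \<Rightarrow> 'w measure \<Rightarrow>
     ('w \<Rightarrow> nat \<Rightarrow> nat \<Rightarrow> 'x) \<Rightarrow> ('w \<Rightarrow> nat \<Rightarrow> nat \<Rightarrow> nat) \<Rightarrow> bool" where
  "particle_system S T N P \<xi> I \<longleftrightarrow>
     prob_space P \<and>
     (\<forall>t\<in>{0..T}. \<forall>i\<in>{1..N}. (\<lambda>w. \<xi> w t i) \<in> P \<rightarrow>\<^sub>M borel) \<and>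
     (\<forall>t\<in>{1..T}. \<forall>i\<in>{1..N}. (\<lambda>w. I w t i) \<in> P \<rightarrow>\<^sub>M count_space {1..N}) \<and>
     prob_space.indep_vars P (\<lambda>_. borel) (\<lambda>i w. \<xi> w 0 i) {1..N} \<and>
     (\<forall>i\<in>{1..N}. distr P borel (\<lambda>w. \<xi> w 0 i) = init_prop S) \<and>
     (\<forall>t\<in>{1..T}. \<forall>A. (\<forall>i\<in>{1..N}. A i \<in> sets (count_space {1..N} \<Otimes>\<^sub>M borel)) \<longrightarrow>
        (AE w in P.
           0 < (\<Sum>j=1..N. weight S (\<xi> w) (I w) (t - 1) j * adj_mult S t (\<xi> w (t - 1) j)) \<longrightarrow>
           real_cond_exp P (particle_history S N P \<xi> I (t - 1))
             (indicat_real {v \<in> space P. \<forall>i\<in>{1..N}. (I v t i, \<xi> v t i) \<in> A i}) w =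
           (\<Prod>i=1..N. selection_mutation_prob S N (\<xi> w) (I w) t (A i))))"


section \<open>Forward filtering backward smoothing\<close>

text \<open>
  If the denominator is 0 the kernel returns \<open>\<eta>\<close> itself, so that it is always Markov. For the
  particle filters, as long as no total weight vanishes, this almost surely concerns only particles
  of weight 0.
\<close>

definition backward_kernel ::
  "('x, 'y) smc_model \<Rightarrow> 'x measure \<Rightarrow> 'x \<Rightarrow> ('x \<Rightarrow> real) \<Rightarrow> real" where
  "backward_kernel S \<eta> x f =
     (if (\<integral>x'. trans_dens S x' x \<partial>\<eta>) = 0 then (\<integral>x'. f x' \<partial>\<eta>)
      else (\<integral>x'. trans_dens S x' x * f x' \<partial>\<eta>) / (\<integral>x'. trans_dens S x' x \<partial>\<eta>))"

text \<open>
  For a path \<open>x\<close> from time \<open>t\<close> on, this is the iterated integral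
  \<open>\<integral>\<dots>\<integral> B\<^sub>\<eta>\<^sub>(\<^sub>t\<^sub>-\<^sub>1\<^sub>)(x\<^sub>t, dx\<^sub>t\<^sub>-\<^sub>1) \<dots> B\<^sub>\<eta>\<^sub>(\<^sub>0\<^sub>)(x\<^sub>1, dx\<^sub>0) h(x\<^sub>0, x\<^sub>1, \<dots>)\<close>.
\<close>

primrec backward_integral ::
  "('x, 'y) smc_model \<Rightarrow> (nat \<Rightarrow> 'x measure) \<Rightarrow> nat \<Rightarrow> (nat \<Rightarrow> 'x) \<Rightarrow>
     ((nat \<Rightarrow> 'x) \<Rightarrow> real) \<Rightarrow> real" where
  "backward_integral S \<eta> 0 x h = h x"
| "backward_integral S \<eta> (Suc t) x h =
     backward_kernel S (\<eta> t) (x (Suc t)) (\<lambda>x'. backward_integral S \<eta> t (x(t := x')) h)"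

definition ffbs_estimator ::
  "('x :: polish_space, 'y) smc_model \<Rightarrow> nat \<Rightarrow> nat \<Rightarrow> (nat \<Rightarrow> nat \<Rightarrow> 'x) \<Rightarrow>
     (nat \<Rightarrow> nat \<Rightarrow> nat) \<Rightarrow> ((nat \<Rightarrow> 'x) \<Rightarrow> real) \<Rightarrow> real" where
  "ffbs_estimator S T N \<xi> I h =
     (\<integral>x. backward_integral S (particle_filter S N \<xi> I) T ((\<lambda>_. undefined)(T := x)) h
        \<partial>particle_filter S N \<xi> I T)"

end

theory Submission
  imports Defs
begin

text \<open>The backward kernel at level t is built from all particles up to time t, so the summands
  at time t + 1 are independent only given that whole history. Hoeffding's inequality is therefore
  needed for functions of a history and a fresh pair, with the history frozen. Subtracting R_t times
  the lookahead of 1 inside each summand does two jobs: it makes the conditional mean vanish, and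
  since R_t stays between any two bounds of \<open>h\<close>, only the oscillation of
  \<open>h\<close> enters, never its size. The events on which a denominator is small involve
  neither \<open>h\<close> nor \<epsilon>, so one pair of constants serves all of them. Their
  probability is of order exp(-CN), which is no larger than a Gaussian term while \<epsilon> is at
  most twice the oscillation; beyond that the deviation event is empty. Positive likelihoods (A1)
  make the limits of the denominators positive. Where the total selection mass vanishes, the model
  prescribes no law for the next particles; that event has exponentially small probability and is
  counted among the bad ones.\<close>

text \<open>
  Put \<open>G\<^sub>t h (x\<^sub>0, \<dots>, x\<^sub>t)\<close> for the forward integral of \<open>h\<close> from time \<open>t\<close> to \<open>T\<close> and let \<open>R\<^sub>t\<close> be the ratio of
  the backward-smoothed particle averages of \<open>G\<^sub>t h\<close> and \<open>G\<^sub>t 1\<close>, so that \<open>R\<^sub>T\<close> is the estimator. The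
  backward kernel undoes one forward step exactly; hence \<open>R\<^sub>t\<^sub>+\<^sub>1 - R\<^sub>t\<close> is a quotient whose
  numerator is, conditionally on the history up to time \<open>t\<close>, an average of i.i.d. centred variables
  bounded by a multiple of \<open>osc h\<close>, to which Hoeffding's inequality applies. The denominator is the
  average of the second assertion: it converges exponentially fast to a positive limit, by induction
  on \<open>t\<close> with Hoeffding's inequality again.
\<close>

section \<open>Conditional Hoeffding inequality\<close>

lemma prob_kernelD:
  assumes "K \<in> M \<rightarrow>\<^sub>M prob_algebra N" "x \<in> space M"
  shows "prob_space (K x)" "sets (K x) = sets N" "space (K x) = space N"
  using measurable_space[OF assms] sets_eq_imp_space_eq[of "K x" N]
  by (auto simp: space_prob_algebra)

text \<open>Pushing \<open>K x\<close> forward along y \<mapsto> (x, y) makes the integrand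
  independent of x, and integrating a fixed function is a measurable functional of the
  measure.\<close>

lemma measurable_integral_kernel:
  fixes f :: "'a \<Rightarrow> 'b \<Rightarrow> real"
  assumes f[measurable]: "(\<lambda>(x, y). f x y) \<in> borel_measurable (M \<Otimes>\<^sub>M N)"
    and K: "K \<in> M \<rightarrow>\<^sub>M prob_algebra N"
  shows "(\<lambda>x. \<integral>y. f x y \<partial>K x) \<in> borel_measurable M"
proof -
  note K' [measurable] = measurable_prob_algebraD[OF K]
  note integral_measurable_subprob_algebra[measurable]
  note measurable_distr2[measurable]
  have "(\<lambda>x. integral\<^sup>L (distr (K x) (M \<Otimes>\<^sub>M N) (\<lambda>y. (x, y))) (\<lambda>(x, y). f x y)) \<in> borel_measurable M"
    by measurable
  then show ?thesis
    by (rule measurable_cong[THEN iffD1, rotated])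
       (subst integral_distr; auto simp: subprob_measurableD[OF K'])
qed

lemma (in prob_space) hoeffding_iid:
  assumes fin: "finite J" "J \<noteq> {}"
    and indep: "indep_vars (\<lambda>_. N) Y J"
    and distr: "\<And>i. i \<in> J \<Longrightarrow> distr M N (Y i) = D"
    and f[measurable]: "f \<in> borel_measurable N"
    and bd: "\<And>y. y \<in> space N \<Longrightarrow> \<bar>f y\<bar> \<le> c" and c: "0 < c" and e: "0 \<le> e"
  shows "prob {x \<in> space M. real (card J) * e \<le> \<bar>(\<Sum>i\<in>J. f (Y i x)) - real (card J) * (\<integral>y. f y \<partial>D)\<bar>}
    \<le> 2 * exp (- (real (card J) * e\<^sup>2 / (2 * c\<^sup>2)))"
proof -
  have Y[measurable]: "Y i \<in> M \<rightarrow>\<^sub>M N" if "i \<in> J" for i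
    using indep that by (auto simp: indep_vars_def)
  interpret H: Hoeffding_ineq M J "\<lambda>i x. f (Y i x)" "\<lambda>_. - c" "\<lambda>_. c"
    "\<Sum>i\<in>J. expectation (\<lambda>x. f (Y i x))"
  proof unfold_locales
    show "indep_vars (\<lambda>_. borel) (\<lambda>i x. f (Y i x)) J"
      by (rule indep_vars_compose2[OF indep f])
    show "AE x in M. f (Y i x) \<in> {- c..c}" if "i \<in> J" for i
      using bd measurable_space[OF Y[OF that]] by (intro AE_I2) (force simp: abs_le_iff)
  qed (use fin in auto)
  have E: "expectation (\<lambda>x. f (Y i x)) = (\<integral>y. f y \<partial>D)" if "i \<in> J" for i
    using that distr[OF that, symmetric] by (simp add: integral_distr)
  have J: "real (card J) > 0" using fin by (simp add: card_gt_0_iff)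
  have "prob {x \<in> space M. real (card J) * e \<le>
      \<bar>(\<Sum>i\<in>J. f (Y i x)) - (\<Sum>i\<in>J. expectation (\<lambda>x. f (Y i x)))\<bar>}
      \<le> 2 * exp (- 2 * (real (card J) * e)\<^sup>2 / (\<Sum>i\<in>J. (c - - c)\<^sup>2))"
    using J c e by (intro H.Hoeffding_ineq_abs_ge) auto
  \<comment> \<open>Each summand ranges over an interval of length 2c, so the exponent is 2 (n e)^2
    / (n (2 c)^2).\<close>
  also have "- 2 * (real (card J) * e)\<^sup>2 / (\<Sum>i\<in>J. (c - - c)\<^sup>2) = - (real (card J) * e\<^sup>2 / (2 * c\<^sup>2))"
    using J c by (simp add: field_simps power2_eq_square)
  finally show ?thesis by (simp add: E)
qed

lemma emeasure_PiM_const: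
  assumes "finite J" "prob_space K" "\<And>i. i \<in> J \<Longrightarrow> B i \<in> sets K"
  shows "emeasure (PiM J (\<lambda>_. K)) (Pi\<^sub>E J B) = (\<Prod>i\<in>J. emeasure K (B i))"
proof -
  interpret prob_space K by fact
  interpret product_prob_space "\<lambda>_. K" J by unfold_locales
  show ?thesis using assms by (intro emeasure_PiM) auto
qed

text \<open>Boxes form an intersection-stable generator of the product, and on a box the product
  measure is a finite product of measurable functions of x.\<close>

lemma measurable_PiM_kernel:
  assumes J: "finite J" and K[measurable]: "K \<in> M \<rightarrow>\<^sub>M prob_algebra N"
  shows "(\<lambda>x. PiM J (\<lambda>_. K x)) \<in> M \<rightarrow>\<^sub>M prob_algebra (PiM J (\<lambda>_. N))"
proof (rule measurable_prob_algebra_generated[where \<Omega>="space (PiM J (\<lambda>_. N))" and G="prod_algebra J (\<lambda>_. N)"])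
  show "sets (PiM J (\<lambda>_. N)) = sigma_sets (space (PiM J (\<lambda>_. N))) (prod_algebra J (\<lambda>_. N))"
    by (simp add: sets_PiM space_PiM)
  show "Int_stable (prod_algebra J (\<lambda>_. N))" by (rule Int_stable_prod_algebra)
  show "prod_algebra J (\<lambda>_. N) \<subseteq> Pow (space (PiM J (\<lambda>_. N)))"
    using prod_algebra_sets_into_space[of J "\<lambda>_. N"] by (simp add: space_PiM)
  fix x assume x: "x \<in> space M"
  note k = prob_kernelD[OF K x]
  show "prob_space (PiM J (\<lambda>_. K x))"
    using k(1) by (intro prob_space_PiM)
  show "sets (PiM J (\<lambda>_. K x)) = sets (PiM J (\<lambda>_. N))"
    using k(2) by (intro sets_PiM_cong) auto
next
  fix A assume "A \<in> prod_algebra J (\<lambda>_. N)"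
  then obtain B where A: "A = Pi\<^sub>E J B" and B: "\<And>i. i \<in> J \<Longrightarrow> B i \<in> sets N"
    by (auto simp: prod_algebra_eq_finite[OF J] Pi_iff)
  have "(\<lambda>x. emeasure (PiM J (\<lambda>_. K x)) A) \<in> borel_measurable M \<longleftrightarrow>
      (\<lambda>x. \<Prod>i\<in>J. emeasure (K x) (B i)) \<in> borel_measurable M"
    using J B by (intro measurable_cong) (auto simp: A emeasure_PiM_const prob_kernelD[OF K])
  also have "\<dots>"
    using B by (intro borel_measurable_prod_ennreal measurable_compose[OF measurable_prob_algebraD[OF K]])
      (auto intro: measurable_emeasure_subprob_algebra)
  finally show "(\<lambda>x. emeasure (PiM J (\<lambda>_. K x)) A) \<in> borel_measurable M" .
qed

text \<open>Nothing is known about the conditional law where the conditioning variable lies outside \<open>G\<close>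
  (for the particle system: where the selection law does not exist), so both sides are restricted
  to \<open>G\<close>.\<close>

lemma (in prob_space) joint_law_from_conditional:
  assumes J: "finite J" and Z[measurable]: "Z \<in> M \<rightarrow>\<^sub>M MZ"
    and Y[measurable]: "\<And>i. i \<in> J \<Longrightarrow> Y i \<in> M \<rightarrow>\<^sub>M MY"
    and G[measurable]: "G \<in> sets MZ"
    and K[measurable]: "K \<in> MZ \<rightarrow>\<^sub>M prob_algebra MY"
    and cond: "\<And>A B. A \<in> sets MZ \<Longrightarrow> A \<subseteq> G \<Longrightarrow> (\<And>i. i \<in> J \<Longrightarrow> B i \<in> sets MY) \<Longrightarrow>
       emeasure M {w \<in> space M. Z w \<in> A \<and> (\<forall>i\<in>J. Y i w \<in> B i)} =
       (\<integral>\<^sup>+w. indicator A (Z w) * (\<Prod>i\<in>J. emeasure (K (Z w)) (B i)) \<partial>M)"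
    and Q[measurable]: "Q \<in> sets (MZ \<Otimes>\<^sub>M PiM J (\<lambda>_. MY))"
  shows "emeasure M {w \<in> space M. Z w \<in> G \<and> (Z w, \<lambda>i\<in>J. Y i w) \<in> Q} =
    (\<integral>\<^sup>+w. indicator G (Z w) * emeasure (PiM J (\<lambda>_. K (Z w))) {y \<in> space (PiM J (\<lambda>_. MY)). (Z w, y) \<in> Q} \<partial>M)"
proof -
  define PK where "PK z = PiM J (\<lambda>_. K z)" for z
  have PK[measurable]: "PK \<in> MZ \<rightarrow>\<^sub>M prob_algebra (PiM J (\<lambda>_. MY))"
    unfolding PK_def by (rule measurable_PiM_kernel[OF J K])
  note PKD = prob_kernelD[OF PK]
  have PKs[measurable]: "PK \<in> MZ \<rightarrow>\<^sub>M subprob_algebra (PiM J (\<lambda>_. MY))"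
    by (rule measurable_prob_algebraD[OF PK])
  have Yr[measurable]: "(\<lambda>w. \<lambda>i\<in>J. Y i w) \<in> M \<rightarrow>\<^sub>M PiM J (\<lambda>_. MY)"
    by (rule measurable_restrict) (rule Y)
  let ?MQ = "MZ \<Otimes>\<^sub>M PiM J (\<lambda>_. MY)"
  \<comment> \<open>\<open>\<mu>1\<close> is the actual joint law on the event that \<open>Z\<close>
    lies in \<open>G\<close>; \<open>\<mu>2\<close> redraws the family \<open>Y\<close> from the
    product kernel. Making the cut in the density, not in the kernel, leaves \<open>F\<close> a
    kernel at every point.\<close>
  define D where "D = density M (\<lambda>w. indicator G (Z w) :: ennreal)"
  define \<mu>1 where "\<mu>1 = distr D ?MQ (\<lambda>w. (Z w, \<lambda>i\<in>J. Y i w))"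
  define F where "F w = distr (PK (Z w)) ?MQ (\<lambda>y. (Z w, y))" for w
  have F[measurable]: "F \<in> D \<rightarrow>\<^sub>M subprob_algebra ?MQ"
    unfolding F_def D_def by (rule measurable_distr2[where M="PiM J (\<lambda>_. MY)"]) measurable
  define \<mu>2 where "\<mu>2 = D \<bind> F"
  have Dsp: "space D = space M" "sets D = sets M" by (simp_all add: D_def)
  have m1: "emeasure \<mu>1 R = emeasure M {w \<in> space M. Z w \<in> G \<and> (Z w, \<lambda>i\<in>J. Y i w) \<in> R}"
    if R[measurable]: "R \<in> sets ?MQ" for R
  proof -
    have "emeasure \<mu>1 R = emeasure D ((\<lambda>w. (Z w, \<lambda>i\<in>J. Y i w)) -` R \<inter> space M)"
      unfolding \<mu>1_def by (subst emeasure_distr) (auto simp: D_def)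
    also have "\<dots> = (\<integral>\<^sup>+w. indicator G (Z w) * indicator ((\<lambda>w. (Z w, \<lambda>i\<in>J. Y i w)) -` R \<inter> space M) w \<partial>M)"
      unfolding D_def by (subst emeasure_density) auto
    also have "\<dots> = (\<integral>\<^sup>+w. indicator {w \<in> space M. Z w \<in> G \<and> (Z w, \<lambda>i\<in>J. Y i w) \<in> R} w \<partial>M)"
      by (intro nn_integral_cong) (auto simp: indicator_def)
    also have "\<dots> = emeasure M {w \<in> space M. Z w \<in> G \<and> (Z w, \<lambda>i\<in>J. Y i w) \<in> R}"
      by (rule nn_integral_indicator) measurable
    finally show ?thesis .
  qed
  have m2: "emeasure \<mu>2 R = (\<integral>\<^sup>+w. indicator G (Z w) * emeasure (PK (Z w)) {y \<in> space (PiM J (\<lambda>_. MY)). (Z w, y) \<in> R} \<partial>M)"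
    if R[measurable]: "R \<in> sets ?MQ" for R
  proof -
    have Fe: "emeasure (F w) R = emeasure (PK (Z w)) {y \<in> space (PiM J (\<lambda>_. MY)). (Z w, y) \<in> R}"
      if w: "w \<in> space M" for w
    proof -
      have z: "Z w \<in> space MZ" using measurable_space[OF Z w] .
      note [measurable_cong] = PKD(2)[OF z]
      show ?thesis unfolding F_def
        using z sets.sets_into_space[OF R]
        by (subst emeasure_distr)
          (auto simp: PKD(3)[OF z] space_pair_measure intro!: arg_cong2[where f=emeasure])
    qed
    have "emeasure \<mu>2 R = (\<integral>\<^sup>+w. emeasure (F w) R \<partial>D)"
      unfolding \<mu>2_def using not_empty by (intro emeasure_bind[OF _ F R]) (simp add: Dsp)
    also have "\<dots> = (\<integral>\<^sup>+w. indicator G (Z w) * emeasure (F w) R \<partial>M)"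
      unfolding D_def
      using measurable_emeasure_kernel[OF F R]
      by (subst nn_integral_density) (auto simp: D_def)
    finally show ?thesis by (simp add: Fe cong: nn_integral_cong_simp)
  qed
  define E where "E = {A \<times> Pi\<^sub>E J B |A B. A \<in> sets MZ \<and> (\<forall>i\<in>J. B i \<in> sets MY)}"
  have EP: "E \<subseteq> Pow (space ?MQ)"
  proof
    fix X assume "X \<in> E"
    then obtain A B where X: "X = A \<times> Pi\<^sub>E J B" "A \<in> sets MZ" "\<forall>i\<in>J. B i \<in> sets MY"
      unfolding E_def by blast
    then have "A \<subseteq> space MZ" "Pi\<^sub>E J B \<subseteq> space (PiM J (\<lambda>_. MY))"
      by (auto simp: space_PiM dest: sets.sets_into_space intro!: PiE_mono)
    then show "X \<in> Pow (space ?MQ)" unfolding X space_pair_measure by blast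
  qed
  have "\<mu>1 = \<mu>2"
  proof (rule measure_eqI_generator_eq[where E=E and \<Omega>="space ?MQ" and A="\<lambda>_. space ?MQ"])
    have gen: "sets ?MQ = sigma_sets (space ?MQ) E"
    proof -
      have "sets ?MQ = sets (sigma (space ?MQ) {A \<times> B |A B. A \<in> sets MZ \<and> B \<in> prod_algebra J (\<lambda>_. MY)})"
        unfolding space_pair_measure
        by (rule sets_pair_eq[where Ca="{space MZ}" and Cb="{space (PiM J (\<lambda>_. MY))}"])
          (auto simp: sets.space_closed sets_PiM space_PiM sets.sigma_sets_eq
             prod_algebra_sets_into_space space_in_prod_algebra[of J "\<lambda>_. MY", simplified]
             dest: sets.sets_into_space)
      also have "{A \<times> B |A B. A \<in> sets MZ \<and> B \<in> prod_algebra J (\<lambda>_. MY)} = E"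
      proof (intro set_eqI iffI)
        fix X assume "X \<in> {A \<times> B |A B. A \<in> sets MZ \<and> B \<in> prod_algebra J (\<lambda>_. MY)}"
        then obtain A C where "X = A \<times> C" "A \<in> sets MZ" "C \<in> prod_algebra J (\<lambda>_. MY)" by blast
        moreover from this(3) obtain B where "C = Pi\<^sub>E J B" "\<forall>i\<in>J. B i \<in> sets MY"
          unfolding prod_algebra_eq_finite[OF J] by auto
        ultimately show "X \<in> E" unfolding E_def by blast
      next
        fix X assume "X \<in> E"
        then obtain A B where "X = A \<times> Pi\<^sub>E J B" "A \<in> sets MZ" and B: "\<forall>i\<in>J. B i \<in> sets MY"
          unfolding E_def by blast
        moreover have "Pi\<^sub>E J B \<in> prod_algebra J (\<lambda>_. MY)"
          by (rule prod_algebraI_finite[OF J B])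
        ultimately show "X \<in> {A \<times> B |A B. A \<in> sets MZ \<and> B \<in> prod_algebra J (\<lambda>_. MY)}"
          by blast
      qed
      finally show ?thesis
        unfolding sets_measure_of[OF EP] .
    qed
    show "sets \<mu>1 = sigma_sets (space ?MQ) E" unfolding gen[symmetric] by (simp add: \<mu>1_def)
    show "sets \<mu>2 = sigma_sets (space ?MQ) E" unfolding gen[symmetric] \<mu>2_def
      using not_empty by (intro sets_bind[OF subprob_measurableD(2)[OF F]]) (auto simp: Dsp)
    show "E \<subseteq> Pow (space ?MQ)" by (rule EP)
    show "Int_stable E"
    proof (rule Int_stableI)
      fix a b assume "a \<in> E" "b \<in> E"
      then obtain A B A' B' where "a = A \<times> Pi\<^sub>E J B" "b = A' \<times> Pi\<^sub>E J B'"
        and *: "A \<in> sets MZ" "A' \<in> sets MZ" "\<forall>i\<in>J. B i \<in> sets MY" "\<forall>i\<in>J. B' i \<in> sets MY"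
        by (auto simp: E_def)
      then have "a \<inter> b = (A \<inter> A') \<times> Pi\<^sub>E J (\<lambda>i. B i \<inter> B' i)"
        by (auto simp: PiE_iff)
      with * show "a \<inter> b \<in> E" unfolding E_def by blast
    qed
    show "range (\<lambda>_::nat. space ?MQ) \<subseteq> E"
      unfolding E_def space_pair_measure space_PiM by (auto intro!: exI[of _ "\<lambda>_. space MY"])
    show "emeasure \<mu>1 (space ?MQ) \<noteq> \<infinity>"
      by (subst m1) (auto simp: emeasure_eq_measure)
    fix X assume "X \<in> E"
    then obtain A B where X: "X = A \<times> Pi\<^sub>E J B" and A[measurable]: "A \<in> sets MZ"
      and B[measurable]: "\<And>i. i \<in> J \<Longrightarrow> B i \<in> sets MY"
      by (auto simp: E_def)
    have Xs: "X \<in> sets ?MQ" unfolding X using J by (auto intro!: sets_PiM_I_finite)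
    \<comment> \<open>On rectangles the two measures agree by \<open>cond\<close>. That hypothesis
      covers only subsets of \<open>G\<close>, and the cut by \<open>G\<close> built into both
      measures supplies the intersection.\<close>
    have "emeasure \<mu>1 X = emeasure M {w \<in> space M. Z w \<in> G \<inter> A \<and> (\<forall>i\<in>J. Y i w \<in> B i)}"
      unfolding m1[OF Xs] by (intro arg_cong2[where f=emeasure]) (auto simp: X PiE_iff)
    also have "\<dots> = (\<integral>\<^sup>+w. indicator (G \<inter> A) (Z w) * (\<Prod>i\<in>J. emeasure (K (Z w)) (B i)) \<partial>M)"
      by (rule cond) auto
    also have "\<dots> = emeasure \<mu>2 X"
      unfolding m2[OF Xs]
    proof (intro nn_integral_cong)
      fix w assume w: "w \<in> space M"
      have z: "Z w \<in> space MZ" using measurable_space[OF Z w] .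
      note k = prob_kernelD[OF K z]
      have "{y \<in> space (PiM J (\<lambda>_. MY)). (Z w, y) \<in> X} = (if Z w \<in> A then Pi\<^sub>E J B else {})"
        using B[THEN sets.sets_into_space] by (auto simp: X space_PiM PiE_iff extensional_def)
      then show "indicator (G \<inter> A) (Z w) * (\<Prod>i\<in>J. emeasure (K (Z w)) (B i)) =
        indicator G (Z w) * emeasure (PK (Z w)) {y \<in> space (PiM J (\<lambda>_. MY)). (Z w, y) \<in> X}"
        using B J k by (auto simp: PK_def emeasure_PiM_const indicator_def)
    qed
    finally show "emeasure \<mu>1 X = emeasure \<mu>2 X" .
  qed auto
  then show ?thesis using m1[OF Q] m2[OF Q] by (simp add: PK_def)
qed

text \<open>Given \<open>Z = z\<close> in \<open>G\<close>, the family \<open>Y\<close> is an i.i.d.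
  sample from \<open>K z\<close>, so the ordinary inequality applies on the product space to the
  single function \<open>f z\<close>. Its bound does not depend on z and survives integration over
  the law of \<open>Z\<close>.\<close>

lemma (in prob_space) conditional_hoeffding:
  fixes f :: "'z \<Rightarrow> 'y \<Rightarrow> real"
  assumes J: "finite J" "J \<noteq> {}" and Z[measurable]: "Z \<in> M \<rightarrow>\<^sub>M MZ"
    and Y[measurable]: "\<And>i. i \<in> J \<Longrightarrow> Y i \<in> M \<rightarrow>\<^sub>M MY"
    and G[measurable]: "G \<in> sets MZ"
    and K[measurable]: "K \<in> MZ \<rightarrow>\<^sub>M prob_algebra MY"
    and cond: "\<And>A B. A \<in> sets MZ \<Longrightarrow> A \<subseteq> G \<Longrightarrow> (\<And>i. i \<in> J \<Longrightarrow> B i \<in> sets MY) \<Longrightarrow>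
       emeasure M {w \<in> space M. Z w \<in> A \<and> (\<forall>i\<in>J. Y i w \<in> B i)} =
       (\<integral>\<^sup>+w. indicator A (Z w) * (\<Prod>i\<in>J. emeasure (K (Z w)) (B i)) \<partial>M)"
    and f[measurable]: "(\<lambda>(z, y). f z y) \<in> borel_measurable (MZ \<Otimes>\<^sub>M MY)"
    and bd: "\<And>z y. z \<in> G \<Longrightarrow> y \<in> space MY \<Longrightarrow> \<bar>f z y\<bar> \<le> c" and c: "0 < c" and e: "0 \<le> e"
  shows "prob {w \<in> space M. Z w \<in> G \<and>
      real (card J) * e \<le> \<bar>(\<Sum>i\<in>J. f (Z w) (Y i w)) - real (card J) * (\<integral>y. f (Z w) y \<partial>K (Z w))\<bar>}
    \<le> 2 * exp (- (real (card J) * e\<^sup>2 / (2 * c\<^sup>2)))" (is "prob ?E \<le> ?r")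
proof -
  have mean[measurable]: "(\<lambda>z. \<integral>y. f z y \<partial>K z) \<in> borel_measurable MZ"
    by (rule measurable_integral_kernel[OF f K])
  define Q where "Q = {zy \<in> space (MZ \<Otimes>\<^sub>M PiM J (\<lambda>_. MY)). real (card J) * e \<le>
     \<bar>(\<Sum>i\<in>J. f (fst zy) (snd zy i)) - real (card J) * (\<integral>y. f (fst zy) y \<partial>K (fst zy))\<bar>}"
  have [measurable]: "(\<lambda>zy. f (fst zy) (snd zy i)) \<in> borel_measurable (MZ \<Otimes>\<^sub>M PiM J (\<lambda>_. MY))"
    if "i \<in> J" for i
    using that measurable_compose[OF _ f, of "\<lambda>zy. (fst zy, snd zy i)" "MZ \<Otimes>\<^sub>M PiM J (\<lambda>_. MY)"]
    by simp
  have [measurable]: "Q \<in> sets (MZ \<Otimes>\<^sub>M PiM J (\<lambda>_. MY))"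
    unfolding Q_def by measurable
  have "?E = {w \<in> space M. Z w \<in> G \<and> (Z w, \<lambda>i\<in>J. Y i w) \<in> Q}"
  proof (rule Collect_cong, rule conj_cong[OF refl], rule conj_cong[OF refl])
    fix w assume "w \<in> space M"
    then have "(Z w, \<lambda>i\<in>J. Y i w) \<in> space (MZ \<Otimes>\<^sub>M PiM J (\<lambda>_. MY))"
      using measurable_space[OF Z] measurable_space[OF Y]
      by (auto simp: space_pair_measure space_PiM)
    then show "(real (card J) * e \<le> \<bar>(\<Sum>i\<in>J. f (Z w) (Y i w)) - real (card J) * (\<integral>y. f (Z w) y \<partial>K (Z w))\<bar>)
       = ((Z w, \<lambda>i\<in>J. Y i w) \<in> Q)"
      by (simp add: Q_def)
  qed
  then have "emeasure M ?E = emeasure M {w \<in> space M. Z w \<in> G \<and> (Z w, \<lambda>i\<in>J. Y i w) \<in> Q}"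
    by (rule arg_cong)
  also have "\<dots> =
     (\<integral>\<^sup>+w. indicator G (Z w) * emeasure (PiM J (\<lambda>_. K (Z w))) {y \<in> space (PiM J (\<lambda>_. MY)). (Z w, y) \<in> Q} \<partial>M)"
    by (rule joint_law_from_conditional[OF J(1) Z Y G K cond \<open>Q \<in> _\<close>])
  also have "\<dots> \<le> (\<integral>\<^sup>+w. ennreal ?r \<partial>M)"
  proof (rule nn_integral_mono)
    fix w assume w: "w \<in> space M"
    define z where "z = Z w"
    have z: "z \<in> space MZ" using measurable_space[OF Z w] by (simp add: z_def)
    note k = prob_kernelD[OF K z]
    note [measurable_cong] = k(2)
    show "indicator G (Z w) * emeasure (PiM J (\<lambda>_. K (Z w))) {y \<in> space (PiM J (\<lambda>_. MY)). (Z w, y) \<in> Q} \<le> ennreal ?r"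
    proof (cases "z \<in> G")
      case True
      interpret P: prob_space "PiM J (\<lambda>_. K z)" using k(1) by (intro prob_space_PiM)
      interpret Kz: prob_space "K z" by fact
      interpret PP: product_prob_space "\<lambda>_. K z" J by unfold_locales
      have sp: "space (PiM J (\<lambda>_. K z)) = space (PiM J (\<lambda>_. MY))"
        by (simp add: space_PiM k(3))
      have fz[measurable]: "f z \<in> borel_measurable (K z)"
        using z by measurable
      have d: "distr (PiM J (\<lambda>_. K z)) (K z) (\<lambda>y. y i) = K z" if "i \<in> J" for i
        using that by (rule PP.PiM_component)
      \<comment> \<open>The coordinates of a product measure are independent: their joint law is the
        image under the identity, hence the product of the marginals.\<close>
      have ind: "P.indep_vars (\<lambda>_. K z) (\<lambda>i y. y i) J"
      proof (subst P.indep_vars_iff_distr_eq_PiM')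
        have "distr (PiM J (\<lambda>_. K z)) (PiM J (\<lambda>_. K z)) (\<lambda>x. \<lambda>i\<in>J. x i) =
          distr (PiM J (\<lambda>_. K z)) (PiM J (\<lambda>_. K z)) (\<lambda>x. x)"
          by (intro distr_cong) (auto simp: space_PiM)
        also have "\<dots> = PiM J (\<lambda>_. K z)" by (simp add: distr_id)
        also have "\<dots> = (\<Pi>\<^sub>M i\<in>J. distr (PiM J (\<lambda>_. K z)) (K z) (\<lambda>y. y i))"
          by (intro PiM_cong) (auto simp: d)
        finally show "distr (PiM J (\<lambda>_. K z)) (PiM J (\<lambda>_. K z)) (\<lambda>x. \<lambda>i\<in>J. x i) =
           (\<Pi>\<^sub>M i\<in>J. distr (PiM J (\<lambda>_. K z)) (K z) (\<lambda>y. y i))" .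
      qed (use J in auto)
      have "P.prob {y \<in> space (PiM J (\<lambda>_. K z)). real (card J) * e \<le>
           \<bar>(\<Sum>i\<in>J. f z (y i)) - real (card J) * (\<integral>y. f z y \<partial>K z)\<bar>} \<le> ?r"
        using bd[OF True] c e
        by (intro P.hoeffding_iid[OF J ind d fz]) (auto simp: k(3))
      also have "{y \<in> space (PiM J (\<lambda>_. K z)). real (card J) * e \<le>
           \<bar>(\<Sum>i\<in>J. f z (y i)) - real (card J) * (\<integral>y. f z y \<partial>K z)\<bar>} =
          {y \<in> space (PiM J (\<lambda>_. MY)). (z, y) \<in> Q}"
        using z by (auto simp: Q_def sp space_pair_measure)
      finally show ?thesis
        by (simp add: z_def[symmetric] True P.emeasure_eq_measure ennreal_leI)
    qed (simp add: z_def)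
  qed
  also have "\<dots> = ennreal ?r" by (simp add: emeasure_space_1)
  finally show ?thesis by (simp add: emeasure_eq_measure)
qed

section \<open>Integrals of bounded and of positive functions over a probability space\<close>

lemma prob_integral_bound:
  fixes f :: "'a \<Rightarrow> real"
  assumes "prob_space M" "f \<in> borel_measurable M" "\<And>x. x \<in> space M \<Longrightarrow> \<bar>f x\<bar> \<le> c"
  shows "\<bar>\<integral>x. f x \<partial>M\<bar> \<le> c"
proof -
  interpret prob_space M by fact
  have "integrable M f" using assms by (intro integrable_const_bound[where B=c]) auto
  then have "(\<integral>x. \<bar>f x\<bar> \<partial>M) \<le> (\<integral>x. c \<partial>M)"
    using assms(3) by (intro integral_mono) auto
  then show ?thesis
    by (intro order_trans[OF integral_abs_bound]) (simp add: prob_space)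
qed

lemma prob_integral_pos:
  fixes f :: "'a \<Rightarrow> real"
  assumes "prob_space M" "integrable M f" "\<And>x. x \<in> space M \<Longrightarrow> 0 < f x"
  shows "0 < (\<integral>x. f x \<partial>M)"
proof -
  interpret prob_space M by fact
  have "(\<integral>x. f x \<partial>M) \<noteq> 0"
  proof
    assume "(\<integral>x. f x \<partial>M) = 0"
    then have "AE x in M. f x = 0"
      using assms by (subst (asm) integral_nonneg_eq_0_iff_AE) (auto intro!: AE_I2 less_imp_le)
    moreover have "AE x in M. f x \<noteq> 0" using assms(3) by (intro AE_I2) force
    ultimately have "AE x in M. False" by eventually_elim simp
    then show False by (simp add: AE_False)
  qed
  moreover have "0 \<le> (\<integral>x. f x \<partial>M)"
    using assms by (intro integral_nonneg_AE AE_I2) (auto intro: less_imp_le)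
  ultimately show ?thesis by simp
qed

section \<open>Exponentially fast convergence in probability\<close>

text \<open>The bound is asked for every \<open>N\<close> from 1 on and not just eventually, since
  the deviation inequality is claimed for every such \<open>N\<close>.\<close>

definition exp_small :: "(nat \<Rightarrow> real) \<Rightarrow> bool" where
  "exp_small p \<longleftrightarrow> (\<exists>B>0. \<exists>C>0. \<forall>N\<ge>1. p N \<le> B * exp (- C * real N))"

text \<open>Convergence in probability would give the second assertion; the exponential rate is what
  lets the events of small denominators be absorbed in the deviation inequality.\<close>

definition exp_conv :: "(nat \<Rightarrow> 'w measure) \<Rightarrow> (nat \<Rightarrow> 'w \<Rightarrow> real) \<Rightarrow> real \<Rightarrow> bool" where
  "exp_conv P X c \<longleftrightarrow> (\<forall>N\<ge>1. X N \<in> borel_measurable (P N)) \<and>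
     (\<forall>\<epsilon>>0. exp_small (\<lambda>N. measure (P N) {w \<in> space (P N). \<epsilon> \<le> \<bar>X N w - c\<bar>}))"

lemma exp_smallI:
  assumes "0 \<le> B" "0 < C" "\<And>N. N \<ge> 1 \<Longrightarrow> p N \<le> B * exp (- C * real N)"
  shows "exp_small p"
  unfolding exp_small_def
\<comment> \<open>\<open>exp_small\<close> asks for a positive factor, while \<open>B\<close> may be
  0 here.\<close>
proof (rule exI[of _ "B + 1"], rule conjI, use assms in simp, rule exI[of _ C], intro conjI allI impI)
  fix N :: nat assume "1 \<le> N"
  then have "p N \<le> B * exp (- C * real N)" by (rule assms)
  also have "\<dots> \<le> (B + 1) * exp (- C * real N)" by (intro mult_right_mono) auto
  finally show "p N \<le> (B + 1) * exp (- C * real N)" .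
qed (use assms in auto)

lemma exp_small_add:
  assumes "exp_small p" "exp_small q"
  shows "exp_small (\<lambda>N. p N + q N)"
proof -
  obtain B C where p: "0 < B" "0 < C" "\<And>N. N \<ge> 1 \<Longrightarrow> p N \<le> B * exp (- C * real N)"
    using assms(1) by (auto simp: exp_small_def)
  obtain B' C' where q: "0 < B'" "0 < C'" "\<And>N. N \<ge> 1 \<Longrightarrow> q N \<le> B' * exp (- C' * real N)"
    using assms(2) by (auto simp: exp_small_def)
  show ?thesis
  proof (rule exp_smallI[where B="B + B'" and C="min C C'"])
    fix N :: nat assume N: "1 \<le> N"
    have "p N + q N \<le> B * exp (- C * real N) + B' * exp (- C' * real N)"
      using p(3)[OF N] q(3)[OF N] by (rule add_mono)
    also have "\<dots> \<le> B * exp (- min C C' * real N) + B' * exp (- min C C' * real N)"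
      using p q by (intro add_mono mult_left_mono) (auto intro!: mult_right_mono)
    finally show "p N + q N \<le> (B + B') * exp (- min C C' * real N)"
      by (simp add: distrib_right)
  qed (use p q in auto)
qed

lemma exp_small_mono:
  assumes "exp_small q" "\<And>N. N \<ge> 1 \<Longrightarrow> p N \<le> q N"
  shows "exp_small p"
  using assms unfolding exp_small_def by (meson order_trans)

lemma exp_small_tendsto:
  assumes "exp_small p" "\<And>N. 0 \<le> p N"
  shows "p \<longlonglongrightarrow> 0"
proof -
  obtain B C where p: "0 < B" "0 < C" "\<And>N. N \<ge> 1 \<Longrightarrow> p N \<le> B * exp (- C * real N)"
    using assms(1) by (auto simp: exp_small_def)
  have "(\<lambda>N. exp (- C) ^ N) \<longlonglongrightarrow> 0"
    using p by (intro LIMSEQ_power_zero) auto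
  then have "(\<lambda>N. B * exp (- C * real N)) \<longlonglongrightarrow> B * 0"
    by (intro tendsto_mult tendsto_const) (simp add: exp_of_nat_mult[symmetric] mult.commute)
  then have l: "(\<lambda>N. B * exp (- C * real N)) \<longlonglongrightarrow> 0"
    by simp
  show ?thesis
    by (rule tendsto_sandwich[OF _ _ tendsto_const l])
      (use assms(2) p(3) in \<open>auto intro!: always_eventually eventually_sequentiallyI[of 1]\<close>)
qed

lemma exp_conv_measurable: "exp_conv P X c \<Longrightarrow> N \<ge> 1 \<Longrightarrow> X N \<in> borel_measurable (P N)"
  by (simp add: exp_conv_def)

lemma exp_conv_small:
  "exp_conv P X c \<Longrightarrow> 0 < e \<Longrightarrow> exp_small (\<lambda>N. measure (P N) {w \<in> space (P N). e \<le> \<bar>X N w - c\<bar>})"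
  by (simp add: exp_conv_def)

lemma exp_conv_tendsto_in_probability:
  "exp_conv P X c \<Longrightarrow> tendsto_in_probability P X c"
  unfolding tendsto_in_probability_def
  by (intro allI impI exp_small_tendsto exp_conv_small) auto

text \<open>Used with a positive limit c and \<open>d\<close> half of it: averages that stand in
  denominators stay away from 0 up to exponentially small probability.\<close>

lemma exp_conv_less:
  assumes P: "\<And>N. N \<ge> 1 \<Longrightarrow> prob_space (P N)" and X: "exp_conv P X c" and d: "d < c"
  shows "exp_small (\<lambda>N. measure (P N) {w \<in> space (P N). X N w < d})"
proof (rule exp_small_mono[OF exp_conv_small[OF X, of "c - d"]])
  fix N :: nat assume N: "1 \<le> N"
  interpret prob_space "P N" using P[OF N] .
  note [measurable] = exp_conv_measurable[OF X N]
  show "prob {w \<in> space (P N). X N w < d} \<le> prob {w \<in> space (P N). c - d \<le> \<bar>X N w - c\<bar>}"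
    by (intro finite_measure_mono) (auto simp: abs_real_def)
qed (use d in auto)

text \<open>In the induction over time, \<open>Y\<close> is the new particle average and
  \<open>X\<close> its mean given the history. One of the two distances must be at least half of the
  total.\<close>

lemma exp_conv_perturb:
  assumes P: "\<And>N. N \<ge> 1 \<Longrightarrow> prob_space (P N)" and X: "exp_conv P X c"
    and Y: "\<And>N. N \<ge> 1 \<Longrightarrow> Y N \<in> borel_measurable (P N)"
    and D: "\<And>e. 0 < e \<Longrightarrow> exp_small (\<lambda>N. measure (P N) {w \<in> space (P N). e \<le> \<bar>Y N w - X N w\<bar>})"
  shows "exp_conv P Y c"
  unfolding exp_conv_def
proof (intro conjI allI impI)
  fix e :: real assume e: "0 < e"
  show "exp_small (\<lambda>N. measure (P N) {w \<in> space (P N). e \<le> \<bar>Y N w - c\<bar>})"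
  proof (rule exp_small_mono[OF exp_small_add[OF D[of "e/2"] exp_conv_small[OF X, of "e/2"]]])
    fix N :: nat assume N: "1 \<le> N"
    interpret prob_space "P N" using P[OF N] .
    note [measurable] = exp_conv_measurable[OF X N] Y[OF N]
    have "prob {w \<in> space (P N). e \<le> \<bar>Y N w - c\<bar>} \<le>
      prob ({w \<in> space (P N). e / 2 \<le> \<bar>Y N w - X N w\<bar>} \<union> {w \<in> space (P N). e / 2 \<le> \<bar>X N w - c\<bar>})"
    proof (rule finite_measure_mono, safe)
      fix w assume "w \<in> space (P N)" "e \<le> \<bar>Y N w - c\<bar>" "\<not> e / 2 \<le> \<bar>X N w - c\<bar>"
      then show "e / 2 \<le> \<bar>Y N w - X N w\<bar>" by linarith
    qed measurable
    also have "\<dots> \<le> prob {w \<in> space (P N). e / 2 \<le> \<bar>Y N w - X N w\<bar>} +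
        prob {w \<in> space (P N). e / 2 \<le> \<bar>X N w - c\<bar>}"
      by (rule measure_Un_le) measurable
    finally show "prob {w \<in> space (P N). e \<le> \<bar>Y N w - c\<bar>} \<le> \<dots>" .
  qed (use e in auto)
qed (use Y in auto)

text \<open>Exponential smallness is demanded at each fixed \<epsilon> separately, so plain
  continuity of division at (a, b) suffices, without any quantitative estimate. Zeros of
  \<open>Y\<close> only occur away from the limit and fall into the bad event.\<close>

lemma exp_conv_divide:
  assumes P: "\<And>N. N \<ge> 1 \<Longrightarrow> prob_space (P N)" and X: "exp_conv P X a"
    and Y: "exp_conv P Y b" and b: "b \<noteq> 0"
  shows "exp_conv P (\<lambda>N w. X N w / Y N w) (a / b)"
  unfolding exp_conv_def
proof (intro conjI allI impI)
  fix e :: real assume e: "0 < e"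
  have "isCont (\<lambda>p. fst p / snd p) (a, b)"
    using b by (intro continuous_intros) auto
  then obtain d where d: "0 < d" "\<And>p. dist p (a, b) < d \<Longrightarrow> dist (fst p / snd p) (a / b) < e"
    using e unfolding continuous_at_eps_delta by force
  show "exp_small (\<lambda>N. measure (P N) {w \<in> space (P N). e \<le> \<bar>X N w / Y N w - a / b\<bar>})"
  proof (rule exp_small_mono[OF exp_small_add[OF exp_conv_small[OF X, of "d/2"] exp_conv_small[OF Y, of "d/2"]]])
    fix N :: nat assume N: "1 \<le> N"
    interpret prob_space "P N" using P[OF N] .
    note [measurable] = exp_conv_measurable[OF X N] exp_conv_measurable[OF Y N]
    have "prob {w \<in> space (P N). e \<le> \<bar>X N w / Y N w - a / b\<bar>} \<le>
      prob ({w \<in> space (P N). d / 2 \<le> \<bar>X N w - a\<bar>} \<union> {w \<in> space (P N). d / 2 \<le> \<bar>Y N w - b\<bar>})"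
    proof (rule finite_measure_mono, safe)
      fix w assume "w \<in> space (P N)" and *: "e \<le> \<bar>X N w / Y N w - a / b\<bar>" and
        **: "\<not> d / 2 \<le> \<bar>Y N w - b\<bar>"
      have "\<not> dist (X N w, Y N w) (a, b) < d"
        using d(2)[of "(X N w, Y N w)"] * by (auto simp: dist_real_def)
      moreover have "dist (X N w, Y N w) (a, b) \<le> \<bar>X N w - a\<bar> + \<bar>Y N w - b\<bar>"
        unfolding dist_Pair_Pair dist_real_def by (metis sqrt_sum_squares_le_sum_abs abs_abs)
      ultimately show "d / 2 \<le> \<bar>X N w - a\<bar>" using ** by linarith
    qed measurable
    also have "\<dots> \<le> prob {w \<in> space (P N). d / 2 \<le> \<bar>X N w - a\<bar>} +
        prob {w \<in> space (P N). d / 2 \<le> \<bar>Y N w - b\<bar>}"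
      by (rule measure_Un_le) measurable
    finally show "prob {w \<in> space (P N). e \<le> \<bar>X N w / Y N w - a / b\<bar>} \<le> \<dots>" .
  qed (use d in auto)
qed (use exp_conv_measurable[OF X] exp_conv_measurable[OF Y] in auto)

section \<open>Paths, backward sums and forward integrals\<close>

text \<open>Coordinates before \<open>t\<close> are placeholders that a backward sum overwrites
  before the function is evaluated; after \<open>t\<close>, \<open>undefined\<close> is what
  extensionality demands.\<close>

abbreviation single :: "nat \<Rightarrow> 'x \<Rightarrow> nat \<Rightarrow> 'x" where
  "single t x \<equiv> (\<lambda>_. undefined)(t := x)"

lemma measurable_single[measurable (raw)]:
  "f \<in> M \<rightarrow>\<^sub>M borel \<Longrightarrow> (\<lambda>z. single t (f z)) \<in> M \<rightarrow>\<^sub>M path_space t"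
  by (rule measurable_PiM_single') (auto simp: space_PiM PiE_iff extensional_def split: if_splits)

lemma single_in_space[simp]: "single t x \<in> space (path_space t)"
  by (auto simp: space_PiM PiE_iff extensional_def)

lemma measurable_path_upd[measurable (raw)]:
  assumes "f \<in> M \<rightarrow>\<^sub>M path_space n" "g \<in> M \<rightarrow>\<^sub>M borel" "t \<le> n"
  shows "(\<lambda>z. (f z)(t := g z)) \<in> M \<rightarrow>\<^sub>M path_space n"
  using assms by (intro measurable_fun_upd[where J="{..n}"]) auto

lemma measurable_path_extend[measurable (raw)]:
  assumes "f \<in> M \<rightarrow>\<^sub>M path_space t" "g \<in> M \<rightarrow>\<^sub>M borel"
  shows "(\<lambda>z. (f z)(Suc t := g z)) \<in> M \<rightarrow>\<^sub>M path_space (Suc t)"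
  using assms by (intro measurable_fun_upd[where J="{..t}"]) auto

lemma path_extend_in_space: "x \<in> space (path_space t) \<Longrightarrow> x(Suc t := y) \<in> space (path_space (Suc t))"
  by (auto simp: space_PiM PiE_iff extensional_def)

lemma path_upd_in_space: "x \<in> space (path_space n) \<Longrightarrow> t \<le> n \<Longrightarrow> x(t := y) \<in> space (path_space n)"
  by (auto simp: space_PiM PiE_iff extensional_def)

text \<open>Membership in the path space restricts only the coordinates after
  \<open>n\<close>.\<close>

lemma path_agree_in_space:
  "x \<in> space (path_space n) \<Longrightarrow> t \<le> n \<Longrightarrow> (\<And>s. s \<ge> t \<Longrightarrow> y s = x s) \<Longrightarrow> y \<in> space (path_space n)"
  by (auto simp: space_PiM PiE_iff extensional_def)

text \<open>The masses that the backward kernel of a weighted sample gives to its points, with the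
  same convention for a zero denominator. Positions and weights are free arguments, so the formula
  can be evaluated both on a realisation and on a recorded history.\<close>

definition backward_weight ::
  "('x, 'y) smc_model \<Rightarrow> nat \<Rightarrow> (nat \<Rightarrow> nat \<Rightarrow> 'x) \<Rightarrow> (nat \<Rightarrow> nat \<Rightarrow> real) \<Rightarrow> nat \<Rightarrow> 'x \<Rightarrow> nat \<Rightarrow> real" where
  "backward_weight S N X W t y i =
     (if (\<Sum>k=1..N. W t k * trans_dens S (X t k) y) = 0 then W t i
      else W t i * trans_dens S (X t i) y / (\<Sum>k=1..N. W t k * trans_dens S (X t k) y))"

primrec backward_sum ::
  "('x, 'y) smc_model \<Rightarrow> nat \<Rightarrow> (nat \<Rightarrow> nat \<Rightarrow> 'x) \<Rightarrow> (nat \<Rightarrow> nat \<Rightarrow> real) \<Rightarrow> nat \<Rightarrow> (nat \<Rightarrow> 'x) \<Rightarrow>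
     ((nat \<Rightarrow> 'x) \<Rightarrow> real) \<Rightarrow> real" where
  "backward_sum S N X W 0 x h = h x"
| "backward_sum S N X W (Suc t) x h =
     (\<Sum>i=1..N. backward_weight S N X W t (x (Suc t)) i * backward_sum S N X W t (x(t := X t i)) h)"

definition smoothed_sum ::
  "('x, 'y) smc_model \<Rightarrow> nat \<Rightarrow> (nat \<Rightarrow> nat \<Rightarrow> 'x) \<Rightarrow> (nat \<Rightarrow> nat \<Rightarrow> real) \<Rightarrow> nat \<Rightarrow>
     ((nat \<Rightarrow> 'x) \<Rightarrow> real) \<Rightarrow> real" where
  "smoothed_sum S N X W t h = (\<Sum>i=1..N. W t i * backward_sum S N X W t (single t (X t i)) h)"

definition is_prob_weights :: "nat \<Rightarrow> (nat \<Rightarrow> real) \<Rightarrow> bool" where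
  "is_prob_weights N w \<longleftrightarrow> (\<forall>i\<in>{1..N}. 0 \<le> w i) \<and> (\<Sum>i=1..N. w i) = 1"

lemma convex_sum_between:
  fixes lo hi :: real
  assumes "is_prob_weights N w" "\<And>i. i \<in> {1..N} \<Longrightarrow> lo \<le> f i \<and> f i \<le> hi"
  shows "lo \<le> (\<Sum>i=1..N. w i * f i) \<and> (\<Sum>i=1..N. w i * f i) \<le> hi"
proof -
  have "(\<Sum>i=1..N. w i * lo) \<le> (\<Sum>i=1..N. w i * f i)" "(\<Sum>i=1..N. w i * f i) \<le> (\<Sum>i=1..N. w i * hi)"
    using assms by (auto intro!: sum_mono mult_left_mono simp: is_prob_weights_def)
  then show ?thesis using assms(1)
    by (simp add: sum_distrib_right[symmetric] is_prob_weights_def)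
qed

text \<open>The recursion replaces only coordinates below \<open>t\<close>, so \<open>h\<close> is
  evaluated only at paths that keep the rest of \<open>x\<close>.\<close>

lemma backward_sum_cong:
  assumes "\<And>y. (\<And>s. s \<ge> t \<Longrightarrow> y s = x s) \<Longrightarrow> h y = h' y"
  shows "backward_sum S N X W t x h = backward_sum S N X W t x h'"
  using assms
proof (induction t arbitrary: x)
  case (Suc t)
  show ?case unfolding backward_sum.simps
    by (intro sum.cong arg_cong2[where f="(*)"] refl Suc.IH) (auto intro!: Suc.prems)
qed simp

lemma backward_weight_cong:
  assumes "\<And>i. i \<in> {1..N} \<Longrightarrow> X t i = X' t i \<and> W t i = W' t i" "i \<in> {1..N}"
  shows "backward_weight S N X W t y i = backward_weight S N X' W' t y i"
  using assms by (auto simp: backward_weight_def cong: sum.cong_simp)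

text \<open>A backward sum from level \<open>t\<close> reads only particles strictly before
  \<open>t\<close>. This makes each summand at time t + 1 a function of the history up to t and the
  new position.\<close>

lemma backward_sum_cong_particles:
  assumes "\<And>s i. s < t \<Longrightarrow> i \<in> {1..N} \<Longrightarrow> X s i = X' s i \<and> W s i = W' s i"
  shows "backward_sum S N X W t x h = backward_sum S N X' W' t x h"
  using assms
proof (induction t arbitrary: x)
  case (Suc t)
  have "backward_weight S N X W t (x (Suc t)) i = backward_weight S N X' W' t (x (Suc t)) i"
    "backward_sum S N X W t (x(t := X t i)) h = backward_sum S N X' W' t (x(t := X' t i)) h" if "i \<in> {1..N}" for i
  proof -
    have X: "X t i = X' t i" using Suc.prems[of t i] that by simp
    show "backward_weight S N X W t (x (Suc t)) i = backward_weight S N X' W' t (x (Suc t)) i"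
      using Suc.prems that by (intro backward_weight_cong) auto
    show "backward_sum S N X W t (x(t := X t i)) h = backward_sum S N X' W' t (x(t := X' t i)) h"
      unfolding X by (rule Suc.IH) (use Suc.prems in auto)
  qed
  then show ?case by simp
qed simp

lemma smoothed_sum_cong:
  assumes "\<And>s i. s \<le> t \<Longrightarrow> i \<in> {1..N} \<Longrightarrow> X s i = X' s i \<and> W s i = W' s i"
  shows "smoothed_sum S N X W t h = smoothed_sum S N X' W' t h"
proof -
  have "backward_sum S N X W t x h = backward_sum S N X' W' t x h" for x
    using assms by (intro backward_sum_cong_particles) auto
  then show ?thesis unfolding smoothed_sum_def using assms by (intro sum.cong) auto
qed

text \<open>A backward sum is a finite linear combination whose coefficients read no coordinate
  above \<open>t\<close>, so integration over a later coordinate \<open>j\<close> moves inside.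
  Integrability is part of the claim because linearity consumes it at each level of the
  induction.\<close>

lemma backward_sum_integral:
  assumes "\<And>y'. (\<And>s. s \<ge> t \<Longrightarrow> y' s = y s) \<Longrightarrow> integrable \<mu> (\<lambda>x. c x * h (y'(j := x)))" "t < j"
  shows "integrable \<mu> (\<lambda>x. c x * backward_sum S N X W t (y(j := x)) h) \<and>
    (\<integral>x. c x * backward_sum S N X W t (y(j := x)) h \<partial>\<mu>) =
    backward_sum S N X W t y (\<lambda>y'. \<integral>x. c x * h (y'(j := x)) \<partial>\<mu>)"
  using assms
proof (induction t arbitrary: y)
  case 0
  then show ?case by auto
next
  case (Suc t)
  have IH: "integrable \<mu> (\<lambda>x. c x * backward_sum S N X W t (y(t := X t i, j := x)) h) \<and>
    (\<integral>x. c x * backward_sum S N X W t (y(t := X t i, j := x)) h \<partial>\<mu>) =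
    backward_sum S N X W t (y(t := X t i)) (\<lambda>y'. \<integral>x. c x * h (y'(j := x)) \<partial>\<mu>)" for i
  proof (rule Suc.IH)
    fix y' assume *: "\<And>s. s \<ge> t \<Longrightarrow> y' s = (y(t := X t i)) s"
    show "integrable \<mu> (\<lambda>x. c x * h (y'(j := x)))"
    proof (rule Suc.prems(1))
      fix s assume "s \<ge> Suc t" then show "y' s = y s" using *[of s] by simp
    qed
  qed (use Suc.prems in simp)
  have eq: "c x * backward_sum S N X W (Suc t) (y(j := x)) h =
    (\<Sum>i=1..N. backward_weight S N X W t (y (Suc t)) i *
      (c x * backward_sum S N X W t (y(t := X t i, j := x)) h))" for x
    using Suc.prems(2) by (simp add: sum_distrib_left fun_upd_twist[of t j] mult_ac)
  show ?case unfolding eq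
    using IH by (auto simp: Bochner_Integration.integral_sum fun_upd_def)
qed

text \<open>A single constant dominates all suprema in (A1) and (A2). Upper bounds are enough, since
  all these functions are nonnegative.\<close>

locale smc =
  fixes S :: "('x :: polish_space, 'y :: polish_space) smc_model" and T :: nat and K :: real
  assumes model: "standing_assumptions S T"
    and lik_pos: "t \<le> T \<Longrightarrow> 0 < lik_at S t x"
    and lik_le: "t \<le> T \<Longrightarrow> lik_at S t x \<le> K"
    and adj_le: "1 \<le> t \<Longrightarrow> t \<le> T \<Longrightarrow> adj_mult S t x \<le> K"
    and init_weight_le: "init_weight_fun S x \<le> K"
    and weight_le: "1 \<le> t \<Longrightarrow> t \<le> T \<Longrightarrow> weight_fun S t x x' \<le> K"
begin

lemma K_pos: "0 < K"
  using lik_pos[of 0 undefined] lik_le[of 0 undefined] by simp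

lemma measurable_lik[measurable]: "lik_at S t \<in> borel_measurable borel"
proof -
  have "(\<lambda>(x, y). likelihood S x y) \<in> borel_measurable (borel \<Otimes>\<^sub>M borel)"
    using model by (simp add: standing_assumptions_def)
  from measurable_compose[OF _ this, of "\<lambda>x. (x, observation S t)" borel]
  show ?thesis by (simp add: lik_at_def[abs_def])
qed

lemma init_law: "prob_space (init_law S)" "sets (init_law S) = sets borel"
  using model by (auto simp: standing_assumptions_def space_prob_algebra)

lemma init_prop: "prob_space (init_prop S)" "sets (init_prop S) = sets borel"
  using model by (auto simp: standing_assumptions_def space_prob_algebra)

lemma ref_meas: "sigma_finite_measure (ref_meas S)" "sets (ref_meas S) = sets borel"
  using model by (auto simp: standing_assumptions_def)

lemma trans_kernel[measurable]: "trans_kernel S \<in> borel \<rightarrow>\<^sub>M prob_algebra borel"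
  using model by (auto simp: standing_assumptions_def markov_kernel_density_def)

lemma trans_dens[measurable]: "(\<lambda>(x, x'). trans_dens S x x') \<in> borel_measurable (borel \<Otimes>\<^sub>M borel)"
  using model by (auto simp: standing_assumptions_def markov_kernel_density_def)

lemma trans_dens_nonneg: "0 \<le> trans_dens S x x'"
  using model by (auto simp: standing_assumptions_def markov_kernel_density_def)

lemma trans_kernel_density: "trans_kernel S x = density (ref_meas S) (\<lambda>x'. ennreal (trans_dens S x x'))"
  using model by (auto simp: standing_assumptions_def markov_kernel_density_def)

lemma trans_kernelD: "prob_space (trans_kernel S x)" "sets (trans_kernel S x) = sets borel"
  "space (trans_kernel S x) = UNIV"
  using prob_kernelD[OF trans_kernel, of x] by auto

lemma trans_kernel_integrable:
  fixes f :: "'x \<Rightarrow> real"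
  assumes "f \<in> borel_measurable borel" "\<And>x. \<bar>f x\<bar> \<le> c"
  shows "integrable (trans_kernel S x) f"
proof -
  interpret prob_space "trans_kernel S x" by (rule trans_kernelD)
  show ?thesis using assms
    by (intro integrable_const_bound[where B=c]) (auto cong: measurable_cong_sets simp: trans_kernelD(2))
qed

section \<open>Forward integrals as positive linear functionals\<close>

lemma forward_integral_bound_measurable:
  assumes "t + n \<le> T" "h \<in> borel_measurable (path_space (t + n))"
    "\<And>x. x \<in> space (path_space (t + n)) \<Longrightarrow> \<bar>h x\<bar> \<le> c"
  shows "(\<lambda>x. forward_integral S n t x h) \<in> borel_measurable (path_space t) \<and>
    (\<forall>x\<in>space (path_space t). \<bar>forward_integral S n t x h\<bar> \<le> K ^ n * c)"
  using assms
proof (induction n arbitrary: t)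
  case 0
  then show ?case by simp
next
  case (Suc n)
  have IH: "(\<lambda>x. forward_integral S n (Suc t) x h) \<in> borel_measurable (path_space (Suc t))"
    "\<And>x. x \<in> space (path_space (Suc t)) \<Longrightarrow> \<bar>forward_integral S n (Suc t) x h\<bar> \<le> K ^ n * c"
    using Suc.IH[of "Suc t"] Suc.prems by auto
  note [measurable] = IH(1)
  let ?f = "\<lambda>x x'. lik_at S (Suc t) x' * forward_integral S n (Suc t) (x(Suc t := x')) h"
  have "(\<lambda>x. \<integral>x'. ?f x x' \<partial>trans_kernel S (x t)) \<in> borel_measurable (path_space t)"
    by (rule measurable_integral_kernel[where N=borel]) measurable
  moreover have "\<bar>\<integral>x'. ?f x x' \<partial>trans_kernel S (x t)\<bar> \<le> K ^ Suc n * c" if x: "x \<in> space (path_space t)" for x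
  proof (rule prob_integral_bound[OF trans_kernelD(1)])
    have [measurable]: "(\<lambda>x'. x(Suc t := x')) \<in> borel \<rightarrow>\<^sub>M path_space (Suc t)"
      using x by (intro measurable_path_extend) auto
    note [measurable_cong] = trans_kernelD(2)
    show "?f x \<in> borel_measurable (trans_kernel S (x t))" by measurable
    fix x'
    have "\<bar>?f x x'\<bar> \<le> K * (K ^ n * c)"
      unfolding abs_mult using Suc.prems(1) K_pos lik_pos[of "Suc t" x'] lik_le[of "Suc t" x']
      by (intro mult_mono IH(2) path_extend_in_space x) auto
    then show "\<bar>?f x x'\<bar> \<le> K ^ Suc n * c" by (simp add: mult_ac)
  qed
  ultimately show ?case by simp
qed

lemmas measurable_forward_integral = forward_integral_bound_measurable[THEN conjunct1]
lemmas forward_integral_bound = forward_integral_bound_measurable[THEN conjunct2, rule_format]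

lemma forward_step_integrand:
  assumes "Suc t + n \<le> T" "h \<in> borel_measurable (path_space (Suc t + n))"
    "\<And>x. x \<in> space (path_space (Suc t + n)) \<Longrightarrow> \<bar>h x\<bar> \<le> c"
    and x: "x \<in> space (path_space t)"
  shows "integrable (trans_kernel S z) (\<lambda>x'. lik_at S (Suc t) x' * forward_integral S n (Suc t) (x(Suc t := x')) h)"
proof (rule trans_kernel_integrable)
  note [measurable] = measurable_forward_integral[OF assms(1-3)]
  have [measurable]: "(\<lambda>x'. x(Suc t := x')) \<in> borel \<rightarrow>\<^sub>M path_space (Suc t)"
    using x by (intro measurable_path_extend) auto
  show "(\<lambda>x'. lik_at S (Suc t) x' * forward_integral S n (Suc t) (x(Suc t := x')) h) \<in> borel_measurable borel"
    by measurable
  fix x'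
  show "\<bar>lik_at S (Suc t) x' * forward_integral S n (Suc t) (x(Suc t := x')) h\<bar> \<le> K * (K ^ n * c)"
    unfolding abs_mult using assms(1) K_pos lik_pos[of "Suc t" x'] lik_le[of "Suc t" x']
    by (intro mult_mono forward_integral_bound[OF assms(1-3)] path_extend_in_space x) auto
qed

lemma forward_integral_mono:
  assumes "t + n \<le> T" "h \<in> borel_measurable (path_space (t + n))" "h' \<in> borel_measurable (path_space (t + n))"
    "\<And>x. x \<in> space (path_space (t + n)) \<Longrightarrow> \<bar>h x\<bar> \<le> c" "\<And>x. x \<in> space (path_space (t + n)) \<Longrightarrow> \<bar>h' x\<bar> \<le> c"
    "\<And>x. x \<in> space (path_space (t + n)) \<Longrightarrow> h x \<le> h' x"
    and "x \<in> space (path_space t)"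
  shows "forward_integral S n t x h \<le> forward_integral S n t x h'"
  using assms
proof (induction n arbitrary: t x)
  case (Suc n)
  show ?case unfolding forward_integral.simps
  proof (rule integral_mono)
    fix x'
    show "lik_at S (Suc t) x' * forward_integral S n (Suc t) (x(Suc t := x')) h
         \<le> lik_at S (Suc t) x' * forward_integral S n (Suc t) (x(Suc t := x')) h'"
      using Suc.prems lik_pos[of "Suc t" x']
      by (intro mult_left_mono Suc.IH path_extend_in_space) auto
  qed (use Suc.prems in \<open>auto intro!: forward_step_integrand[where c=c]\<close>)
qed auto

lemma forward_integral_pos:
  assumes "t + n \<le> T" "h \<in> borel_measurable (path_space (t + n))"
    "\<And>x. x \<in> space (path_space (t + n)) \<Longrightarrow> \<bar>h x\<bar> \<le> c"
    "\<And>x. x \<in> space (path_space (t + n)) \<Longrightarrow> 0 < h x"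
    and "x \<in> space (path_space t)"
  shows "0 < forward_integral S n t x h"
  using assms
proof (induction n arbitrary: t x)
  case (Suc n)
  show ?case unfolding forward_integral.simps
  proof (rule prob_integral_pos[OF trans_kernelD(1)])
    fix x'
    show "0 < lik_at S (Suc t) x' * forward_integral S n (Suc t) (x(Suc t := x')) h"
      using Suc.prems lik_pos[of "Suc t" x']
      by (intro mult_pos_pos Suc.IH path_extend_in_space) auto
  qed (use Suc.prems in \<open>auto intro!: forward_step_integrand[where c=c]\<close>)
qed auto

lemma forward_integral_const: "forward_integral S n t x (\<lambda>_. c) = c * forward_integral S n t x (\<lambda>_. 1)"
proof (induction n arbitrary: t x)
  case (Suc n)
  have "forward_integral S (Suc n) t x (\<lambda>_. c) =
    (\<integral>x'. c * (lik_at S (Suc t) x' * forward_integral S n (Suc t) (x(Suc t := x')) (\<lambda>_. 1)) \<partial>trans_kernel S (x t))"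
    unfolding forward_integral.simps Suc.IH by (simp add: mult_ac)
  then show ?case by simp
qed simp

lemma forward_integral_one_cong:
  "x t = y t \<Longrightarrow> forward_integral S n t x (\<lambda>_. 1) = forward_integral S n t y (\<lambda>_. 1)"
proof (induction n arbitrary: t x y)
  case (Suc n)
  have "forward_integral S n (Suc t) (x(Suc t := x')) (\<lambda>_. 1) = forward_integral S n (Suc t) (y(Suc t := x')) (\<lambda>_. 1)" for x'
    by (rule Suc.IH) simp
  with Suc.prems show ?case by simp
qed simp

text \<open>The definition splits off the first transition; the recursion of the filter in time
  needs the last one split off.\<close>

lemma forward_integral_Suc_right:
  "forward_integral S (Suc n) t x h = forward_integral S n t x
     (\<lambda>y. \<integral>x'. lik_at S (t + Suc n) x' * h (y(t + Suc n := x')) \<partial>trans_kernel S (y (t + n)))"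
proof (induction n arbitrary: t x)
  case (Suc n)
  show ?case
    by (subst forward_integral.simps, subst Suc.IH) simp
qed simp

lemma forward_integral_lik_to_go:
  "forward_integral S (T - t) t x (\<lambda>_. 1) = lik_to_go S t T (x t)"
  unfolding lik_to_go_def by (rule forward_integral_one_cong) simp

lemma lik_to_go_T: "lik_to_go S T T x = 1"
  by (simp add: lik_to_go_def)

lemma lik_to_go_Suc:
  "t < T \<Longrightarrow> lik_to_go S t T x = (\<integral>x'. lik_at S (Suc t) x' * lik_to_go S (Suc t) T x' \<partial>trans_kernel S x)"
  using forward_integral_lik_to_go[of "Suc t"]
  by (simp add: lik_to_go_def[of S t] Suc_diff_Suc[symmetric])

lemma measurable_lik_to_go[measurable]: "t \<le> T \<Longrightarrow> lik_to_go S t T \<in> borel_measurable borel"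
  unfolding lik_to_go_def[abs_def]
  by (rule measurable_compose[OF measurable_single measurable_forward_integral[where c=1]]) auto

lemma lik_to_go_bounds:
  assumes "t \<le> T" shows "0 < lik_to_go S t T x" "lik_to_go S t T x \<le> K ^ (T - t)"
  using assms forward_integral_pos[of t "T - t" "\<lambda>_. 1" 1 "single t x"]
    forward_integral_bound[of t "T - t" "\<lambda>_. 1" 1 "single t x"]
  by (auto simp: lik_to_go_def)

text \<open>The forward integral is a positive functional whose value at 1 is
  \<open>lik_to_go\<close>; compare \<open>h\<close> with the constants \<open>lo\<close> and
  \<open>hi\<close>.\<close>

lemma forward_integral_between:
  assumes "t \<le> T" "h \<in> borel_measurable (path_space T)"
    "\<And>x. x \<in> space (path_space T) \<Longrightarrow> lo \<le> h x \<and> h x \<le> hi"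
    and "x \<in> space (path_space t)"
  shows "lo * lik_to_go S t T (x t) \<le> forward_integral S (T - t) t x h"
    "forward_integral S (T - t) t x h \<le> hi * lik_to_go S t T (x t)"
proof -
  have c: "\<bar>h x\<bar> \<le> max \<bar>lo\<bar> \<bar>hi\<bar>" if "x \<in> space (path_space T)" for x
    using assms(3)[OF that] by (auto simp: abs_real_def max_def)
  show "lo * lik_to_go S t T (x t) \<le> forward_integral S (T - t) t x h"
    using assms c unfolding forward_integral_lik_to_go[symmetric] forward_integral_const[symmetric]
    by (intro forward_integral_mono[where c="max \<bar>lo\<bar> \<bar>hi\<bar>"]) auto
  show "forward_integral S (T - t) t x h \<le> hi * lik_to_go S t T (x t)"
    using assms c unfolding forward_integral_lik_to_go[symmetric] forward_integral_const[symmetric]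
    by (intro forward_integral_mono[where c="max \<bar>lo\<bar> \<bar>hi\<bar>"]) auto
qed

text \<open>Without normalisation the recursion in time is linear, and the normalising constant
  cancels in every ratio that occurs.\<close>

definition unnormalised_filter :: "nat \<Rightarrow> ('x \<Rightarrow> real) \<Rightarrow> real" where
  "unnormalised_filter t f = unnormalised_smoothing S t (\<lambda>x. f (x t))"

lemma unnormalised_filter_0: "unnormalised_filter 0 f = (\<integral>x. lik_at S 0 x * f x \<partial>init_law S)"
  by (simp add: unnormalised_filter_def unnormalised_smoothing_def)

lemma unnormalised_filter_Suc:
  "unnormalised_filter (Suc t) f = unnormalised_filter t (\<lambda>x. \<integral>x'. lik_at S (Suc t) x' * f x' \<partial>trans_kernel S x)"
  unfolding unnormalised_filter_def unnormalised_smoothing_def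
  by (subst forward_integral_Suc_right) simp

lemma filter_expectation_ratio:
  "filter_expectation S t f / filter_expectation S t f' = unnormalised_filter t f / unnormalised_filter t f'"
  if "unnormalised_smoothing S t (\<lambda>_. 1) \<noteq> 0"
  using that by (simp add: filter_expectation_def joint_smoothing_def unnormalised_filter_def)

lemma init_integrand:
  assumes "t \<le> T" "h \<in> borel_measurable (path_space t)" "\<And>x. x \<in> space (path_space t) \<Longrightarrow> \<bar>h x\<bar> \<le> c"
  shows "integrable (init_law S) (\<lambda>x. lik_at S 0 x * forward_integral S t 0 (single 0 x) h)"
proof -
  interpret prob_space "init_law S" by (rule init_law)
  note [measurable_cong] = init_law(2)
  have 1: "(\<lambda>x. forward_integral S t 0 x h) \<in> borel_measurable (path_space 0)"
    and 2: "\<bar>forward_integral S t 0 (single 0 x) h\<bar> \<le> K ^ t * c" for x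
    by (rule measurable_forward_integral[where c=c], use assms in simp_all)
      (rule forward_integral_bound[OF _ _ _ single_in_space], use assms in auto)
  note [measurable] = 1
  show ?thesis
  proof (rule integrable_const_bound[where B="K * (K ^ t * c)"])
    show "AE x in init_law S. norm (lik_at S 0 x * forward_integral S t 0 (single 0 x) h) \<le> K * (K ^ t * c)"
      unfolding real_norm_def abs_mult using lik_pos[of 0] lik_le[of 0] K_pos
      by (intro AE_I2 mult_mono 2) (auto simp: abs_of_pos)
  qed measurable
qed

text \<open>The model postulates a positive normaliser at the final time; positive likelihoods give
  it at all intermediate times, which is where the filters of the second assertion live.\<close>

lemma unnormalised_smoothing_pos:
  assumes "t \<le> T" "h \<in> borel_measurable (path_space t)" "\<And>x. x \<in> space (path_space t) \<Longrightarrow> \<bar>h x\<bar> \<le> c"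
    "\<And>x. x \<in> space (path_space t) \<Longrightarrow> 0 < h x"
  shows "0 < unnormalised_smoothing S t h"
  unfolding unnormalised_smoothing_def
  by (intro prob_integral_pos[OF init_law(1)] init_integrand[where c=c] mult_pos_pos lik_pos
      forward_integral_pos[where c=c] single_in_space) (use assms in auto)

lemma unnormalised_filter_pos:
  assumes "t \<le> T" "f \<in> borel_measurable borel" "\<And>x. \<bar>f x\<bar> \<le> c" "\<And>x. 0 < f x"
  shows "0 < unnormalised_filter t f"
  unfolding unnormalised_filter_def using assms
  by (intro unnormalised_smoothing_pos[where c=c]) auto

text \<open>Thanks to the default in the degenerate case, the weights sum to 1 in both branches, so
  every backward sum is an iterated weighted mean.\<close>

lemma backward_weight_prob:
  assumes "is_prob_weights N (W t)"
  shows "is_prob_weights N (backward_weight S N X W t y)"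
proof -
  let ?D = "\<Sum>k=1..N. W t k * trans_dens S (X t k) y"
  have "0 \<le> ?D" using assms by (intro sum_nonneg) (auto simp: is_prob_weights_def trans_dens_nonneg)
  then show ?thesis
    using assms by (cases "?D = 0")
      (simp_all add: is_prob_weights_def backward_weight_def trans_dens_nonneg sum_divide_distrib[symmetric] del: One_nat_def)
qed

lemma backward_sum_between:
  assumes "\<And>s. s < t \<Longrightarrow> is_prob_weights N (W s)"
    "\<And>y. (\<And>s. s \<ge> t \<Longrightarrow> y s = x s) \<Longrightarrow> lo \<le> h y \<and> h y \<le> hi"
  shows "lo \<le> backward_sum S N X W t x h \<and> backward_sum S N X W t x h \<le> hi"
  using assms
proof (induction t arbitrary: x)
  case (Suc t)
  show ?case unfolding backward_sum.simps
    by (intro convex_sum_between backward_weight_prob Suc.IH) (auto intro!: Suc.prems)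
qed auto

lemma measurable_trans_dens[measurable (raw)]:
  "f \<in> M \<rightarrow>\<^sub>M borel \<Longrightarrow> g \<in> M \<rightarrow>\<^sub>M borel \<Longrightarrow> (\<lambda>z. trans_dens S (f z) (g z)) \<in> borel_measurable M"
  using measurable_compose[OF measurable_Pair trans_dens, of f M g] by simp

lemma measurable_backward_weight:
  assumes [measurable]: "\<And>i. i \<in> {1..N} \<Longrightarrow> (\<lambda>z. X z t i) \<in> M \<rightarrow>\<^sub>M borel"
    "\<And>i. i \<in> {1..N} \<Longrightarrow> (\<lambda>z. W z t i) \<in> borel_measurable M" "f \<in> M \<rightarrow>\<^sub>M borel" and i: "i \<in> {1..N}"
  shows "(\<lambda>z. backward_weight S N (X z) (W z) t (f z) i) \<in> borel_measurable M"
  unfolding backward_weight_def using i by measurable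

lemma measurable_backward_sum:
  assumes "t \<le> n" "\<phi> \<in> M \<rightarrow>\<^sub>M path_space n" "h \<in> borel_measurable (path_space n)"
    "\<And>s i. s < t \<Longrightarrow> i \<in> {1..N} \<Longrightarrow> (\<lambda>z. X z s i) \<in> M \<rightarrow>\<^sub>M borel"
    "\<And>s i. s < t \<Longrightarrow> i \<in> {1..N} \<Longrightarrow> (\<lambda>z. W z s i) \<in> borel_measurable M"
  shows "(\<lambda>z. backward_sum S N (X z) (W z) t (\<phi> z) h) \<in> borel_measurable M"
  using assms
proof (induction t arbitrary: \<phi>)
  case 0
  then show ?case by simp
next
  case (Suc t)
  show ?case unfolding backward_sum.simps
  proof (intro borel_measurable_sum borel_measurable_times measurable_backward_weight Suc.IH)
    show "(\<lambda>z. \<phi> z (Suc t)) \<in> M \<rightarrow>\<^sub>M borel"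
      using Suc.prems(1,2) by (intro measurable_compose[OF Suc.prems(2)] measurable_component_singleton) auto
    show "(\<lambda>z. (\<phi> z)(t := X z t i)) \<in> M \<rightarrow>\<^sub>M path_space n" if "i \<in> {1..N}" for i
      by (rule measurable_path_upd) (use that Suc.prems in auto)
  qed (use Suc.prems in auto)
qed

end

section \<open>The selection-mutation kernel\<close>

text \<open>The selection-mutation law as a measure. The index stays visible in the pair because the
  weight of a new particle depends on its ancestor.\<close>

definition mixture :: "nat \<Rightarrow> (nat \<Rightarrow> real) \<Rightarrow> (nat \<Rightarrow> 'x :: polish_space measure) \<Rightarrow> (nat \<times> 'x) measure" where
  "mixture N a Q = point_measure {1..N} (\<lambda>j. ennreal (a j / (\<Sum>k=1..N. a k))) \<bind>
     (\<lambda>j. distr (Q j) (count_space {1..N} \<Otimes>\<^sub>M borel) (Pair j))"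

context
  fixes N :: nat and a :: "nat \<Rightarrow> real" and Q :: "nat \<Rightarrow> 'x :: polish_space measure"
  assumes N: "N \<ge> 1"
    and a: "\<And>j. j \<in> {1..N} \<Longrightarrow> 0 \<le> a j" and a_pos: "0 < (\<Sum>k=1..N. a k)"
    and Q: "\<And>j. j \<in> {1..N} \<Longrightarrow> prob_space (Q j)" "\<And>j. j \<in> {1..N} \<Longrightarrow> sets (Q j) = sets borel"
begin

lemma measurable_Pair_mixture:
  "j \<in> {1..N} \<Longrightarrow> Pair j \<in> Q j \<rightarrow>\<^sub>M count_space {1..N} \<Otimes>\<^sub>M borel"
  by (subst measurable_cong_sets[OF Q(2) refl]) (auto intro!: measurable_Pair1')

lemma mixture_component:
  "(\<lambda>j. distr (Q j) (count_space {1..N} \<Otimes>\<^sub>M borel) (Pair j)) \<in>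
     point_measure {1..N} (\<lambda>j. ennreal (a j / (\<Sum>k=1..N. a k))) \<rightarrow>\<^sub>M subprob_algebra (count_space {1..N} \<Otimes>\<^sub>M borel)"
  unfolding measurable_point_measure_eq1
  by (auto simp: space_subprob_algebra simp del: One_nat_def
     intro!: prob_space_imp_subprob_space prob_space.prob_space_distr Q measurable_Pair_mixture)

lemma sets_mixture: "sets (mixture N a Q) = sets (count_space {1..N} \<Otimes>\<^sub>M borel)"
  unfolding mixture_def
  using N by (intro sets_bind[OF subprob_measurableD(2)[OF mixture_component]]) (auto simp: space_point_measure)

lemma emeasure_mixture:
  assumes A: "A \<in> sets (count_space {1..N} \<Otimes>\<^sub>M borel)"
  shows "emeasure (mixture N a Q) A =
    ennreal ((\<Sum>j=1..N. a j * measure (Q j) {x. (j, x) \<in> A}) / (\<Sum>j=1..N. a j))"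
proof -
  have e: "emeasure (distr (Q j) (count_space {1..N} \<Otimes>\<^sub>M borel) (Pair j)) A = ennreal (measure (Q j) {x. (j, x) \<in> A})"
    if j: "j \<in> {1..N}" for j
  proof -
    interpret prob_space "Q j" by (rule Q(1)[OF j])
    have "space (Q j) = UNIV" using sets_eq_imp_space_eq[OF Q(2)[OF j]] by simp
    then show ?thesis
      by (subst emeasure_distr[OF measurable_Pair_mixture[OF j] A])
        (simp add: emeasure_eq_measure vimage_def)
  qed
  have "emeasure (mixture N a Q) A =
    (\<Sum>j=1..N. ennreal (a j / (\<Sum>k=1..N. a k)) * ennreal (measure (Q j) {x. (j, x) \<in> A}))"
    unfolding mixture_def using N
    by (subst emeasure_bind[OF _ mixture_component A])
      (auto simp: space_point_measure nn_integral_point_measure_finite e simp del: One_nat_def)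
  also have "\<dots> = (\<Sum>j=1..N. ennreal (a j / (\<Sum>k=1..N. a k) * measure (Q j) {x. (j, x) \<in> A}))"
    using a a_pos by (intro sum.cong) (auto simp: ennreal_mult'[symmetric] simp del: One_nat_def)
  also have "\<dots> = ennreal (\<Sum>j=1..N. a j / (\<Sum>k=1..N. a k) * measure (Q j) {x. (j, x) \<in> A})"
    using a a_pos by (intro sum_ennreal) (auto intro!: mult_nonneg_nonneg divide_nonneg_pos simp del: One_nat_def)
  finally show ?thesis by (simp add: sum_divide_distrib)
qed

lemma prob_space_mixture: "prob_space (mixture N a Q)"
proof
  have sp: "space (mixture N a Q) = {1..N} \<times> UNIV"
    using sets_eq_imp_space_eq[OF sets_mixture] by (simp add: space_pair_measure)
  have s: "{1..N} \<times> UNIV \<in> sets (count_space {1..N} \<Otimes>\<^sub>M (borel :: 'x measure))"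
    using sets.top[of "count_space {1..N} \<Otimes>\<^sub>M (borel :: 'x measure)"] by (simp add: space_pair_measure)
  have "measure (Q j) {x. (j, x) \<in> {1..N} \<times> UNIV} = 1" if j: "j \<in> {1..N}" for j
  proof -
    interpret prob_space "Q j" by (rule Q(1)[OF j])
    have "space (Q j) = UNIV" using sets_eq_imp_space_eq[OF Q(2)[OF j]] by simp
    then show ?thesis using prob_space j by simp
  qed
  then show "emeasure (mixture N a Q) (space (mixture N a Q)) = 1"
    using a_pos unfolding sp emeasure_mixture[OF s] by (simp del: One_nat_def)
qed

lemma integral_mixture:
  fixes u :: "nat \<times> 'x \<Rightarrow> real"
  assumes u: "u \<in> borel_measurable (count_space {1..N} \<Otimes>\<^sub>M borel)"
    and bd: "\<And>j x. j \<in> {1..N} \<Longrightarrow> \<bar>u (j, x)\<bar> \<le> c"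
  shows "(\<integral>y. u y \<partial>mixture N a Q) = (\<Sum>j=1..N. a j * (\<integral>x. u (j, x) \<partial>Q j)) / (\<Sum>j=1..N. a j)"
proof -
  let ?p = "point_measure {1..N} (\<lambda>j. ennreal (a j / (\<Sum>k=1..N. a k)))"
  have fin: "finite_measure ?p"
    by (intro finite_measureI) (simp add: space_point_measure emeasure_point_measure_finite)
  have "(\<integral>y. u y \<partial>mixture N a Q) =
     (\<integral>j. \<integral>y. u y \<partial>distr (Q j) (count_space {1..N} \<Otimes>\<^sub>M borel) (Pair j) \<partial>?p)"
    unfolding mixture_def
  proof (rule integral_bind[OF u _ mixture_component fin, where B=c and B'=1])
    show "\<bar>u y\<bar> \<le> c" if "y \<in> space (count_space {1..N} \<Otimes>\<^sub>M borel)" for y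
      using that bd by (auto simp: space_pair_measure)
    show "AE x in ?p. emeasure (distr (Q x) (count_space {1..N} \<Otimes>\<^sub>M borel) (Pair x))
        (space (distr (Q x) (count_space {1..N} \<Otimes>\<^sub>M borel) (Pair x))) \<le> ennreal 1"
      by (intro AE_I2) (auto simp: space_point_measure prob_space.emeasure_space_1[OF prob_space.prob_space_distr[OF Q(1) measurable_Pair_mixture]] simp del: One_nat_def space_distr)
  qed
  also have "\<dots> = (\<Sum>j=1..N. (a j / (\<Sum>k=1..N. a k)) * (\<integral>y. u y \<partial>distr (Q j) (count_space {1..N} \<Otimes>\<^sub>M borel) (Pair j)))"
    using a a_pos by (subst lebesgue_integral_point_measure_finite) (auto simp del: One_nat_def)
  also have "\<dots> = (\<Sum>j=1..N. (a j / (\<Sum>k=1..N. a k)) * (\<integral>x. u (j, x) \<partial>Q j))"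
    by (intro sum.cong refl arg_cong2[where f="(*)"] integral_distr u measurable_Pair_mixture)
  finally show ?thesis by (simp add: sum_divide_distrib)
qed

end

text \<open>Outside \<open>G\<close> the normalising sum may vanish and the mixture need not be a
  probability measure; a fixed point mass there yields a Markov kernel on the whole space.\<close>

lemma measurable_mixture:
  fixes Q :: "'z \<Rightarrow> nat \<Rightarrow> 'x :: polish_space measure"
  assumes N: "N \<ge> 1"
    and G[measurable]: "G \<in> sets M"
    and a[measurable]: "\<And>j. j \<in> {1..N} \<Longrightarrow> (\<lambda>z. a z j) \<in> borel_measurable M"
    and Q[measurable]: "\<And>j. j \<in> {1..N} \<Longrightarrow> (\<lambda>z. Q z j) \<in> M \<rightarrow>\<^sub>M prob_algebra borel"
    and pos: "\<And>z j. z \<in> G \<Longrightarrow> j \<in> {1..N} \<Longrightarrow> 0 \<le> a z j" "\<And>z. z \<in> G \<Longrightarrow> 0 < (\<Sum>k=1..N. a z k)"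
  shows "(\<lambda>z. if z \<in> G then mixture N (a z) (Q z) else return (count_space {1..N} \<Otimes>\<^sub>M borel) (1, undefined))
    \<in> M \<rightarrow>\<^sub>M prob_algebra (count_space {1..N} \<Otimes>\<^sub>M borel)" (is "?K \<in> _")
proof -
  let ?MY = "count_space {1..N} \<Otimes>\<^sub>M (borel :: 'x measure)"
  have Qz: "prob_space (Q z j)" "sets (Q z j) = sets borel" if "z \<in> G" "j \<in> {1..N}" for z j
    using that prob_kernelD[OF Q, of j z] sets.sets_into_space[OF G] by auto
  have one: "(1, undefined) \<in> space ?MY" using N by (simp add: space_pair_measure)
  have pr: "prob_space (?K z)" for z
    using prob_space_mixture[OF N pos Qz, of z] one by (auto intro: prob_space_return)
  have st: "sets (?K z) = sets ?MY" for z
    using sets_mixture[OF N pos Qz, of z] by (simp del: One_nat_def)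
  have "(\<lambda>z. emeasure (?K z) A) \<in> borel_measurable M" if A: "A \<in> sets ?MY" for A
  proof -
    have [measurable]: "(\<lambda>z. measure (Q z j) {x. (j, x) \<in> A}) \<in> borel_measurable M" if j: "j \<in> {1..N}" for j
    proof (rule measurable_compose[OF Q[OF j]])
      have "{x. (j, x) \<in> A} = Pair j -` A \<inter> space borel" by auto
      also have "\<dots> \<in> sets borel" using A j by (intro measurable_sets[OF measurable_Pair1']) auto
      finally show "(\<lambda>M. measure M {x. (j, x) \<in> A}) \<in> borel_measurable (prob_algebra borel)"
        by measurable
    qed
    have "(\<lambda>z. emeasure (?K z) A) = (\<lambda>z. if z \<in> G
       then ennreal ((\<Sum>j=1..N. a z j * measure (Q z j) {x. (j, x) \<in> A}) / (\<Sum>j=1..N. a z j))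
       else indicator A (1, undefined))"
    proof
      fix z
      have "emeasure (mixture N (a z) (Q z)) A =
        ennreal ((\<Sum>j=1..N. a z j * measure (Q z j) {x. (j, x) \<in> A}) / (\<Sum>j=1..N. a z j))" if "z \<in> G"
        by (rule emeasure_mixture[OF N pos Qz A]) (use that in auto)
      then show "emeasure (?K z) A = (if z \<in> G
         then ennreal ((\<Sum>j=1..N. a z j * measure (Q z j) {x. (j, x) \<in> A}) / (\<Sum>j=1..N. a z j))
         else indicator A (1, undefined))"
        using emeasure_return[OF A] by (simp del: One_nat_def)
    qed
    also have "\<dots> \<in> borel_measurable M" by measurable
    finally show ?thesis .
  qed
  then show ?thesis
    using pr st by (intro measurable_prob_algebraI measurable_subprob_algebra prob_space_imp_subprob_space)
qed

section \<open>Importance weights as changes of measure\<close>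

context smc
begin

lemma adj_mult[measurable]: "1 \<le> t \<Longrightarrow> t \<le> T \<Longrightarrow> adj_mult S t \<in> borel_measurable borel"
  using model by (auto simp: standing_assumptions_def)

lemma adj_pos: "1 \<le> t \<Longrightarrow> t \<le> T \<Longrightarrow> 0 < adj_mult S t x"
  using model by (auto simp: standing_assumptions_def)

lemma prop_kernel[measurable]: "1 \<le> t \<Longrightarrow> t \<le> T \<Longrightarrow> prop_kernel S t \<in> borel \<rightarrow>\<^sub>M prob_algebra borel"
  using model by (auto simp: standing_assumptions_def markov_kernel_density_def)

lemma prop_kernelD: "1 \<le> t \<Longrightarrow> t \<le> T \<Longrightarrow> prob_space (prop_kernel S t x)"
   "1 \<le> t \<Longrightarrow> t \<le> T \<Longrightarrow> sets (prop_kernel S t x) = sets borel"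
  using prob_kernelD[OF prop_kernel, of t x] by auto

lemma prop_dens[measurable]:
  "1 \<le> t \<Longrightarrow> t \<le> T \<Longrightarrow> (\<lambda>(x, x'). prop_dens S t x x') \<in> borel_measurable (borel \<Otimes>\<^sub>M borel)"
  using model by (auto simp: standing_assumptions_def markov_kernel_density_def)

lemma measurable_prop_dens[measurable (raw)]:
  "1 \<le> t \<Longrightarrow> t \<le> T \<Longrightarrow> f \<in> M \<rightarrow>\<^sub>M borel \<Longrightarrow> g \<in> M \<rightarrow>\<^sub>M borel \<Longrightarrow> (\<lambda>z. prop_dens S t (f z) (g z)) \<in> borel_measurable M"
  using measurable_compose[OF measurable_Pair prop_dens, of f M g] by simp

lemma prop_dens_nonneg: "1 \<le> t \<Longrightarrow> t \<le> T \<Longrightarrow> 0 \<le> prop_dens S t x x'"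
  using model by (auto simp: standing_assumptions_def markov_kernel_density_def)

lemma prop_kernel_density:
  "1 \<le> t \<Longrightarrow> t \<le> T \<Longrightarrow> prop_kernel S t x = density (ref_meas S) (\<lambda>x'. ennreal (prop_dens S t x x'))"
  using model by (auto simp: standing_assumptions_def markov_kernel_density_def)

lemma prop_dens_pos:
  "1 \<le> t \<Longrightarrow> t \<le> T \<Longrightarrow> 0 < trans_dens S x x' \<Longrightarrow> 0 < prop_dens S t x x'"
  using model lik_pos[of t x'] by (auto simp: standing_assumptions_def)

lemma measurable_weight_fun[measurable (raw)]:
  assumes [measurable, simp]: "1 \<le> t" "t \<le> T" and [measurable]: "f \<in> M \<rightarrow>\<^sub>M borel" "g \<in> M \<rightarrow>\<^sub>M borel"
  shows "(\<lambda>z. weight_fun S t (f z) (g z)) \<in> borel_measurable M"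
  unfolding weight_fun_def by measurable

lemma weight_fun_nonneg: "1 \<le> t \<Longrightarrow> t \<le> T \<Longrightarrow> 0 \<le> weight_fun S t x x'"
  unfolding weight_fun_def using adj_pos[of t x] prop_dens_nonneg[of t x x'] lik_pos[of t x'] trans_dens_nonneg[of x x']
  by (intro divide_nonneg_nonneg mult_nonneg_nonneg) auto

lemma init_dens[measurable]: "init_dens S \<in> borel_measurable borel"
  using model by (auto simp: standing_assumptions_def)

lemma measurable_init_weight_fun[measurable]: "init_weight_fun S \<in> borel_measurable borel"
  unfolding init_weight_fun_def[abs_def] by measurable

lemma init_weight_fun_nonneg: "0 \<le> init_weight_fun S x"
  using model lik_pos[of 0 x] unfolding init_weight_fun_def
  by (intro mult_nonneg_nonneg) (auto simp: standing_assumptions_def)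

lemma integral_init_weight:
  fixes u :: "'x \<Rightarrow> real"
  assumes [measurable]: "u \<in> borel_measurable borel"
  shows "(\<integral>x. init_weight_fun S x * u x \<partial>init_prop S) = (\<integral>x. lik_at S 0 x * u x \<partial>init_law S)"
proof -
  note [measurable_cong] = init_prop(2)
  have "init_law S = density (init_prop S) (\<lambda>x. ennreal (init_dens S x))" "\<And>x. 0 \<le> init_dens S x"
    using model by (auto simp: standing_assumptions_def)
  then show ?thesis
    by (simp add: integral_density init_weight_fun_def mult.assoc)
qed

lemma integral_trans_kernel:
  fixes u :: "'x \<Rightarrow> real"
  assumes [measurable]: "u \<in> borel_measurable borel"
  shows "(\<integral>x'. u x' \<partial>trans_kernel S x) = (\<integral>x'. trans_dens S x x' * u x' \<partial>ref_meas S)"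
    "integrable (trans_kernel S x) u \<longleftrightarrow> integrable (ref_meas S) (\<lambda>x'. trans_dens S x x' * u x')"
proof -
  note [measurable_cong] = ref_meas(2)
  show "(\<integral>x'. u x' \<partial>trans_kernel S x) = (\<integral>x'. trans_dens S x x' * u x' \<partial>ref_meas S)"
    unfolding trans_kernel_density by (subst integral_density) (auto simp: trans_dens_nonneg)
  show "integrable (trans_kernel S x) u \<longleftrightarrow> integrable (ref_meas S) (\<lambda>x'. trans_dens S x x' * u x')"
    unfolding trans_kernel_density by (subst integrable_density) (auto simp: trans_dens_nonneg)
qed

text \<open>The multiplier and the proposal density cancel against the denominator of the weight.
  Where the proposal density is 0, so is the transition density, by the support condition and the
  positive likelihood, and then both integrands vanish.\<close>

lemma integral_weight_fun:
  fixes u :: "'x \<Rightarrow> real"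
  assumes t: "1 \<le> t" "t \<le> T" and [measurable]: "u \<in> borel_measurable borel"
  shows "adj_mult S t x * (\<integral>x'. weight_fun S t x x' * u x' \<partial>prop_kernel S t x) =
    (\<integral>x'. lik_at S t x' * u x' \<partial>trans_kernel S x)"
proof -
  note [measurable_cong] = ref_meas(2)
  have "adj_mult S t x * (prop_dens S t x x' * (weight_fun S t x x' * u x')) =
      trans_dens S x x' * (lik_at S t x' * u x')" for x'
  proof (cases "trans_dens S x x' = 0")
    case False
    then have "0 < prop_dens S t x x'"
      using prop_dens_pos[OF t, of x x'] trans_dens_nonneg[of x x'] by simp
    then show ?thesis using adj_pos[OF t, of x] by (simp add: weight_fun_def field_simps)
  qed (simp add: weight_fun_def)
  then have "(\<integral>x'. adj_mult S t x * (prop_dens S t x x' * (weight_fun S t x x' * u x')) \<partial>ref_meas S) =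
      (\<integral>x'. trans_dens S x x' * (lik_at S t x' * u x') \<partial>ref_meas S)" by (simp only:)
  moreover have "(\<integral>x'. weight_fun S t x x' * u x' \<partial>prop_kernel S t x) =
     (\<integral>x'. prop_dens S t x x' * (weight_fun S t x x' * u x') \<partial>ref_meas S)"
    unfolding prop_kernel_density[OF t] using t by (subst integral_density) (auto simp: prop_dens_nonneg)
  ultimately show ?thesis by (simp add: integral_trans_kernel)
qed

text \<open>The denominator of the backward kernel is the density of the predictive law, so that the
  backward step exactly undoes the forward step.\<close>

lemma backward_forward_identity:
  assumes t: "t < T" and W: "\<And>s. s \<le> t \<Longrightarrow> is_prob_weights N (W s)"
    and h: "h \<in> borel_measurable (path_space T)" and c: "\<And>x. x \<in> space (path_space T) \<Longrightarrow> \<bar>h x\<bar> \<le> c"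
  shows "(\<Sum>j=1..N. W t j * (\<integral>x. lik_at S (Suc t) x * backward_sum S N X W (Suc t) (single (Suc t) x)
      (\<lambda>y. forward_integral S (T - Suc t) (Suc t) y h) \<partial>trans_kernel S (X t j))) =
    smoothed_sum S N X W t (\<lambda>y. forward_integral S (T - t) t y h)"
proof -
  let ?G = "\<lambda>y. forward_integral S (T - Suc t) (Suc t) y h"
  have Gm[measurable]: "?G \<in> borel_measurable (path_space (Suc t))"
    using t h c by (intro measurable_forward_integral[where c=c]) auto
  have Gb: "\<bar>?G y\<bar> \<le> K ^ (T - Suc t) * c" if "y \<in> space (path_space (Suc t))" for y
    using t h c that by (intro forward_integral_bound) auto
  \<comment> \<open>\<open>b x\<close> averages over the ancestors of \<open>x\<close> at time t;
    \<open>bb k x\<close> has the ancestor fixed to be particle \<open>k\<close>.\<close>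
  define b where "b x = backward_sum S N X W (Suc t) (single (Suc t) x) ?G" for x
  define bb where "bb k x = backward_sum S N X W t ((single t (X t k))(Suc t := x)) ?G" for k x
  have bm[measurable]: "b \<in> borel_measurable borel"
    unfolding b_def[abs_def] by (rule measurable_backward_sum[where n="Suc t"]) auto
  have bbm[measurable]: "bb k \<in> borel_measurable borel" for k
    unfolding bb_def[abs_def] by (rule measurable_backward_sum[where n="Suc t"]) (auto intro!: measurable_path_extend)
  define C where "C = K ^ (T - Suc t) * c"
  have bB: "\<bar>b x\<bar> \<le> C" for x
  proof -
    have "- C \<le> b x \<and> b x \<le> C" unfolding b_def
    proof (rule backward_sum_between)
      fix y assume "\<And>s. s \<ge> Suc t \<Longrightarrow> y s = single (Suc t) x s"
      then have "\<bar>?G y\<bar> \<le> C" unfolding C_def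
        by (intro Gb path_agree_in_space[OF single_in_space order_refl]) auto
      then show "- C \<le> ?G y \<and> ?G y \<le> C" by auto
    qed (use W in auto)
    then show ?thesis by auto
  qed
  have bbB: "\<bar>bb k x\<bar> \<le> C" for k x
  proof -
    have "- C \<le> bb k x \<and> bb k x \<le> C" unfolding bb_def
    proof (rule backward_sum_between)
      fix y assume "\<And>s. s \<ge> t \<Longrightarrow> y s = ((single t (X t k))(Suc t := x)) s"
      then have "\<bar>?G y\<bar> \<le> C" unfolding C_def
        by (intro Gb path_agree_in_space[OF path_extend_in_space[OF single_in_space], of t]) auto
      then show "- C \<le> ?G y \<and> ?G y \<le> C" by auto
    qed (use W in auto)
    then show ?thesis by auto
  qed
  have lb: "\<bar>lik_at S (Suc t) x * r\<bar> \<le> K * C" if "\<bar>r\<bar> \<le> C" for x r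
    unfolding abs_mult using lik_pos[of "Suc t" x] lik_le[of "Suc t" x] t K_pos that by (intro mult_mono) auto
  have int_b: "integrable (trans_kernel S x) (\<lambda>x'. lik_at S (Suc t) x' * b x')"
    and int_bb: "integrable (trans_kernel S x) (\<lambda>x'. lik_at S (Suc t) x' * bb k x')" for x k
    by (auto intro!: trans_kernel_integrable[where c="K * C"] lb bB bbB)
  have W0: "is_prob_weights N (W t)" using W by simp
  \<comment> \<open>Pointwise in \<open>x\<close>, the predictive density \<open>?D\<close> cancels
    the denominator of the backward weights, so the average over ancestors in \<open>b\<close>
    becomes a sum weighted by transition densities.\<close>
  have key: "(\<Sum>j=1..N. W t j * (trans_dens S (X t j) x * (lik_at S (Suc t) x * b x))) =
     (\<Sum>j=1..N. W t j * (trans_dens S (X t j) x * (lik_at S (Suc t) x * bb j x)))" for x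
  proof -
    let ?D = "\<Sum>k=1..N. W t k * trans_dens S (X t k) x"
    have b_eq: "b x = (\<Sum>k=1..N. backward_weight S N X W t x k * bb k x)"
      unfolding b_def bb_def by (simp add: fun_upd_twist[of t "Suc t"])
    have "?D * b x = (\<Sum>k=1..N. W t k * trans_dens S (X t k) x * bb k x)"
    proof (cases "?D = 0")
      \<comment> \<open>A vanishing predictive density forces every summand to vanish, so the
        default backward weights are multiplied by 0.\<close>
      case True
      then have "W t k * trans_dens S (X t k) x = 0" if "k \<in> {1..N}" for k
        using that W0 by (subst (asm) sum_nonneg_eq_0_iff) (auto simp: is_prob_weights_def trans_dens_nonneg)
      then have "(\<Sum>k=1..N. W t k * trans_dens S (X t k) x * bb k x) = 0"
        by (intro sum.neutral) simp
      then show ?thesis unfolding True by simp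
    next
      case False
      then have "?D * backward_weight S N X W t x k = W t k * trans_dens S (X t k) x" for k
        by (simp add: backward_weight_def del: One_nat_def)
      then have "?D * (backward_weight S N X W t x k * bb k x) = W t k * trans_dens S (X t k) x * bb k x" for k
        by (metis mult.assoc)
      then show ?thesis unfolding b_eq sum_distrib_left by (intro sum.cong) auto
    qed
    then have "lik_at S (Suc t) x * (?D * b x) =
       lik_at S (Suc t) x * (\<Sum>k=1..N. W t k * trans_dens S (X t k) x * bb k x)" by simp
    then show ?thesis
      unfolding sum_distrib_left sum_distrib_right by (simp add: mult_ac)
  qed
  \<comment> \<open>Writing all transition kernels as densities with respect to the one measure
    \<open>ref_meas\<close> brings the sum under a single integral, where \<open>key\<close>
    applies.\<close>
  have "(\<Sum>j=1..N. W t j * (\<integral>x. lik_at S (Suc t) x * b x \<partial>trans_kernel S (X t j))) =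
    (\<integral>x. (\<Sum>j=1..N. W t j * (trans_dens S (X t j) x * (lik_at S (Suc t) x * b x))) \<partial>ref_meas S)"
    using int_b by (subst Bochner_Integration.integral_sum) (auto simp: integral_trans_kernel)
  also have "\<dots> = (\<Sum>j=1..N. W t j * (\<integral>x. lik_at S (Suc t) x * bb j x \<partial>trans_kernel S (X t j)))"
    unfolding key using int_bb by (subst Bochner_Integration.integral_sum) (auto simp: integral_trans_kernel)
  also have "\<dots> = smoothed_sum S N X W t (\<lambda>y. forward_integral S (T - t) t y h)"
    unfolding smoothed_sum_def
  proof (intro sum.cong refl arg_cong2[where f="(*)"])
    fix j
    \<comment> \<open>The coordinate \<open>Suc t\<close> lies above all those that the backward sum
      reads or overwrites, so the integral moves inside and becomes one more step of the forward
      recursion.\<close>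
    have "(\<integral>x. lik_at S (Suc t) x * bb j x \<partial>trans_kernel S (X t j)) =
      backward_sum S N X W t (single t (X t j)) (\<lambda>y. \<integral>x. lik_at S (Suc t) x * ?G (y(Suc t := x)) \<partial>trans_kernel S (X t j))"
      unfolding bb_def
    proof (rule backward_sum_integral[THEN conjunct2])
      fix y' assume *: "\<And>s. s \<ge> t \<Longrightarrow> y' s = single t (X t j) s"
      have "y' \<in> space (path_space t)"
        by (rule path_agree_in_space[OF single_in_space order_refl *])
      then show "integrable (trans_kernel S (X t j)) (\<lambda>x. lik_at S (Suc t) x * ?G (y'(Suc t := x)))"
        using t h c by (intro forward_step_integrand[where c=c]) auto
    qed simp
    also have "\<dots> = backward_sum S N X W t (single t (X t j)) (\<lambda>y. forward_integral S (T - t) t y h)"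
    proof (rule backward_sum_cong)
      fix y assume *: "\<And>s. s \<ge> t \<Longrightarrow> y s = single t (X t j) s"
      have "T - t = Suc (T - Suc t)" using t by simp
      then show "(\<integral>x. lik_at S (Suc t) x * ?G (y(Suc t := x)) \<partial>trans_kernel S (X t j)) =
         forward_integral S (T - t) t y h"
        using *[of t] by simp
    qed
    finally show "(\<integral>x. lik_at S (Suc t) x * bb j x \<partial>trans_kernel S (X t j)) =
      backward_sum S N X W t (single t (X t j)) (\<lambda>y. forward_integral S (T - t) t y h)" .
  qed
  finally show ?thesis unfolding b_def .
qed

end

section \<open>One step of the particle system\<close>

locale particles = smc S T K
  for S :: "('x :: polish_space, 'y :: polish_space) smc_model" and T :: nat and K :: real +
  fixes N :: nat and P :: "'w measure" and \<xi> :: "'w \<Rightarrow> nat \<Rightarrow> nat \<Rightarrow> 'x" and I :: "'w \<Rightarrow> nat \<Rightarrow> nat \<Rightarrow> nat"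
  assumes N: "N \<ge> 1" and system: "particle_system S T N P \<xi> I"

sublocale particles \<subseteq> prob_space P
  using system by (simp add: particle_system_def)

context particles
begin

definition wt :: "'w \<Rightarrow> nat \<Rightarrow> nat \<Rightarrow> real" where
  "wt w s i = weight S (\<xi> w) (I w) s i"

lemma measurable_particle[measurable]: "t \<le> T \<Longrightarrow> i \<in> {1..N} \<Longrightarrow> (\<lambda>w. \<xi> w t i) \<in> P \<rightarrow>\<^sub>M borel"
  using system by (simp add: particle_system_def)

lemma measurable_index[measurable]:
  "1 \<le> t \<Longrightarrow> t \<le> T \<Longrightarrow> i \<in> {1..N} \<Longrightarrow> (\<lambda>w. I w t i) \<in> P \<rightarrow>\<^sub>M count_space {1..N}"
  using system by (simp add: particle_system_def)

lemma index_range: "w \<in> space P \<Longrightarrow> 1 \<le> t \<Longrightarrow> t \<le> T \<Longrightarrow> i \<in> {1..N} \<Longrightarrow> I w t i \<in> {1..N}"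
  using measurable_space[OF measurable_index] by auto

lemma wt_0: "wt w 0 i = init_weight_fun S (\<xi> w 0 i)"
  by (simp add: wt_def weight_def)

lemma wt_Suc: "wt w (Suc t) i = weight_fun S (Suc t) (\<xi> w t (I w (Suc t) i)) (\<xi> w (Suc t) i)"
  by (simp add: wt_def weight_def)

lemma wt_nonneg: "t \<le> T \<Longrightarrow> 0 \<le> wt w t i"
  by (cases t) (auto simp: wt_0 wt_Suc init_weight_fun_nonneg weight_fun_nonneg)

lemma measurable_wt[measurable]:
  assumes t: "t \<le> T" and i: "i \<in> {1..N}" shows "(\<lambda>w. wt w t i) \<in> borel_measurable P"
proof (cases t)
  case 0
  then show ?thesis
    unfolding 0 wt_0 using i
    by (intro measurable_compose[OF measurable_particle measurable_init_weight_fun]) auto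
next
  case (Suc s)
  have "(\<lambda>w. weight_fun S (Suc s) (\<xi> w s (I w (Suc s) i)) (\<xi> w (Suc s) i)) \<in> borel_measurable P"
  \<comment> \<open>The ancestor index selects one of finitely many measurable functions.\<close>
  proof (rule measurable_compose_countable'[where I="{1..N}" and g="\<lambda>w. I w (Suc s) i"])
    show "(\<lambda>w. weight_fun S (Suc s) (\<xi> w s j) (\<xi> w (Suc s) i)) \<in> borel_measurable P" if "j \<in> {1..N}" for j
      using that t i Suc by (intro measurable_weight_fun measurable_particle) auto
  qed (use t i Suc in \<open>auto simp del: One_nat_def\<close>)
  then show ?thesis unfolding Suc wt_Suc .
qed

abbreviation hist_space :: "nat \<Rightarrow> (nat \<times> nat \<Rightarrow> 'x \<times> real) measure" where
  "hist_space t \<equiv> Pi\<^sub>M ({..t} \<times> {1..N}) (\<lambda>_. borel \<Otimes>\<^sub>M borel)"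

text \<open>Records positions and weights but no ancestor indices, since
  \<open>particle_history\<close> is generated by exactly these data. All backward sums can be
  computed from them.\<close>

definition hist :: "nat \<Rightarrow> 'w \<Rightarrow> nat \<times> nat \<Rightarrow> 'x \<times> real" where
  "hist t w = (\<lambda>(s, i) \<in> {..t} \<times> {1..N}. (\<xi> w s i, wt w s i))"

abbreviation pos_of :: "(nat \<times> nat \<Rightarrow> 'x \<times> real) \<Rightarrow> nat \<Rightarrow> nat \<Rightarrow> 'x" where
  "pos_of z s i \<equiv> fst (z (s, i))"

abbreviation wt_of :: "(nat \<times> nat \<Rightarrow> 'x \<times> real) \<Rightarrow> nat \<Rightarrow> nat \<Rightarrow> real" where
  "wt_of z s i \<equiv> snd (z (s, i))"

lemma hist_simps:
  assumes "s \<le> t" "i \<in> {1..N}"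
  shows "pos_of (hist t w) s i = \<xi> w s i" "wt_of (hist t w) s i = wt w s i"
  using assms by (auto simp: hist_def)

lemma measurable_hist[measurable]: "t \<le> T \<Longrightarrow> hist t \<in> P \<rightarrow>\<^sub>M hist_space t"
  unfolding hist_def[abs_def]
  by (rule measurable_restrict) (auto simp del: One_nat_def intro!: measurable_Pair measurable_particle measurable_wt)

lemma particle_history_eq:
  "particle_history S N P \<xi> I t = vimage_algebra (space P) (hist t) (hist_space t)"
  by (simp add: particle_history_def hist_def[abs_def] wt_def)

lemma measurable_coord:
  assumes "s \<le> t" "i \<in> {1..N}"
  shows "(\<lambda>z. z (s, i)) \<in> hist_space t \<rightarrow>\<^sub>M borel \<Otimes>\<^sub>M borel"
  using assms by (intro measurable_component_singleton) auto

lemma measurable_pos_of[measurable]: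
  "s \<le> t \<Longrightarrow> i \<in> {1..N} \<Longrightarrow> (\<lambda>z. pos_of z s i) \<in> hist_space t \<rightarrow>\<^sub>M borel"
  by (rule measurable_compose[OF measurable_coord measurable_fst])

lemma measurable_wt_of[measurable]:
  "s \<le> t \<Longrightarrow> i \<in> {1..N} \<Longrightarrow> (\<lambda>z. wt_of z s i) \<in> borel_measurable (hist_space t)"
  by (rule measurable_compose[OF measurable_coord measurable_snd])

definition total_adj :: "nat \<Rightarrow> (nat \<times> nat \<Rightarrow> 'x \<times> real) \<Rightarrow> real" where
  "total_adj t z = (\<Sum>j=1..N. wt_of z t j * adj_mult S (Suc t) (pos_of z t j))"

text \<open>Histories after which the selection law exists. Since \<open>z\<close> ranges over the
  whole product space, nonnegative weights must be required; at all times up to \<open>t\<close>, so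
  that every normalised weight vector is a probability vector.\<close>

definition good :: "nat \<Rightarrow> (nat \<times> nat \<Rightarrow> 'x \<times> real) set" where
  "good t = {z \<in> space (hist_space t). (\<forall>s\<in>{..t}. \<forall>i\<in>{1..N}. 0 \<le> wt_of z s i) \<and> 0 < total_adj t z}"

lemma measurable_total_adj[measurable]:
  assumes "t < T" shows "total_adj t \<in> borel_measurable (hist_space t)"
  unfolding total_adj_def[abs_def] using assms
  by (intro borel_measurable_sum borel_measurable_times measurable_wt_of
      measurable_compose[OF measurable_pos_of adj_mult]) auto

lemma good_sets[measurable]:
  assumes t: "t < T" shows "good t \<in> sets (hist_space t)"
proof -
  note [measurable] = measurable_total_adj[OF t]
  have "good t = (\<Inter>s\<in>{..t}. \<Inter>i\<in>{1..N}. {z \<in> space (hist_space t). 0 \<le> wt_of z s i}) \<inter>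
      {z \<in> space (hist_space t). 0 < total_adj t z}"
    using N by (auto simp: good_def simp del: One_nat_def)
  also have "\<dots> \<in> sets (hist_space t)"
    using N by (intro sets.Int sets.finite_INT) (auto simp del: One_nat_def)
  finally show ?thesis .
qed

lemma total_adj_hist: "total_adj t (hist t w) = (\<Sum>j=1..N. wt w t j * adj_mult S (Suc t) (\<xi> w t j))"
  unfolding total_adj_def by (intro sum.cong) (auto simp: hist_simps)

lemma hist_good:
  assumes "t < T" "w \<in> space P"
  shows "hist t w \<in> good t \<longleftrightarrow> 0 < (\<Sum>j=1..N. wt w t j * adj_mult S (Suc t) (\<xi> w t j))"
  using assms measurable_space[OF measurable_hist, of t w]
  by (auto simp: good_def total_adj_hist hist_simps wt_nonneg simp del: One_nat_def)

section \<open>The conditional law of the new particles\<close>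

abbreviation pair_space :: "(nat \<times> 'x) measure" where
  "pair_space \<equiv> count_space {1..N} \<Otimes>\<^sub>M borel"

definition sel_kernel :: "nat \<Rightarrow> (nat \<times> nat \<Rightarrow> 'x \<times> real) \<Rightarrow> (nat \<times> 'x) measure" where
  "sel_kernel t z = (if z \<in> good t
     then mixture N (\<lambda>j. wt_of z t j * adj_mult S (Suc t) (pos_of z t j)) (\<lambda>j. prop_kernel S (Suc t) (pos_of z t j))
     else return pair_space (1, undefined))"

lemma good_weights:
  assumes "t < T" "z \<in> good t"
  shows "j \<in> {1..N} \<Longrightarrow> 0 \<le> wt_of z t j * adj_mult S (Suc t) (pos_of z t j)"
    "0 < (\<Sum>j=1..N. wt_of z t j * adj_mult S (Suc t) (pos_of z t j))"
  using assms less_imp_le[OF adj_pos[of "Suc t"]]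
  by (auto simp: good_def total_adj_def simp del: One_nat_def intro!: mult_nonneg_nonneg)

lemma measurable_sel_kernel:
  assumes t: "t < T" shows "sel_kernel t \<in> hist_space t \<rightarrow>\<^sub>M prob_algebra pair_space"
  unfolding sel_kernel_def[abs_def]
proof (rule measurable_mixture[OF N good_sets[OF t]])
  show "(\<lambda>z. wt_of z t j * adj_mult S (Suc t) (pos_of z t j)) \<in> borel_measurable (hist_space t)" if "j \<in> {1..N}" for j
    using that t by (intro borel_measurable_times measurable_wt_of measurable_compose[OF measurable_pos_of adj_mult]) auto
  show "(\<lambda>z. prop_kernel S (Suc t) (pos_of z t j)) \<in> hist_space t \<rightarrow>\<^sub>M prob_algebra borel" if "j \<in> {1..N}" for j
    using that t by (intro measurable_compose[OF measurable_pos_of prop_kernel]) auto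
qed (use good_weights[OF t] in auto)

lemma measure_sel_kernel:
  assumes t: "t < T" and w: "w \<in> space P" "hist t w \<in> good t" and A: "A \<in> sets pair_space"
  shows "measure (sel_kernel t (hist t w)) A = selection_mutation_prob S N (\<xi> w) (I w) (Suc t) A"
    "emeasure (sel_kernel t (hist t w)) A = ennreal (selection_mutation_prob S N (\<xi> w) (I w) (Suc t) A)"
proof -
  let ?z = "hist t w"
  have "emeasure (sel_kernel t ?z) A =
      ennreal ((\<Sum>j=1..N. wt_of ?z t j * adj_mult S (Suc t) (pos_of ?z t j) *
        measure (prop_kernel S (Suc t) (pos_of ?z t j)) {x. (j, x) \<in> A}) /
      (\<Sum>j=1..N. wt_of ?z t j * adj_mult S (Suc t) (pos_of ?z t j)))"
    unfolding sel_kernel_def using t w(2)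
    by (subst if_P, simp, intro emeasure_mixture N good_weights prop_kernelD A) auto
  also have "\<dots> = ennreal (selection_mutation_prob S N (\<xi> w) (I w) (Suc t) A)"
    unfolding selection_mutation_prob_def
    by (intro arg_cong[where f=ennreal] arg_cong2[where f="(/)"] sum.cong refl) (auto simp: hist_simps wt_def)
  finally show e: "emeasure (sel_kernel t ?z) A = ennreal (selection_mutation_prob S N (\<xi> w) (I w) (Suc t) A)" .
  have "0 \<le> selection_mutation_prob S N (\<xi> w) (I w) (Suc t) A"
    unfolding selection_mutation_prob_def using t adj_pos[of "Suc t"]
    by (intro divide_nonneg_nonneg sum_nonneg mult_nonneg_nonneg)
      (auto simp: wt_def[symmetric] wt_nonneg intro: less_imp_le)
  with e show "measure (sel_kernel t (hist t w)) A = selection_mutation_prob S N (\<xi> w) (I w) (Suc t) A"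
    by (simp add: measure_def)
qed

definition new_pair :: "nat \<Rightarrow> nat \<Rightarrow> 'w \<Rightarrow> nat \<times> 'x" where
  "new_pair t i w = (I w (Suc t) i, \<xi> w (Suc t) i)"

lemma measurable_new_pair[measurable]:
  "t < T \<Longrightarrow> i \<in> {1..N} \<Longrightarrow> new_pair t i \<in> P \<rightarrow>\<^sub>M pair_space"
  unfolding new_pair_def[abs_def] by (intro measurable_Pair measurable_index measurable_particle) auto

text \<open>Puts the conditional expectation in \<open>particle_system\<close> into the integrated
  form that \<open>conditional_hoeffding\<close> takes. Sets inside \<open>good t\<close> are
  considered because the model fixes the law only there.\<close>

lemma conditional_law:
  assumes t: "t < T" and A: "A \<in> sets (hist_space t)" "A \<subseteq> good t"
    and B: "\<And>i. i \<in> {1..N} \<Longrightarrow> B i \<in> sets pair_space"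
  shows "emeasure P {w \<in> space P. hist t w \<in> A \<and> (\<forall>i\<in>{1..N}. new_pair t i w \<in> B i)} =
    (\<integral>\<^sup>+w. indicator A (hist t w) * (\<Prod>i\<in>{1..N}. emeasure (sel_kernel t (hist t w)) (B i)) \<partial>P)"
proof -
  let ?F = "particle_history S N P \<xi> I t"
  note [measurable] = A(1)
  have [measurable]: "hist t \<in> P \<rightarrow>\<^sub>M hist_space t" using t by (intro measurable_hist) simp
  have sub: "subalgebra P ?F"
  proof -
    have fs: "hist t \<in> space P \<rightarrow> space (hist_space t)"
      using measurable_space[OF \<open>hist t \<in> P \<rightarrow>\<^sub>M hist_space t\<close>] by blast
    show ?thesis
      unfolding particle_history_eq subalgebra_def sets_vimage_algebra2[OF fs]
      using measurable_sets[OF \<open>hist t \<in> P \<rightarrow>\<^sub>M hist_space t\<close>] by (auto simp del: One_nat_def)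
  qed
  interpret F: finite_measure_subalgebra P ?F
    by unfold_locales (rule sub)
  define C where "C = {w \<in> space P. \<forall>i\<in>{1..N}. new_pair t i w \<in> B i}"
  have [measurable]: "C \<in> sets P"
    unfolding C_def
  proof (intro sets.sets_Collect_finite_All)
    fix i assume i: "i \<in> {1..N}"
    show "{w \<in> space P. new_pair t i w \<in> B i} \<in> sets P"
      using measurable_sets[OF measurable_new_pair[OF t i] B[OF i]]
      by (simp add: vimage_def Collect_conj_eq Int_commute)
  qed simp
  have ce: "AE w in P. 0 < (\<Sum>j=1..N. wt w t j * adj_mult S (Suc t) (\<xi> w t j)) \<longrightarrow>
      real_cond_exp P ?F (indicat_real C) w =
      (\<Prod>i=1..N. selection_mutation_prob S N (\<xi> w) (I w) (Suc t) (B i))"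
  proof -
    have "\<forall>t\<in>{1..T}. \<forall>A. (\<forall>i\<in>{1..N}. A i \<in> sets pair_space) \<longrightarrow>
        (AE w in P.
           0 < (\<Sum>j=1..N. weight S (\<xi> w) (I w) (t - 1) j * adj_mult S t (\<xi> w (t - 1) j)) \<longrightarrow>
           real_cond_exp P (particle_history S N P \<xi> I (t - 1))
             (indicat_real {v \<in> space P. \<forall>i\<in>{1..N}. (I v t i, \<xi> v t i) \<in> A i}) w =
           (\<Prod>i=1..N. selection_mutation_prob S N (\<xi> w) (I w) t (A i)))"
      using system unfolding particle_system_def by (elim conjE)
    from this[rule_format, of "Suc t" B] t B show ?thesis
      by (simp add: wt_def C_def new_pair_def del: One_nat_def)
  qed
  define A' where "A' = {w \<in> space P. hist t w \<in> A}"
  have A'F: "A' \<in> sets ?F"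
    unfolding A'_def particle_history_eq using in_vimage_algebra[OF A(1), of "hist t" "space P"]
    by (simp add: vimage_def Collect_conj_eq Int_commute)
  have [measurable]: "A' \<in> sets P" unfolding A'_def by measurable
  define r where "r w = indicat_real A (hist t w) * (\<Prod>i\<in>{1..N}. measure (sel_kernel t (hist t w)) (B i))" for w
  have mK[measurable]: "(\<lambda>w. measure (sel_kernel t (hist t w)) (B i)) \<in> borel_measurable P" if "i \<in> {1..N}" for i
    by (rule measurable_compose[OF _ measurable_measure_prob_algebra[OF B[OF that]]],
      rule measurable_compose[OF _ measurable_sel_kernel[OF t]]) measurable
  have r_meas[measurable]: "r \<in> borel_measurable P" unfolding r_def[abs_def] by measurable
  have kprob: "prob_space (sel_kernel t (hist t w))" if "w \<in> space P" for w
    using that measurable_space[OF \<open>hist t \<in> P \<rightarrow>\<^sub>M hist_space t\<close>]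
    by (intro prob_kernelD(1)[OF measurable_sel_kernel[OF t]])
  have r01: "0 \<le> r w" "r w \<le> 1" if "w \<in> space P" for w
    unfolding r_def using prob_space.prob_le_1[OF kprob[OF that]]
    by (auto intro!: mult_nonneg_nonneg prod_nonneg prod_le_1 mult_le_one)
  have int_C: "integrable P (indicat_real C)" by (simp add: emeasure_eq_measure)
  have "measure P (A' \<inter> C) = (\<integral>w\<in>A'. indicat_real C w \<partial>P)"
    unfolding set_lebesgue_integral_def by (simp add: indicator_inter_arith[symmetric])
  \<comment> \<open>\<open>A'\<close> is an event of the history, so the defining property of
    conditional expectation applies on it.\<close>
  also have "\<dots> = (\<integral>w\<in>A'. real_cond_exp P ?F (indicat_real C) w \<partial>P)"
    by (rule F.real_cond_exp_intA[OF int_C A'F])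
  also have "\<dots> = (\<integral>w. r w \<partial>P)"
    unfolding set_lebesgue_integral_def
  proof (rule integral_cong_AE)
    show "(\<lambda>w. indicat_real A' w *\<^sub>R real_cond_exp P ?F (indicat_real C) w) \<in> borel_measurable P"
      using borel_measurable_cond_exp2 by measurable
    show "AE w in P. indicat_real A' w *\<^sub>R real_cond_exp P ?F (indicat_real C) w = r w"
      using ce
    proof (rule AE_mp, intro AE_I2 impI)
      fix w assume w: "w \<in> space P" and
        *: "0 < (\<Sum>j=1..N. wt w t j * adj_mult S (Suc t) (\<xi> w t j)) \<longrightarrow>
          real_cond_exp P ?F (indicat_real C) w =
          (\<Prod>i=1..N. selection_mutation_prob S N (\<xi> w) (I w) (Suc t) (B i))"
      show "indicat_real A' w *\<^sub>R real_cond_exp P ?F (indicat_real C) w = r w"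
      proof (cases "hist t w \<in> A")
        case True
        then have g: "hist t w \<in> good t" using A(2) by auto
        then have "real_cond_exp P ?F (indicat_real C) w =
          (\<Prod>i=1..N. measure (sel_kernel t (hist t w)) (B i))"
          using * hist_good[OF t w] B measure_sel_kernel(1)[OF t w g] by (simp del: One_nat_def)
        then show ?thesis using True w by (simp add: r_def A'_def)
      qed (simp add: r_def A'_def)
    qed
  qed measurable
  finally have *: "measure P (A' \<inter> C) = (\<integral>w. r w \<partial>P)" .
  have "{w \<in> space P. hist t w \<in> A \<and> (\<forall>i\<in>{1..N}. new_pair t i w \<in> B i)} = A' \<inter> C"
    by (auto simp: A'_def C_def)
  then have "emeasure P {w \<in> space P. hist t w \<in> A \<and> (\<forall>i\<in>{1..N}. new_pair t i w \<in> B i)} = ennreal (\<integral>w. r w \<partial>P)"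
    by (simp only: emeasure_eq_measure *)
  also have "\<dots> = (\<integral>\<^sup>+w. ennreal (r w) \<partial>P)"
    using r01 by (intro nn_integral_eq_integral[symmetric] integrable_const_bound[where B=1] AE_I2) auto
  also have "\<dots> = (\<integral>\<^sup>+w. indicator A (hist t w) * (\<Prod>i\<in>{1..N}. emeasure (sel_kernel t (hist t w)) (B i)) \<partial>P)"
  proof (rule nn_integral_cong)
    fix w assume w: "w \<in> space P"
    interpret k: prob_space "sel_kernel t (hist t w)" by (rule kprob[OF w])
    show "ennreal (r w) = indicator A (hist t w) * (\<Prod>i\<in>{1..N}. emeasure (sel_kernel t (hist t w)) (B i))"
      by (auto simp: r_def k.emeasure_eq_measure prod_ennreal indicator_def simp del: One_nat_def)
  qed
  finally show ?thesis .
qed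

text \<open>In each component the multiplier of the selection probability cancels against the one in
  the weight; only the total selection mass remains, as the normaliser.\<close>

lemma integral_sel_kernel:
  assumes t: "t < T" and z: "z \<in> good t" and u: "u \<in> borel_measurable borel" and c: "\<And>x. \<bar>u x\<bar> \<le> c"
  shows "(\<integral>(j, x). weight_fun S (Suc t) (pos_of z t j) x * u x \<partial>sel_kernel t z) =
    (\<Sum>j=1..N. wt_of z t j * (\<integral>x. lik_at S (Suc t) x * u x \<partial>trans_kernel S (pos_of z t j))) / total_adj t z"
proof -
  note [measurable] = u
  have "(\<integral>(j, x). weight_fun S (Suc t) (pos_of z t j) x * u x \<partial>sel_kernel t z) =
    (\<Sum>j=1..N. wt_of z t j * adj_mult S (Suc t) (pos_of z t j) *
      (\<integral>x. weight_fun S (Suc t) (pos_of z t j) x * u x \<partial>prop_kernel S (Suc t) (pos_of z t j))) / total_adj t z"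
    unfolding sel_kernel_def total_adj_def if_P[OF z]
  proof (subst integral_mixture[where c="K * c"])
    show "(\<lambda>(j, x). weight_fun S (Suc t) (pos_of z t j) x * u x) \<in> borel_measurable pair_space"
      unfolding split_beta
      using t
      by (intro measurable_compose_countable'[where I="{1..N}" and g=fst and
         f="\<lambda>j y. weight_fun S (Suc t) (pos_of z t j) (snd y) * u (snd y)"]
         borel_measurable_times measurable_weight_fun) auto
    show "\<bar>case (j, x) of (j, x) \<Rightarrow> weight_fun S (Suc t) (pos_of z t j) x * u x\<bar> \<le> K * c" for j x
      using t weight_fun_nonneg[of "Suc t" "pos_of z t j" x] weight_le[of "Suc t" "pos_of z t j" x] c[of x] K_pos
      by (auto simp: abs_mult intro!: mult_mono)
  qed (use good_weights[OF t z] prop_kernelD[of "Suc t"] t N in auto)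
  also have "(\<Sum>j=1..N. wt_of z t j * adj_mult S (Suc t) (pos_of z t j) *
      (\<integral>x. weight_fun S (Suc t) (pos_of z t j) x * u x \<partial>prop_kernel S (Suc t) (pos_of z t j))) =
    (\<Sum>j=1..N. wt_of z t j * (\<integral>x. lik_at S (Suc t) x * u x \<partial>trans_kernel S (pos_of z t j)))"
    using t by (intro sum.cong refl) (simp add: mult.assoc integral_weight_fun)
  finally show ?thesis .
qed

text \<open>The test function may depend on the history: this allows the smoothing increments, which
  contain backward sums over old particles. Weights are at most \<open>K\<close>, so the summands
  are at most \<open>K * c\<close>.\<close>

lemma one_step_concentration:
  assumes t: "t < T" and u[measurable]: "(\<lambda>(z, x). u z x) \<in> borel_measurable (hist_space t \<Otimes>\<^sub>M borel)"
    and c: "0 < c" "\<And>z x. z \<in> good t \<Longrightarrow> \<bar>u z x\<bar> \<le> c" and e: "0 \<le> e"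
  shows "prob {w \<in> space P. hist t w \<in> good t \<and> real N * e \<le>
      \<bar>(\<Sum>i=1..N. wt w (Suc t) i * u (hist t w) (\<xi> w (Suc t) i)) - real N *
       ((\<Sum>j=1..N. wt w t j * (\<integral>x. lik_at S (Suc t) x * u (hist t w) x \<partial>trans_kernel S (\<xi> w t j))) /
        (\<Sum>j=1..N. wt w t j * adj_mult S (Suc t) (\<xi> w t j)))\<bar>}
    \<le> 2 * exp (- (real N * e\<^sup>2 / (2 * (K * c)\<^sup>2)))"
proof -
  let ?f = "\<lambda>z (j, x). weight_fun S (Suc t) (pos_of z t j) x * u z x"
  have fm: "(\<lambda>(z, y). ?f z y) \<in> borel_measurable (hist_space t \<Otimes>\<^sub>M pair_space)"
  proof -
    have "(\<lambda>y. weight_fun S (Suc t) (pos_of (fst y) t (fst (snd y))) (snd (snd y)) * u (fst y) (snd (snd y)))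
       \<in> borel_measurable (hist_space t \<Otimes>\<^sub>M pair_space)"
    proof (rule measurable_compose_countable'[where I="{1..N}" and g="\<lambda>y. fst (snd y)" and
         f="\<lambda>j y. weight_fun S (Suc t) (pos_of (fst y) t j) (snd (snd y)) * u (fst y) (snd (snd y))"])
      fix j assume "j \<in> {1..N}"
      then show "(\<lambda>y. weight_fun S (Suc t) (pos_of (fst y) t j) (snd (snd y)) * u (fst y) (snd (snd y)))
        \<in> borel_measurable (hist_space t \<Otimes>\<^sub>M pair_space)"
        using t measurable_compose[OF _ u, of "\<lambda>y. (fst y, snd (snd y))" "hist_space t \<Otimes>\<^sub>M pair_space"]
        by (intro borel_measurable_times measurable_weight_fun measurable_compose[OF measurable_fst measurable_pos_of])
          (auto simp del: One_nat_def)
    qed auto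
    then show ?thesis by (simp add: split_beta')
  qed
  have "prob {w \<in> space P. hist t w \<in> good t \<and> real (card {1..N}) * e \<le>
     \<bar>(\<Sum>i\<in>{1..N}. ?f (hist t w) (new_pair t i w)) - real (card {1..N}) * (\<integral>y. ?f (hist t w) y \<partial>sel_kernel t (hist t w))\<bar>}
    \<le> 2 * exp (- (real (card {1..N}) * e\<^sup>2 / (2 * (K * c)\<^sup>2)))"
  proof (rule conditional_hoeffding[OF _ _ measurable_hist measurable_new_pair good_sets measurable_sel_kernel _ fm])
    show "emeasure P {w \<in> space P. hist t w \<in> A \<and> (\<forall>i\<in>{1..N}. new_pair t i w \<in> B i)} =
    (\<integral>\<^sup>+w. indicator A (hist t w) * (\<Prod>i\<in>{1..N}. emeasure (sel_kernel t (hist t w)) (B i)) \<partial>P)"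
      if "A \<in> sets (hist_space t)" "A \<subseteq> good t" "\<And>i. i \<in> {1..N} \<Longrightarrow> B i \<in> sets pair_space" for A B
      using that by (rule conditional_law[OF t])
    show "\<bar>?f z y\<bar> \<le> K * c" if "z \<in> good t" for z y
      using t weight_fun_nonneg[of "Suc t"] weight_le[of "Suc t"] c(2)[OF that] K_pos
      by (auto simp: abs_mult intro!: mult_mono split: prod.split)
  qed (use t N K_pos c e in auto)
  also have "{w \<in> space P. hist t w \<in> good t \<and> real (card {1..N}) * e \<le>
     \<bar>(\<Sum>i\<in>{1..N}. ?f (hist t w) (new_pair t i w)) - real (card {1..N}) * (\<integral>y. ?f (hist t w) y \<partial>sel_kernel t (hist t w))\<bar>}
    = {w \<in> space P. hist t w \<in> good t \<and> real N * e \<le>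
      \<bar>(\<Sum>i=1..N. wt w (Suc t) i * u (hist t w) (\<xi> w (Suc t) i)) - real N *
       ((\<Sum>j=1..N. wt w t j * (\<integral>x. lik_at S (Suc t) x * u (hist t w) x \<partial>trans_kernel S (\<xi> w t j))) /
        (\<Sum>j=1..N. wt w t j * adj_mult S (Suc t) (\<xi> w t j)))\<bar>}"
  proof (rule Collect_cong, rule conj_cong[OF refl], rule conj_cong[OF refl])
    fix w assume w: "w \<in> space P" and g: "hist t w \<in> good t"
    have z: "hist t w \<in> space (hist_space t)" using g by (simp add: good_def)
    have 1: "(\<Sum>i\<in>{1..N}. ?f (hist t w) (new_pair t i w)) = (\<Sum>i=1..N. wt w (Suc t) i * u (hist t w) (\<xi> w (Suc t) i))"
    proof (intro sum.cong refl)
      fix i assume i: "i \<in> {1..N}"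
      have "I w (Suc t) i \<in> {1..N}" using index_range[OF w _ _ i, of "Suc t"] t by simp
      then show "?f (hist t w) (new_pair t i w) = wt w (Suc t) i * u (hist t w) (\<xi> w (Suc t) i)"
        by (simp add: new_pair_def wt_Suc hist_simps del: One_nat_def)
    qed
    have um: "u (hist t w) \<in> borel_measurable borel"
      using measurable_compose[OF measurable_Pair1'[OF z] u] by simp
    have 2: "(\<integral>y. ?f (hist t w) y \<partial>sel_kernel t (hist t w)) =
       (\<Sum>j=1..N. wt w t j * (\<integral>x. lik_at S (Suc t) x * u (hist t w) x \<partial>trans_kernel S (\<xi> w t j))) /
        (\<Sum>j=1..N. wt w t j * adj_mult S (Suc t) (\<xi> w t j))"
      unfolding integral_sel_kernel[OF t g um c(2)[OF g]] total_adj_hist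
      by (intro arg_cong2[where f="(/)"] sum.cong refl) (auto simp: hist_simps)
    show "(real (card {1..N}) * e \<le>
     \<bar>(\<Sum>i\<in>{1..N}. ?f (hist t w) (new_pair t i w)) - real (card {1..N}) * (\<integral>y. ?f (hist t w) y \<partial>sel_kernel t (hist t w))\<bar>)
     = (real N * e \<le> \<bar>(\<Sum>i=1..N. wt w (Suc t) i * u (hist t w) (\<xi> w (Suc t) i)) - real N *
       ((\<Sum>j=1..N. wt w t j * (\<integral>x. lik_at S (Suc t) x * u (hist t w) x \<partial>trans_kernel S (\<xi> w t j))) /
        (\<Sum>j=1..N. wt w t j * adj_mult S (Suc t) (\<xi> w t j)))\<bar>)"
      unfolding 1 2 by simp
  qed
  finally show ?thesis by simp
qed

text \<open>The analogue at time 0, where the change of measure from \<open>init_prop\<close> to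
  \<open>init_law\<close> takes the place of the selection kernel.\<close>

lemma initial_concentration:
  assumes u[measurable]: "u \<in> borel_measurable borel" and c: "0 < c" "\<And>x. \<bar>u x\<bar> \<le> c" and e: "0 \<le> e"
  shows "prob {w \<in> space P. real N * e \<le>
      \<bar>(\<Sum>i=1..N. wt w 0 i * u (\<xi> w 0 i)) - real N * (\<integral>x. lik_at S 0 x * u x \<partial>init_law S)\<bar>}
    \<le> 2 * exp (- (real N * e\<^sup>2 / (2 * (K * c)\<^sup>2)))"
proof -
  have "prob {w \<in> space P. real (card {1..N}) * e \<le>
      \<bar>(\<Sum>i\<in>{1..N}. init_weight_fun S (\<xi> w 0 i) * u (\<xi> w 0 i)) -
       real (card {1..N}) * (\<integral>x. init_weight_fun S x * u x \<partial>init_prop S)\<bar>}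
    \<le> 2 * exp (- (real (card {1..N}) * e\<^sup>2 / (2 * (K * c)\<^sup>2)))"
  proof (rule hoeffding_iid)
    show "indep_vars (\<lambda>_. borel) (\<lambda>i w. \<xi> w 0 i) {1..N}"
      and "\<And>i. i \<in> {1..N} \<Longrightarrow> distr P borel (\<lambda>w. \<xi> w 0 i) = init_prop S"
      using system by (auto simp: particle_system_def)
    show "\<bar>init_weight_fun S y * u y\<bar> \<le> K * c" for y
      using init_weight_fun_nonneg[of y] init_weight_le[of y] c(2)[of y] K_pos
      by (auto simp: abs_mult intro!: mult_mono)
  qed (use N K_pos c e in auto)
  then show ?thesis by (simp add: wt_0 integral_init_weight)
qed

end

section \<open>Increments of the smoothing ratio\<close>

text \<open>The rule of \<open>normalised_weight\<close> for a bare weight vector, so that it also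
  applies to weights read off a history.\<close>

definition normalise :: "nat \<Rightarrow> (nat \<Rightarrow> real) \<Rightarrow> nat \<Rightarrow> real" where
  "normalise N v i = (if (\<Sum>k=1..N. v k) = 0 then 1 / real N else v i / (\<Sum>k=1..N. v k))"

lemma normalised_weight_eq: "normalised_weight S N \<xi> I t = normalise N (weight S \<xi> I t)"
  by (simp add: fun_eq_iff normalised_weight_def normalise_def total_weight_def)

lemma is_prob_weights_normalise:
  assumes "N \<ge> 1" "\<And>i. i \<in> {1..N} \<Longrightarrow> 0 \<le> v i"
  shows "is_prob_weights N (normalise N v)"
proof -
  have "0 \<le> (\<Sum>k=1..N. v k)" using assms by (intro sum_nonneg) auto
  then show ?thesis using assms
    by (cases "(\<Sum>k=1..N. v k) = 0")
      (simp_all add: is_prob_weights_def normalise_def sum_divide_distrib[symmetric] del: One_nat_def)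
qed

lemma normalise_cong:
  "(\<And>i. i \<in> {1..N} \<Longrightarrow> v i = v' i) \<Longrightarrow> i \<in> {1..N} \<Longrightarrow> normalise N v i = normalise N v' i"
  by (auto simp: normalise_def cong: sum.cong_simp)

lemma measurable_normalise:
  assumes "\<And>i. i \<in> {1..N} \<Longrightarrow> (\<lambda>z. v z i) \<in> borel_measurable M" "i \<in> {1..N}"
  shows "(\<lambda>z. normalise N (v z) i) \<in> borel_measurable M"
proof -
  have [measurable]: "(\<lambda>z. \<Sum>k=1..N. v z k) \<in> borel_measurable M" "(\<lambda>z. v z i) \<in> borel_measurable M"
    using assms by (auto intro!: borel_measurable_sum simp del: One_nat_def)
  show ?thesis unfolding normalise_def by measurable
qed

context smc
begin

text \<open>R_t of the overview. The lookahead of 1 depends on the path only through its coordinate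
  at \<open>t\<close>, so its backward average is its own value and the denominator is a plain
  weighted sum.\<close>

definition smoothing_ratio ::
  "nat \<Rightarrow> (nat \<Rightarrow> nat \<Rightarrow> 'x) \<Rightarrow> (nat \<Rightarrow> nat \<Rightarrow> real) \<Rightarrow> nat \<Rightarrow> ((nat \<Rightarrow> 'x) \<Rightarrow> real) \<Rightarrow> real" where
  "smoothing_ratio N X W t h =
     smoothed_sum S N X W t (\<lambda>y. forward_integral S (T - t) t y h) /
     (\<Sum>i=1..N. W t i * lik_to_go S t T (X t i))"

lemma backward_lookahead_between:
  assumes "t \<le> T" "h \<in> borel_measurable (path_space T)"
    "\<And>x. x \<in> space (path_space T) \<Longrightarrow> lo \<le> h x \<and> h x \<le> hi"
    and "\<And>s. s < t \<Longrightarrow> is_prob_weights N (W s)"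
  shows "lo * lik_to_go S t T x \<le> backward_sum S N X W t (single t x) (\<lambda>y. forward_integral S (T - t) t y h) \<and>
    backward_sum S N X W t (single t x) (\<lambda>y. forward_integral S (T - t) t y h) \<le> hi * lik_to_go S t T x"
proof (rule backward_sum_between[OF assms(4)])
  fix y assume *: "\<And>s. s \<ge> t \<Longrightarrow> y s = single t x s"
  have "y \<in> space (path_space t)"
    by (rule path_agree_in_space[OF single_in_space order_refl *])
  from forward_integral_between[OF assms(1-3) this] *[of t]
  show "lo * lik_to_go S t T x \<le> forward_integral S (T - t) t y h \<and>
      forward_integral S (T - t) t y h \<le> hi * lik_to_go S t T x" by simp
qed

lemma lik_to_go_average_pos:
  assumes "t \<le> T" "is_prob_weights N w"
  shows "0 < (\<Sum>i=1..N. w i * lik_to_go S t T (X i))"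
proof -
  obtain i where "i \<in> {1..N}" "w i \<noteq> 0"
    using assms(2) unfolding is_prob_weights_def by (metis sum.neutral zero_neq_one)
  then show ?thesis
    using assms lik_to_go_bounds(1)[OF assms(1)]
    by (intro sum_pos2[of _ i]) (auto simp: is_prob_weights_def less_le)
qed

text \<open>Each term of the numerator lies between \<open>lo\<close> and \<open>hi\<close> times
  the corresponding term of the denominator. This is how the oscillation of \<open>h\<close>
  replaces its norm.\<close>

lemma smoothing_ratio_between:
  assumes t: "t \<le> T" and h: "h \<in> borel_measurable (path_space T)"
    "\<And>x. x \<in> space (path_space T) \<Longrightarrow> lo \<le> h x \<and> h x \<le> hi"
    and W: "\<And>s. s \<le> t \<Longrightarrow> is_prob_weights N (W s)"
  shows "lo \<le> smoothing_ratio N X W t h" "smoothing_ratio N X W t h \<le> hi"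
proof -
  have Wt: "is_prob_weights N (W t)" using W by simp
  let ?L = "\<Sum>i=1..N. W t i * lik_to_go S t T (X t i)"
  have b: "lo * lik_to_go S t T x \<le> backward_sum S N X W t (single t x) (\<lambda>y. forward_integral S (T - t) t y h)"
    "backward_sum S N X W t (single t x) (\<lambda>y. forward_integral S (T - t) t y h) \<le> hi * lik_to_go S t T x" for x
    using backward_lookahead_between[OF t h, of N W x X] W by auto
  have "lo * ?L \<le> smoothed_sum S N X W t (\<lambda>y. forward_integral S (T - t) t y h)"
    unfolding smoothed_sum_def sum_distrib_left mult.left_commute[of lo]
    using Wt b by (intro sum_mono mult_left_mono) (auto simp: is_prob_weights_def)
  moreover have "smoothed_sum S N X W t (\<lambda>y. forward_integral S (T - t) t y h) \<le> hi * ?L"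
    unfolding smoothed_sum_def sum_distrib_left mult.left_commute[of hi]
    using Wt b by (intro sum_mono mult_left_mono) (auto simp: is_prob_weights_def)
  moreover have "0 < ?L" by (rule lik_to_go_average_pos[OF t Wt])
  ultimately show "lo \<le> smoothing_ratio N X W t h" "smoothing_ratio N X W t h \<le> hi"
    by (simp_all add: smoothing_ratio_def pos_le_divide_eq pos_divide_le_eq del: One_nat_def)
qed

lemma smoothing_ratio_T:
  assumes "is_prob_weights N (W T)"
  shows "smoothing_ratio N X W T h = smoothed_sum S N X W T h"
  using assms by (simp add: smoothing_ratio_def lik_to_go_T is_prob_weights_def del: One_nat_def)

lemma joint_smoothing_between:
  assumes h: "h \<in> borel_measurable (path_space T)"
    "\<And>x. x \<in> space (path_space T) \<Longrightarrow> lo \<le> h x \<and> h x \<le> hi"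
  shows "lo \<le> joint_smoothing S T h" "joint_smoothing S T h \<le> hi"
proof -
  have c: "\<bar>h x\<bar> \<le> max \<bar>lo\<bar> \<bar>hi\<bar>" if "x \<in> space (path_space T)" for x
    using h(2)[OF that] by (auto simp: abs_real_def max_def)
  have ih: "integrable (init_law S) (\<lambda>x. lik_at S 0 x * forward_integral S T 0 (single 0 x) h)"
    by (rule init_integrand[OF order_refl h(1) c])
  have i1: "integrable (init_law S) (\<lambda>x. lik_at S 0 x * forward_integral S T 0 (single 0 x) (\<lambda>_. 1))"
    by (rule init_integrand[where c=1]) auto
  have b: "lo * lik_to_go S 0 T x \<le> forward_integral S T 0 (single 0 x) h"
    "forward_integral S T 0 (single 0 x) h \<le> hi * lik_to_go S 0 T x" for x
    using forward_integral_between[OF _ h single_in_space, of 0 x] by auto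
  have L: "forward_integral S T 0 (single 0 x) (\<lambda>_. 1) = lik_to_go S 0 T x" for x
    using forward_integral_lik_to_go[of 0 "single 0 x"] by simp
  have "lo * unnormalised_smoothing S T (\<lambda>_. 1) \<le> unnormalised_smoothing S T h"
    unfolding unnormalised_smoothing_def integral_mult_right_zero[symmetric]
    using ih i1 b lik_pos[of 0]
    by (intro integral_mono) (auto simp: L mult.left_commute intro!: mult_left_mono less_imp_le)
  moreover have "unnormalised_smoothing S T h \<le> hi * unnormalised_smoothing S T (\<lambda>_. 1)"
    unfolding unnormalised_smoothing_def integral_mult_right_zero[symmetric]
    using ih i1 b lik_pos[of 0]
    by (intro integral_mono) (auto simp: L mult.left_commute intro!: mult_left_mono less_imp_le)
  moreover have "0 < unnormalised_smoothing S T (\<lambda>_. 1)"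
    by (rule unnormalised_smoothing_pos[where c=1]) auto
  ultimately show "lo \<le> joint_smoothing S T h" "joint_smoothing S T h \<le> hi"
    by (simp_all add: joint_smoothing_def pos_le_divide_eq pos_divide_le_eq)
qed

end

section \<open>Estimator and increments as functions of the recorded history\<close>

context particles
begin

abbreviation nw :: "'w \<Rightarrow> nat \<Rightarrow> nat \<Rightarrow> real" where
  "nw w s \<equiv> normalise N (wt w s)"

abbreviation nw_of :: "(nat \<times> nat \<Rightarrow> 'x \<times> real) \<Rightarrow> nat \<Rightarrow> nat \<Rightarrow> real" where
  "nw_of z s \<equiv> normalise N (wt_of z s)"

lemma nw_prob: "s \<le> T \<Longrightarrow> is_prob_weights N (nw w s)"
  by (rule is_prob_weights_normalise[OF N]) (rule wt_nonneg)

lemma nw_of_prob: "z \<in> good t \<Longrightarrow> s \<le> t \<Longrightarrow> is_prob_weights N (nw_of z s)"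
  by (rule is_prob_weights_normalise[OF N]) (auto simp: good_def simp del: One_nat_def)

lemma nw_of_hist: "s \<le> t \<Longrightarrow> i \<in> {1..N} \<Longrightarrow> nw_of (hist t w) s i = nw w s i"
  by (rule normalise_cong) (auto simp: hist_simps)

lemma normalised_weight_nw: "normalised_weight S N (\<xi> w) (I w) s = nw w s"
  unfolding normalised_weight_eq by (simp add: wt_def[abs_def])

text \<open>Particle filters have finite support. Measurability of \<open>h\<close> enters because
  \<open>particle_filter\<close> is a measure on the Borel sets, and its integrals reduce to finite
  sums for Borel integrands.\<close>

lemma backward_integral_eq:
  assumes "t \<le> n" "n \<le> T" "h \<in> borel_measurable (path_space n)" "x \<in> space (path_space n)"
  shows "backward_integral S (particle_filter S N (\<xi> w) (I w)) t x h = backward_sum S N (\<xi> w) (nw w) t x h"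
  using assms
proof (induction t arbitrary: x)
  case (Suc t)
  have int: "(\<integral>x. f x \<partial>particle_filter S N (\<xi> w) (I w) t) = (\<Sum>i=1..N. nw w t i * f (\<xi> w t i))"
    if "f \<in> borel_measurable borel" for f :: "'x \<Rightarrow> real"
    using Suc.prems nw_prob[of t w] that
    by (subst integral_particle_filter) (auto simp: normalised_weight_nw is_prob_weights_def)
  have IH: "(\<lambda>x'. backward_integral S (particle_filter S N (\<xi> w) (I w)) t (x(t := x')) h) =
     (\<lambda>x'. backward_sum S N (\<xi> w) (nw w) t (x(t := x')) h)"
    using Suc.prems by (intro ext Suc.IH path_upd_in_space) auto
  have [measurable]: "(\<lambda>x'. backward_sum S N (\<xi> w) (nw w) t (x(t := x')) h) \<in> borel_measurable borel"
    using Suc.prems by (intro measurable_backward_sum[where n=n] measurable_path_upd) auto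
  show ?case
    unfolding backward_integral.simps backward_kernel_def IH backward_sum.simps
    \<comment> \<open>The four integrals belong to the test for zero, the default value, the
      numerator and the denominator.\<close>
    by (subst (1 2 3 4) int, measurable)
      (auto simp: backward_weight_def sum_divide_distrib mult.assoc intro!: sum.cong)
qed simp

lemma ffbs_estimator_eq:
  assumes h: "h \<in> borel_measurable (path_space T)"
  shows "ffbs_estimator S T N (\<xi> w) (I w) h = smoothed_sum S N (\<xi> w) (nw w) T h"
proof -
  have "(\<lambda>x. backward_sum S N (\<xi> w) (nw w) T (single T x) h) \<in> borel_measurable borel"
    using h by (intro measurable_backward_sum[where n=T] measurable_single) auto
  moreover have "backward_integral S (particle_filter S N (\<xi> w) (I w)) T (single T x) h =
      backward_sum S N (\<xi> w) (nw w) T (single T x) h" for x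
    by (rule backward_integral_eq[OF order_refl order_refl h single_in_space])
  ultimately show ?thesis
    using nw_prob[of T w] unfolding ffbs_estimator_def smoothed_sum_def
    by (subst integral_particle_filter[of "\<lambda>x. backward_integral S (particle_filter S N (\<xi> w) (I w)) T (single T x) h"])
      (auto simp: normalised_weight_nw is_prob_weights_def)
qed

text \<open>One term of the numerator of R_(t+1) - R_t. The factor R_t is the constant that centres
  it.\<close>

definition increment :: "nat \<Rightarrow> ((nat \<Rightarrow> 'x) \<Rightarrow> real) \<Rightarrow> (nat \<times> nat \<Rightarrow> 'x \<times> real) \<Rightarrow> 'x \<Rightarrow> real" where
  "increment t h z x =
     backward_sum S N (pos_of z) (nw_of z) (Suc t) (single (Suc t) x) (\<lambda>y. forward_integral S (T - Suc t) (Suc t) y h) -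
     smoothing_ratio N (pos_of z) (nw_of z) t h * lik_to_go S (Suc t) T x"

lemma measurable_increment:
  assumes t: "t < T" and h: "h \<in> borel_measurable (path_space T)" "\<And>x. x \<in> space (path_space T) \<Longrightarrow> \<bar>h x\<bar> \<le> c"
  shows "(\<lambda>(z, x). increment t h z x) \<in> borel_measurable (hist_space t \<Otimes>\<^sub>M borel)"
proof -
  have G: "(\<lambda>y. forward_integral S (T - s) s y h) \<in> borel_measurable (path_space s)" if "s \<le> T" for s
    using that h by (intro measurable_forward_integral[where c=c]) auto
  have p: "(\<lambda>y. pos_of (fst y) s i) \<in> hist_space t \<Otimes>\<^sub>M borel \<rightarrow>\<^sub>M borel" if "s \<le> t" "i \<in> {1..N}" for s i
    by (rule measurable_compose[OF measurable_fst measurable_pos_of[OF that]])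
  have n: "(\<lambda>y. nw_of (fst y) s i) \<in> borel_measurable (hist_space t \<Otimes>\<^sub>M borel)" if "s \<le> t" "i \<in> {1..N}" for s i
    using that by (intro measurable_normalise measurable_compose[OF measurable_fst measurable_wt_of])
  have L: "(\<lambda>y. lik_to_go S s T (f y)) \<in> borel_measurable M" if "s \<le> T" "f \<in> M \<rightarrow>\<^sub>M borel" for s f and M :: "'b measure"
    by (rule measurable_compose[OF that(2) measurable_lik_to_go[OF that(1)]])
  have 1: "(\<lambda>y. backward_sum S N (pos_of (fst y)) (nw_of (fst y)) (Suc t) (single (Suc t) (snd y))
      (\<lambda>y. forward_integral S (T - Suc t) (Suc t) y h)) \<in> borel_measurable (hist_space t \<Otimes>\<^sub>M borel)"
    using t by (intro measurable_backward_sum[where n="Suc t"] measurable_single G p n measurable_snd) auto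
  have 2: "(\<lambda>y. smoothing_ratio N (pos_of (fst y)) (nw_of (fst y)) t h) \<in> borel_measurable (hist_space t \<Otimes>\<^sub>M borel)"
    unfolding smoothing_ratio_def smoothed_sum_def using t
    by (intro borel_measurable_divide borel_measurable_sum borel_measurable_times
         measurable_backward_sum[where n=t] measurable_single G p n L) auto
  show ?thesis
    unfolding split_beta increment_def
    using t by (intro borel_measurable_diff borel_measurable_times 1 2 L measurable_snd) auto
qed

text \<open>Both terms lie between \<open>lo\<close> and \<open>hi\<close> times the same lookahead
  of 1, so only hi - lo survives.\<close>

lemma increment_bound:
  assumes t: "t < T" and z: "z \<in> good t" and h: "h \<in> borel_measurable (path_space T)"
    "\<And>x. x \<in> space (path_space T) \<Longrightarrow> lo \<le> h x \<and> h x \<le> hi"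
  shows "\<bar>increment t h z x\<bar> \<le> (hi - lo) * K ^ (T - Suc t)"
proof -
  let ?L = "lik_to_go S (Suc t) T x"
  let ?r = "smoothing_ratio N (pos_of z) (nw_of z) t h"
  have L: "0 < ?L" "?L \<le> K ^ (T - Suc t)" using lik_to_go_bounds[of "Suc t" x] t by auto
  have r: "lo \<le> ?r" "?r \<le> hi"
    using smoothing_ratio_between[OF _ h, of t N "nw_of z" "pos_of z"] nw_of_prob[OF z] t by auto
  have "lo * ?L \<le> ?r * ?L" "?r * ?L \<le> hi * ?L" using r L by (auto intro!: mult_right_mono)
  then have "\<bar>increment t h z x\<bar> \<le> (hi - lo) * ?L"
    using backward_lookahead_between[OF _ h, of "Suc t" N "nw_of z" x "pos_of z"] nw_of_prob[OF z] t
    unfolding increment_def by (auto simp: left_diff_distrib abs_le_iff)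
  also have "\<dots> \<le> (hi - lo) * K ^ (T - Suc t)" using r L by (intro mult_left_mono) auto
  finally show ?thesis .
qed

text \<open>One forward step turns the first term into the numerator of R_t, by
  \<open>backward_forward_identity\<close>, and the second into R_t times its denominator.\<close>

lemma increment_centred:
  assumes t: "t < T" and z: "z \<in> good t" and h: "h \<in> borel_measurable (path_space T)"
    "\<And>x. x \<in> space (path_space T) \<Longrightarrow> \<bar>h x\<bar> \<le> c"
  shows "(\<Sum>j=1..N. wt_of z t j * (\<integral>x. lik_at S (Suc t) x * increment t h z x \<partial>trans_kernel S (pos_of z t j))) = 0"
proof -
  let ?W = "nw_of z" and ?X = "pos_of z"
  let ?b = "\<lambda>x. backward_sum S N ?X ?W (Suc t) (single (Suc t) x) (\<lambda>y. forward_integral S (T - Suc t) (Suc t) y h)"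
  let ?r = "smoothing_ratio N ?X ?W t h"
  let ?L = "\<Sum>i=1..N. ?W t i * lik_to_go S t T (?X t i)"
  have wn: "\<And>i. i \<in> {1..N} \<Longrightarrow> 0 \<le> wt_of z t i" using z by (simp add: good_def)
  \<comment> \<open>Positive selection mass excludes a zero total weight, so the uniform default is
    not in force and raw weights are a constant multiple of the normalised ones.\<close>
  have "(\<Sum>k=1..N. wt_of z t k) \<noteq> 0"
  proof
    assume "(\<Sum>k=1..N. wt_of z t k) = 0"
    then have "\<And>i. i \<in> {1..N} \<Longrightarrow> wt_of z t i = 0"
      using wn by (subst (asm) sum_nonneg_eq_0_iff) auto
    then have "total_adj t z = 0" unfolding total_adj_def by (intro sum.neutral) simp
    then show False using z by (simp add: good_def)
  qed
  then have w: "wt_of z t j = (\<Sum>k=1..N. wt_of z t k) * ?W t j" for j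
    by (simp add: normalise_def del: One_nat_def)
  have bB: "\<bar>?b x\<bar> \<le> c * lik_to_go S (Suc t) T x" for x
    using backward_lookahead_between[of "Suc t" h "-c" c N ?W x ?X] h nw_of_prob[OF z] t
    by (auto simp: abs_le_iff minus_le_iff)
  have c0: "0 \<le> c" using h(2)[OF single_in_space[of T undefined]] by linarith
  have LB: "0 < lik_to_go S (Suc t) T x" "lik_to_go S (Suc t) T x \<le> K ^ (T - Suc t)" for x
    using lik_to_go_bounds[of "Suc t" x] t by auto
  have bB': "\<bar>?b x\<bar> \<le> c * K ^ (T - Suc t)" for x
    using bB[of x] mult_left_mono[OF LB(2)[of x] c0] by linarith
  have [measurable]: "?b \<in> borel_measurable borel"
    using t h by (intro measurable_backward_sum[where n="Suc t"] measurable_single measurable_forward_integral[where c=c]) auto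
  have [measurable]: "lik_to_go S (Suc t) T \<in> borel_measurable borel" using t by simp
  have lb: "\<bar>lik_at S (Suc t) x * r\<bar> \<le> K * C" if "\<bar>r\<bar> \<le> C" for x r C
    unfolding abs_mult using lik_pos[of "Suc t" x] lik_le[of "Suc t" x] t K_pos that by (intro mult_mono) auto
  have int_b: "integrable (trans_kernel S x) (\<lambda>x. lik_at S (Suc t) x * ?b x)" for x
    by (rule trans_kernel_integrable[OF _ lb[OF bB']]) measurable
  have int_L: "integrable (trans_kernel S x) (\<lambda>x. lik_at S (Suc t) x * lik_to_go S (Suc t) T x)" for x
    using LB by (intro trans_kernel_integrable[where c="K * K ^ (T - Suc t)"] lb) (auto simp: abs_of_pos)
  have inc: "(\<integral>x. lik_at S (Suc t) x * increment t h z x \<partial>trans_kernel S y) =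
      (\<integral>x. lik_at S (Suc t) x * ?b x \<partial>trans_kernel S y) - ?r * lik_to_go S t T y" for y
  proof -
    have "(\<integral>x. lik_at S (Suc t) x * increment t h z x \<partial>trans_kernel S y) =
       (\<integral>x. lik_at S (Suc t) x * ?b x - ?r * (lik_at S (Suc t) x * lik_to_go S (Suc t) T x) \<partial>trans_kernel S y)"
      by (simp only: increment_def right_diff_distrib mult.left_commute)
    then show ?thesis using int_b int_L by (simp add: lik_to_go_Suc[OF t])
  qed
  have "(\<Sum>j=1..N. ?W t j * (\<integral>x. lik_at S (Suc t) x * increment t h z x \<partial>trans_kernel S (?X t j))) =
    smoothed_sum S N ?X ?W t (\<lambda>y. forward_integral S (T - t) t y h) - ?r * ?L"
    unfolding inc right_diff_distrib sum_subtractf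
    using backward_forward_identity[OF t nw_of_prob[OF z] h, where X="?X"]
    by (simp add: sum_distrib_left mult.left_commute del: backward_sum.simps)
  also have "\<dots> = 0"
    using lik_to_go_average_pos[OF less_imp_le[OF t] nw_of_prob[OF z order_refl], of "?X t"]
    unfolding smoothing_ratio_def by simp
  finally have "(\<Sum>k=1..N. wt_of z t k) *
      (\<Sum>j=1..N. ?W t j * (\<integral>x. lik_at S (Suc t) x * increment t h z x \<partial>trans_kernel S (?X t j))) = 0"
    by simp
  then show ?thesis
    unfolding sum_distrib_left by (subst w) (simp add: mult.assoc)
qed

lemma smoothing_ratio_hist:
  "smoothing_ratio N (pos_of (hist t w)) (nw_of (hist t w)) t h = smoothing_ratio N (\<xi> w) (nw w) t h"
  unfolding smoothing_ratio_def
  by (intro arg_cong2[where f="(/)"] smoothed_sum_cong sum.cong refl) (auto simp: hist_simps nw_of_hist)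

lemma smoothing_ratio_normalise:
  assumes "(\<Sum>k=1..N. wt w t k) \<noteq> 0"
  shows "smoothing_ratio N (\<xi> w) (nw w) t h =
    (\<Sum>i=1..N. wt w t i * backward_sum S N (\<xi> w) (nw w) t (single t (\<xi> w t i)) (\<lambda>y. forward_integral S (T - t) t y h)) /
    (\<Sum>i=1..N. wt w t i * lik_to_go S t T (\<xi> w t i))"
  using assms unfolding smoothing_ratio_def smoothed_sum_def normalise_def
  by (simp add: sum_divide_distrib[symmetric] del: One_nat_def)

lemma total_weight_nonzero:
  assumes "0 < (\<Sum>i=1..N. wt w t i * f (\<xi> w t i))" "t \<le> T"
  shows "(\<Sum>k=1..N. wt w t k) \<noteq> 0"
proof
  assume "(\<Sum>k=1..N. wt w t k) = 0"
  then have "\<And>i. i \<in> {1..N} \<Longrightarrow> wt w t i = 0"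
    using wt_nonneg assms(2) by (subst (asm) sum_nonneg_eq_0_iff) auto
  then have "(\<Sum>i=1..N. wt w t i * f (\<xi> w t i)) = 0" by (intro sum.neutral) simp
  then show False using assms by simp
qed

text \<open>R_t does not involve the particles of time t + 1, so it can be moved into the sum over
  them and combined with R_(t+1) over the common denominator.\<close>

lemma smoothing_ratio_Suc_diff:
  assumes t: "t < T" and pos: "0 < (\<Sum>i=1..N. wt w (Suc t) i * lik_to_go S (Suc t) T (\<xi> w (Suc t) i))"
  shows "smoothing_ratio N (\<xi> w) (nw w) (Suc t) h - smoothing_ratio N (\<xi> w) (nw w) t h =
    (\<Sum>i=1..N. wt w (Suc t) i * increment t h (hist t w) (\<xi> w (Suc t) i)) /
    (\<Sum>i=1..N. wt w (Suc t) i * lik_to_go S (Suc t) T (\<xi> w (Suc t) i))"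
proof -
  have nz: "(\<Sum>k=1..N. wt w (Suc t) k) \<noteq> 0"
    by (rule total_weight_nonzero[where f="lik_to_go S (Suc t) T", OF pos]) (use t in simp)
  have bs: "backward_sum S N (pos_of (hist t w)) (nw_of (hist t w)) (Suc t) x H =
      backward_sum S N (\<xi> w) (nw w) (Suc t) x H" for x H
    by (rule backward_sum_cong_particles) (auto simp: hist_simps nw_of_hist)
  have "(\<Sum>i=1..N. wt w (Suc t) i * increment t h (hist t w) (\<xi> w (Suc t) i)) =
    (\<Sum>i=1..N. wt w (Suc t) i * backward_sum S N (\<xi> w) (nw w) (Suc t) (single (Suc t) (\<xi> w (Suc t) i))
        (\<lambda>y. forward_integral S (T - Suc t) (Suc t) y h)) -
    smoothing_ratio N (\<xi> w) (nw w) t h * (\<Sum>i=1..N. wt w (Suc t) i * lik_to_go S (Suc t) T (\<xi> w (Suc t) i))"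
    unfolding increment_def bs smoothing_ratio_hist
    by (simp add: right_diff_distrib sum_subtractf sum_distrib_left mult.left_commute)
  with pos show ?thesis
    unfolding smoothing_ratio_normalise[OF nz] by (simp add: diff_divide_distrib)
qed

text \<open>If selection mass is positive and the denominator is at least \<beta> N, a deviation by
  \<open>e\<close> forces a centred sum of size e \<beta> N; its summands are bounded through hi -
  lo = 2d. The claim concerns a measurable cover \<open>E\<close>, so measurability of the deviation
  event itself is never an issue.\<close>

lemma smoothing_increment_bound:
  assumes t: "t < T" and h: "h \<in> borel_measurable (path_space T)"
    "\<And>x. x \<in> space (path_space T) \<Longrightarrow> a - d \<le> h x \<and> h x \<le> a + d"
    and d: "0 < d" and e: "0 < e" and \<beta>: "0 < \<beta>"
  shows "\<exists>E\<in>events. {w \<in> space P. e \<le> \<bar>smoothing_ratio N (\<xi> w) (nw w) (Suc t) h - smoothing_ratio N (\<xi> w) (nw w) t h\<bar>} \<subseteq> E \<and>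
    prob E \<le> 2 * exp (- (real N * (e * \<beta>)\<^sup>2 / (2 * (K * (2 * d * K ^ (T - Suc t)))\<^sup>2))) +
      (prob {w \<in> space P. (\<Sum>j=1..N. wt w t j * adj_mult S (Suc t) (\<xi> w t j)) \<le> 0} +
       prob {w \<in> space P. (\<Sum>i=1..N. wt w (Suc t) i * lik_to_go S (Suc t) T (\<xi> w (Suc t) i)) / real N < \<beta>})"
proof -
  let ?D = "\<lambda>w. smoothing_ratio N (\<xi> w) (nw w) (Suc t) h - smoothing_ratio N (\<xi> w) (nw w) t h"
  let ?A = "\<lambda>w. \<Sum>j=1..N. wt w t j * adj_mult S (Suc t) (\<xi> w t j)"
  let ?L = "\<lambda>w. \<Sum>i=1..N. wt w (Suc t) i * lik_to_go S (Suc t) T (\<xi> w (Suc t) i)"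
  let ?s = "\<lambda>w. \<Sum>i=1..N. wt w (Suc t) i * increment t h (hist t w) (\<xi> w (Suc t) i)"
  have N0: "0 < real N" using N by simp
  define E1 where "E1 = {w \<in> space P. hist t w \<in> good t \<and> real N * (e * \<beta>) \<le>
    \<bar>?s w - real N * ((\<Sum>j=1..N. wt w t j * (\<integral>x. lik_at S (Suc t) x * increment t h (hist t w) x \<partial>trans_kernel S (\<xi> w t j))) / ?A w)\<bar>}"
  define E2 where "E2 = {w \<in> space P. ?A w \<le> 0}"
  define E3 where "E3 = {w \<in> space P. ?L w / real N < \<beta>}"
  have cb: "\<bar>h x\<bar> \<le> \<bar>a\<bar> + d" if "x \<in> space (path_space T)" for x using h(2)[OF that] by auto
  note im = measurable_increment[OF t h(1) cb]
  have [measurable]: "?A \<in> borel_measurable P"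
    using t by (intro borel_measurable_sum borel_measurable_times measurable_wt measurable_compose[OF measurable_particle adj_mult]) auto
  have [measurable]: "?L \<in> borel_measurable P"
    using t by (intro borel_measurable_sum borel_measurable_times measurable_wt measurable_compose[OF measurable_particle measurable_lik_to_go]) auto
  have 1: "prob E1 \<le> 2 * exp (- (real N * (e * \<beta>)\<^sup>2 / (2 * (K * (2 * d * K ^ (T - Suc t)))\<^sup>2)))"
    unfolding E1_def
    using d K_pos e \<beta> increment_bound[OF t _ h] by (intro one_step_concentration[OF t im]) auto
  have zero: "(\<Sum>j=1..N. wt w t j * (\<integral>x. lik_at S (Suc t) x * increment t h (hist t w) x \<partial>trans_kernel S (\<xi> w t j))) = 0"
    if "hist t w \<in> good t" for w
    using increment_centred[OF t that h(1) cb] by (simp add: hist_simps del: One_nat_def cong: sum.cong_simp)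
  have E1eq: "E1 = {w \<in> space P. hist t w \<in> good t \<and> real N * (e * \<beta>) \<le> \<bar>?s w\<bar>}"
    unfolding E1_def by (intro Collect_cong conj_cong refl) (simp add: zero del: One_nat_def)
  have [measurable]: "hist t \<in> P \<rightarrow>\<^sub>M hist_space t" using t by (intro measurable_hist) simp
  have [measurable]: "?s \<in> borel_measurable P"
  proof (intro borel_measurable_sum borel_measurable_times measurable_wt)
    fix i assume "i \<in> {1..N}"
    then show "(\<lambda>w. increment t h (hist t w) (\<xi> w (Suc t) i)) \<in> borel_measurable P"
      using t measurable_compose[OF measurable_Pair im, of "hist t" P "\<lambda>w. \<xi> w (Suc t) i"]
      by (simp add: measurable_particle \<open>hist t \<in> _\<close> del: One_nat_def)
  qed (use t in auto)
  note [measurable] = good_sets[OF t]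
  have E: "E1 \<in> events" "E2 \<in> events" "E3 \<in> events"
    unfolding E1eq E2_def E3_def by measurable
  show ?thesis
  proof (intro bexI conjI)
    show "E1 \<union> (E2 \<union> E3) \<in> events" using E by auto
    show "prob (E1 \<union> (E2 \<union> E3)) \<le> 2 * exp (- (real N * (e * \<beta>)\<^sup>2 / (2 * (K * (2 * d * K ^ (T - Suc t)))\<^sup>2))) +
      (prob {w \<in> space P. ?A w \<le> 0} + prob {w \<in> space P. ?L w / real N < \<beta>})"
      using measure_Un_le[of E1 P "E2 \<union> E3"] measure_Un_le[of E2 P E3] E 1
      unfolding E2_def[symmetric] E3_def[symmetric] by auto
    show "{w \<in> space P. e \<le> \<bar>?D w\<bar>} \<subseteq> E1 \<union> (E2 \<union> E3)"
    proof (rule subsetI, rule UnCI)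
      fix w assume "w \<in> {w \<in> space P. e \<le> \<bar>?D w\<bar>}" "w \<notin> E2 \<union> E3"
      then have w: "w \<in> space P" "e \<le> \<bar>?D w\<bar>" "w \<notin> E3" "w \<notin> E2" by auto
      then have A: "0 < ?A w" and L: "\<beta> * real N \<le> ?L w"
        using N0 by (auto simp: E2_def E3_def pos_less_divide_eq not_less pos_le_divide_eq)
      have Lp: "0 < ?L w" using L mult_pos_pos[OF \<beta> N0] by linarith
      have "e * (\<beta> * real N) \<le> \<bar>?D w\<bar> * ?L w"
        using w(2) L e \<beta> N0 by (intro mult_mono) auto
      also have "\<dots> = \<bar>?s w\<bar>"
        unfolding smoothing_ratio_Suc_diff[OF t Lp] abs_divide using Lp by simp
      finally show "w \<in> E1"
        unfolding E1eq using w(1) A hist_good[OF t w(1)] by (simp add: mult_ac)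
    qed
  qed
qed

text \<open>The same argument with the exact value in place of a previous ratio: \<open>u\<close> is
  centred under the likelihood-weighted initial law, by the very definition of the smoothing
  law.\<close>

lemma initial_increment_bound:
  assumes h: "h \<in> borel_measurable (path_space T)"
    "\<And>x. x \<in> space (path_space T) \<Longrightarrow> a - d \<le> h x \<and> h x \<le> a + d"
    and d: "0 < d" and e: "0 < e" and \<beta>: "0 < \<beta>"
  shows "\<exists>E\<in>events. {w \<in> space P. e \<le> \<bar>smoothing_ratio N (\<xi> w) (nw w) 0 h - joint_smoothing S T h\<bar>} \<subseteq> E \<and>
    prob E \<le> 2 * exp (- (real N * (e * \<beta>)\<^sup>2 / (2 * (K * (2 * d * K ^ T))\<^sup>2))) +
       prob {w \<in> space P. (\<Sum>i=1..N. wt w 0 i * lik_to_go S 0 T (\<xi> w 0 i)) / real N < \<beta>}"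
proof -
  let ?r = "joint_smoothing S T h"
  let ?D = "\<lambda>w. smoothing_ratio N (\<xi> w) (nw w) 0 h - ?r"
  let ?L = "\<lambda>w. \<Sum>i=1..N. wt w 0 i * lik_to_go S 0 T (\<xi> w 0 i)"
  define u where "u x = forward_integral S T 0 (single 0 x) h - ?r * lik_to_go S 0 T x" for x
  let ?s = "\<lambda>w. \<Sum>i=1..N. wt w 0 i * u (\<xi> w 0 i)"
  have N0: "0 < real N" using N by simp
  have cb: "\<bar>h x\<bar> \<le> \<bar>a\<bar> + d" if "x \<in> space (path_space T)" for x using h(2)[OF that] by auto
  have Gm: "(\<lambda>y. forward_integral S T 0 y h) \<in> borel_measurable (path_space 0)"
    using measurable_forward_integral[of 0 T h "\<bar>a\<bar> + d"] h(1) cb by simp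
  have um[measurable]: "u \<in> borel_measurable borel"
    unfolding u_def[abs_def]
    by (intro borel_measurable_diff borel_measurable_times measurable_compose[OF measurable_single Gm]
      measurable_lik_to_go) auto
  have r: "a - d \<le> ?r" "?r \<le> a + d" using joint_smoothing_between[OF h] by auto
  have ub: "\<bar>u x\<bar> \<le> 2 * d * K ^ T" for x
  proof -
    let ?l = "lik_to_go S 0 T x"
    have L: "0 < ?l" "?l \<le> K ^ T" using lik_to_go_bounds[of 0 x] by auto
    have "(a - d) * ?l \<le> ?r * ?l" "?r * ?l \<le> (a + d) * ?l" using r L by (auto intro!: mult_right_mono)
    moreover have "(a - d) * ?l \<le> forward_integral S T 0 (single 0 x) h"
      "forward_integral S T 0 (single 0 x) h \<le> (a + d) * ?l"
      using forward_integral_between[OF _ h single_in_space, of 0 x] by auto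
    ultimately have "\<bar>u x\<bar> \<le> (2 * d) * ?l"
      unfolding u_def by (auto simp: algebra_simps abs_le_iff)
    also have "\<dots> \<le> 2 * d * K ^ T" using d L by (intro mult_left_mono) auto
    finally show ?thesis .
  qed
  have mean: "(\<integral>x. lik_at S 0 x * u x \<partial>init_law S) = 0"
  proof -
    have L: "lik_to_go S 0 T x = forward_integral S T 0 (single 0 x) (\<lambda>_. 1)" for x
      using forward_integral_lik_to_go[of 0 "single 0 x"] by simp
    have "(\<integral>x. lik_at S 0 x * u x \<partial>init_law S) =
      (\<integral>x. lik_at S 0 x * forward_integral S T 0 (single 0 x) h - ?r * (lik_at S 0 x * forward_integral S T 0 (single 0 x) (\<lambda>_. 1)) \<partial>init_law S)"
      by (simp only: u_def L right_diff_distrib mult.left_commute)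
    also have "\<dots> = unnormalised_smoothing S T h - ?r * unnormalised_smoothing S T (\<lambda>_. 1)"
      unfolding unnormalised_smoothing_def
      using init_integrand[OF order_refl h(1) cb] init_integrand[of T "\<lambda>_. 1" 1] by simp
    also have "\<dots> = 0"
      using unnormalised_smoothing_pos[of T "\<lambda>_. 1" 1] by (simp add: joint_smoothing_def)
    finally show ?thesis .
  qed
  define E1 where "E1 = {w \<in> space P. real N * (e * \<beta>) \<le> \<bar>?s w\<bar>}"
  define E3 where "E3 = {w \<in> space P. ?L w / real N < \<beta>}"
  have [measurable]: "?L \<in> borel_measurable P"
    by (intro borel_measurable_sum borel_measurable_times measurable_wt measurable_compose[OF measurable_particle measurable_lik_to_go]) auto
  have [measurable]: "?s \<in> borel_measurable P"
    by (intro borel_measurable_sum borel_measurable_times measurable_wt measurable_compose[OF measurable_particle um]) auto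
  have 1: "prob E1 \<le> 2 * exp (- (real N * (e * \<beta>)\<^sup>2 / (2 * (K * (2 * d * K ^ T))\<^sup>2)))"
    using initial_concentration[OF um _ ub, of "e * \<beta>"] d e \<beta> K_pos
    unfolding E1_def mean by simp
  have E: "E1 \<in> events" "E3 \<in> events"
    unfolding E1_def E3_def by measurable
  show ?thesis
  proof (intro bexI conjI)
    show "E1 \<union> E3 \<in> events" using E by auto
    show "prob (E1 \<union> E3) \<le> 2 * exp (- (real N * (e * \<beta>)\<^sup>2 / (2 * (K * (2 * d * K ^ T))\<^sup>2))) +
      prob {w \<in> space P. ?L w / real N < \<beta>}"
      using measure_Un_le[of E1 P E3] E 1 unfolding E3_def[symmetric] by auto
    show "{w \<in> space P. e \<le> \<bar>?D w\<bar>} \<subseteq> E1 \<union> E3"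
    proof safe
      fix w assume w: "w \<in> space P" "e \<le> \<bar>?D w\<bar>" "w \<notin> E3"
      then have L: "\<beta> * real N \<le> ?L w"
        using N0 by (auto simp: E3_def pos_less_divide_eq not_less pos_le_divide_eq)
      have Lp: "0 < ?L w" using L mult_pos_pos[OF \<beta> N0] by linarith
      have "?s w = (\<Sum>i=1..N. wt w 0 i * forward_integral S T 0 (single 0 (\<xi> w 0 i)) h) - ?r * ?L w"
        by (simp add: u_def right_diff_distrib sum_subtractf sum_distrib_left mult.left_commute)
      then have D: "?D w = ?s w / ?L w"
        using Lp smoothing_ratio_normalise[OF total_weight_nonzero[where f="lik_to_go S 0 T", OF Lp], of h]
        by (simp add: diff_divide_distrib)
      have "e * (\<beta> * real N) \<le> \<bar>?D w\<bar> * ?L w"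
        using w(2) L e \<beta> N0 by (intro mult_mono) auto
      also have "\<dots> = \<bar>?s w\<bar>" unfolding D abs_divide using Lp by simp
      finally show "w \<in> E1" unfolding E1_def using w(1) by (simp add: mult_ac)
    qed
  qed
qed

end

section \<open>Deviation inequality\<close>

locale particle_sequence = smc S T K
  for S :: "('x :: polish_space, 'y :: polish_space) smc_model" and T :: nat and K :: real +
  fixes P :: "nat \<Rightarrow> 'w measure" and \<xi> :: "nat \<Rightarrow> 'w \<Rightarrow> nat \<Rightarrow> nat \<Rightarrow> 'x"
    and I :: "nat \<Rightarrow> 'w \<Rightarrow> nat \<Rightarrow> nat \<Rightarrow> nat"
  assumes systems: "\<And>N. N \<ge> 1 \<Longrightarrow> particle_system S T N (P N) (\<xi> N) (I N)"
begin

lemma particles: "N \<ge> 1 \<Longrightarrow> particles S T K N (P N) (\<xi> N) (I N)"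
  by unfold_locales (use systems in auto)

lemma prob_spaces: "N \<ge> 1 \<Longrightarrow> prob_space (P N)"
  using systems by (simp add: particle_system_def)

abbreviation "wgt N w t i \<equiv> weight S (\<xi> N w) (I N w) t i"

section \<open>Limits of weighted particle averages\<close>

definition avg :: "nat \<Rightarrow> ('x \<Rightarrow> real) \<Rightarrow> nat \<Rightarrow> 'w \<Rightarrow> real" where
  "avg t f N w = (\<Sum>i=1..N. wgt N w t i * f (\<xi> N w t i)) / real N"

text \<open>Averages of weights do not approach the unnormalised filter itself, because selection
  divides by the total multiplied weight; this is the factor left over. Factors of earlier times
  cancel in that division.\<close>

definition norm_const :: "nat \<Rightarrow> real" where
  "norm_const t = (case t of 0 \<Rightarrow> 1 | Suc s \<Rightarrow> unnormalised_filter s (adj_mult S t))"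

lemma adj_bounded: "1 \<le> t \<Longrightarrow> t \<le> T \<Longrightarrow> \<bar>adj_mult S t x\<bar> \<le> K"
  using adj_pos[of t x] adj_le[of t x] by simp

lemma norm_const_pos: "t \<le> T \<Longrightarrow> 0 < norm_const t"
  by (cases t) (auto simp: norm_const_def intro!: unnormalised_filter_pos[where c=K] adj_bounded adj_pos adj_mult)

lemma avg_measurable:
  assumes N: "N \<ge> 1" and t: "t \<le> T" and f: "f \<in> borel_measurable borel"
  shows "avg t f N \<in> borel_measurable (P N)"
proof -
  interpret particles S T K N "P N" "\<xi> N" "I N" by (rule particles[OF N])
  show ?thesis
    unfolding avg_def[abs_def] wt_def[symmetric]
    using t by (intro borel_measurable_divide borel_measurable_sum borel_measurable_times measurable_wt
       measurable_compose[OF measurable_particle f] borel_measurable_const) auto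
qed

lemma forward_fun:
  assumes t: "Suc t \<le> T" and f[measurable]: "f \<in> borel_measurable borel" and c: "\<And>x. \<bar>f x\<bar> \<le> c"
  shows "(\<lambda>x. \<integral>x'. lik_at S (Suc t) x' * f x' \<partial>trans_kernel S x) \<in> borel_measurable borel"
    "\<bar>\<integral>x'. lik_at S (Suc t) x' * f x' \<partial>trans_kernel S x\<bar> \<le> K * c"
proof -
  show "(\<lambda>x. \<integral>x'. lik_at S (Suc t) x' * f x' \<partial>trans_kernel S x) \<in> borel_measurable borel"
    by (rule measurable_integral_kernel[OF _ trans_kernel]) measurable
  show "\<bar>\<integral>x'. lik_at S (Suc t) x' * f x' \<partial>trans_kernel S x\<bar> \<le> K * c"
  proof (rule prob_integral_bound[OF trans_kernelD(1)])
    note [measurable_cong] = trans_kernelD(2)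
    show "(\<lambda>x'. lik_at S (Suc t) x' * f x') \<in> borel_measurable (trans_kernel S x)" by measurable
    show "\<bar>lik_at S (Suc t) y * f y\<bar> \<le> K * c" for y
      unfolding abs_mult using lik_pos[OF t, of y] lik_le[OF t, of y] c[of y] K_pos by (intro mult_mono) auto
  qed
qed

lemma gauss_small: "0 < e \<Longrightarrow> 0 < c \<Longrightarrow> exp_small (\<lambda>N. 2 * exp (- (real N * e\<^sup>2 / (2 * (K * c)\<^sup>2))))"
  using K_pos by (intro exp_smallI[where B=2 and C="e\<^sup>2 / (2 * (K * c)\<^sup>2)"]) (auto simp: mult.commute)

text \<open>Given the history, the average at time t + 1 concentrates at a quotient of two averages
  at time t: of \<open>f\<close> moved one step forward, and of the multiplier. The induction
  therefore runs over all bounded \<open>f\<close>.\<close>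

lemma avg_exp_conv:
  assumes "t \<le> T" "f \<in> borel_measurable borel" "\<And>x. \<bar>f x\<bar> \<le> c"
  shows "exp_conv P (avg t f) (unnormalised_filter t f / norm_const t)"
  using assms
proof (induction t arbitrary: f c)
  case 0
  \<comment> \<open>The concentration lemmas ask for a positive bound, while \<open>c\<close> is 0
    when \<open>f\<close> is 0.\<close>
  define c' where "c' = max 1 c"
  have c': "0 < c'" "\<And>x. \<bar>f x\<bar> \<le> c'" using 0(3) by (auto simp: c'_def le_max_iff_disj)
  show ?case unfolding exp_conv_def
  proof (intro conjI allI impI)
    fix e :: real assume e: "0 < e"
    show "exp_small (\<lambda>N. measure (P N) {w \<in> space (P N). e \<le> \<bar>avg 0 f N w - unnormalised_filter 0 f / norm_const 0\<bar>})"
    proof (rule exp_small_mono[OF gauss_small[OF e c'(1)]])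
      fix N :: nat assume N: "1 \<le> N"
      interpret particles S T K N "P N" "\<xi> N" "I N" by (rule particles[OF N])
      have "(e \<le> \<bar>avg 0 f N w - unnormalised_filter 0 f / norm_const 0\<bar>) \<longleftrightarrow>
        real N * e \<le> \<bar>(\<Sum>i=1..N. wt w 0 i * f (\<xi> N w 0 i)) - real N * (\<integral>x. lik_at S 0 x * f x \<partial>init_law S)\<bar>" for w
      proof -
        have "(\<Sum>i=1..N. wt w 0 i * f (\<xi> N w 0 i)) - real N * (\<integral>x. lik_at S 0 x * f x \<partial>init_law S) =
          real N * (avg 0 f N w - unnormalised_filter 0 f / norm_const 0)"
          using N by (simp add: avg_def wt_def norm_const_def unnormalised_filter_0 right_diff_distrib)
        then show ?thesis using N by (simp add: abs_mult)
      qed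
      then show "prob {w \<in> space (P N). e \<le> \<bar>avg 0 f N w - unnormalised_filter 0 f / norm_const 0\<bar>}
        \<le> 2 * exp (- (real N * e\<^sup>2 / (2 * (K * c')\<^sup>2)))"
        using initial_concentration[OF 0(2) c' less_imp_le[OF e]] by simp
    qed
  qed (use 0 avg_measurable in auto)
next
  case (Suc t)
  define c' where "c' = max 1 c"
  have c': "0 < c'" "\<And>x. \<bar>f x\<bar> \<le> c'" using Suc(4) by (auto simp: c'_def le_max_iff_disj)
  have t: "t < T" using Suc.prems by simp
  let ?f = "\<lambda>x. \<integral>x'. lik_at S (Suc t) x' * f x' \<partial>trans_kernel S x"
  let ?\<theta> = "adj_mult S (Suc t)"
  have \<theta>: "0 < unnormalised_filter t ?\<theta>"
    using t by (intro unnormalised_filter_pos[where c=K] adj_bounded adj_pos adj_mult) auto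
  have IH1: "exp_conv P (avg t ?f) (unnormalised_filter t ?f / norm_const t)"
    using Suc.prems by (intro Suc.IH[where c="K * c"] forward_fun) auto
  have IH2: "exp_conv P (avg t ?\<theta>) (unnormalised_filter t ?\<theta> / norm_const t)"
    using Suc.prems by (intro Suc.IH[where c=K] adj_mult adj_bounded) auto
  have pos: "0 < unnormalised_filter t ?\<theta> / norm_const t"
    using \<theta> norm_const_pos[of t] t by simp
  have q: "exp_conv P (\<lambda>N w. avg t ?f N w / avg t ?\<theta> N w) (unnormalised_filter (Suc t) f / norm_const (Suc t))"
    using exp_conv_divide[OF prob_spaces IH1 IH2] pos \<theta> norm_const_pos[of t] t
    by (simp add: norm_const_def[of "Suc t"] unnormalised_filter_Suc)
  show ?case
  proof (rule exp_conv_perturb[OF prob_spaces q avg_measurable])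
    fix e :: real assume e: "0 < e"
    let ?d = "unnormalised_filter t ?\<theta> / norm_const t / 2"
    have small: "exp_small (\<lambda>N. measure (P N) {w \<in> space (P N). avg t ?\<theta> N w < ?d})"
      using pos by (intro exp_conv_less[OF prob_spaces IH2]) auto
    show "exp_small (\<lambda>N. measure (P N) {w \<in> space (P N). e \<le> \<bar>avg (Suc t) f N w - avg t ?f N w / avg t ?\<theta> N w\<bar>})"
    proof (rule exp_small_mono[OF exp_small_add[OF gauss_small[OF e c'(1)] small]])
      fix N :: nat assume N: "1 \<le> N"
      interpret particles S T K N "P N" "\<xi> N" "I N" by (rule particles[OF N])
      have [measurable]: "avg t ?\<theta> N \<in> borel_measurable (P N)" "avg t ?f N \<in> borel_measurable (P N)"
        "avg (Suc t) f N \<in> borel_measurable (P N)"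
        using N Suc.prems by (auto intro!: avg_measurable adj_mult forward_fun)
      let ?A = "{w \<in> space (P N). hist t w \<in> good t \<and> real N * e \<le>
          \<bar>(\<Sum>i=1..N. wt w (Suc t) i * f (\<xi> N w (Suc t) i)) - real N *
           ((\<Sum>j=1..N. wt w t j * (\<integral>x. lik_at S (Suc t) x * f x \<partial>trans_kernel S (\<xi> N w t j))) /
            (\<Sum>j=1..N. wt w t j * adj_mult S (Suc t) (\<xi> N w t j)))\<bar>}"
      let ?A' = "{w \<in> space (P N). 0 < avg t ?\<theta> N w \<and> e \<le> \<bar>avg (Suc t) f N w - avg t ?f N w / avg t ?\<theta> N w\<bar>}"
      let ?B = "{w \<in> space (P N). avg t ?\<theta> N w < ?d}"
      have N0: "0 < real N" using N by simp
      \<comment> \<open>Positivity of the averaged multiplied weights is exactly membership of the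
        history in \<open>good t\<close>; where it fails, the average is below \<open>?d\<close> and
        \<open>?B\<close> occurs.\<close>
      have A: "?A = ?A'"
      proof (rule Collect_cong, rule conj_cong[OF refl], rule conj_cong)
        fix w assume w: "w \<in> space (P N)"
        show "(hist t w \<in> good t) = (0 < avg t ?\<theta> N w)"
          using N0 by (simp add: hist_good[OF t w] avg_def wt_def zero_less_divide_iff)
        have "(\<Sum>i=1..N. wt w (Suc t) i * f (\<xi> N w (Suc t) i)) - real N *
           ((\<Sum>j=1..N. wt w t j * ?f (\<xi> N w t j)) / (\<Sum>j=1..N. wt w t j * ?\<theta> (\<xi> N w t j))) =
           real N * (avg (Suc t) f N w - avg t ?f N w / avg t ?\<theta> N w)"
          using N0 by (simp add: avg_def wt_def right_diff_distrib)
        then show "(real N * e \<le> \<bar>(\<Sum>i=1..N. wt w (Suc t) i * f (\<xi> N w (Suc t) i)) - real N *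
           ((\<Sum>j=1..N. wt w t j * ?f (\<xi> N w t j)) / (\<Sum>j=1..N. wt w t j * ?\<theta> (\<xi> N w t j)))\<bar>) =
           (e \<le> \<bar>avg (Suc t) f N w - avg t ?f N w / avg t ?\<theta> N w\<bar>)"
          using N0 by (simp add: abs_mult)
      qed
      have "prob {w \<in> space (P N). e \<le> \<bar>avg (Suc t) f N w - avg t ?f N w / avg t ?\<theta> N w\<bar>} \<le> prob (?A' \<union> ?B)"
        using pos by (intro finite_measure_mono) (auto simp: not_less)
      also have "\<dots> \<le> prob ?A' + prob ?B"
        by (rule measure_Un_le) measurable
      also have "prob ?A' \<le> 2 * exp (- (real N * e\<^sup>2 / (2 * (K * c')\<^sup>2)))"
        unfolding A[symmetric]
      proof (rule one_step_concentration[OF t])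
        show "(\<lambda>(z, x). f x) \<in> borel_measurable (hist_space t \<Otimes>\<^sub>M borel)"
          using measurable_compose[OF measurable_snd Suc.prems(2)] by (simp add: split_beta')
      qed (use c' e in auto)
      finally show "prob {w \<in> space (P N). e \<le> \<bar>avg (Suc t) f N w - avg t ?f N w / avg t ?\<theta> N w\<bar>} \<le>
         2 * exp (- (real N * e\<^sup>2 / (2 * (K * c')\<^sup>2))) + prob ?B" by simp
    qed
  qed (use Suc.prems in auto)
qed

text \<open>The common value at all times is the normalising constant of the smoothing law; this
  moves the limit from time t to the time t - 1 of the second assertion.\<close>

lemma unnormalised_filter_lik_to_go:
  "t < T \<Longrightarrow> unnormalised_filter (Suc t) (lik_to_go S (Suc t) T) = unnormalised_filter t (lik_to_go S t T)"
  by (simp add: unnormalised_filter_Suc lik_to_go_Suc[symmetric])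

lemma lik_to_go_abs: "t \<le> T \<Longrightarrow> \<bar>lik_to_go S t T x\<bar> \<le> K ^ (T - t)"
  using lik_to_go_bounds[of t x] by simp

lemma avg_lik_to_go_exp_conv:
  assumes "t \<le> T"
  shows "exp_conv P (avg t (lik_to_go S t T)) (unnormalised_filter t (lik_to_go S t T) / norm_const t)"
  using assms by (intro avg_exp_conv[where c="K ^ (T - t)"] measurable_lik_to_go lik_to_go_abs)

theorem avg_lik_to_go_tendsto:
  assumes t: "t \<in> {1..T}"
  shows "tendsto_in_probability P
      (\<lambda>N w. (\<Sum>l=1..N. weight S (\<xi> N w) (I N w) t l * lik_to_go S t T (\<xi> N w t l)) / real N)
      (filter_expectation S (t - 1) (lik_to_go S (t - 1) T) / filter_expectation S (t - 1) (adj_mult S t))"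
proof -
  obtain s where s: "t = Suc s" "s < T" using t by (cases t) auto
  have "unnormalised_smoothing S s (\<lambda>_. 1) \<noteq> 0"
    using unnormalised_smoothing_pos[of s "\<lambda>_. 1" 1] s by simp
  then have "filter_expectation S (t - 1) (lik_to_go S (t - 1) T) / filter_expectation S (t - 1) (adj_mult S t) =
    unnormalised_filter t (lik_to_go S t T) / norm_const t"
    using s by (simp add: filter_expectation_ratio norm_const_def unnormalised_filter_lik_to_go)
  then show ?thesis
    using exp_conv_tendsto_in_probability[OF avg_lik_to_go_exp_conv[of t]] t
    unfolding avg_def[abs_def] by simp
qed

section \<open>Gaussian tail bounds uniform in the test function\<close>

definition half_range :: "((nat \<Rightarrow> 'x) \<Rightarrow> real) \<Rightarrow> real \<Rightarrow> bool" where
  "half_range h d \<longleftrightarrow> h \<in> borel_measurable (path_space T) \<and>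
     (\<exists>a. \<forall>x\<in>space (path_space T). a - d \<le> h x \<and> h x \<le> a + d)"

text \<open>A measurable cover takes the place of the event, so bounds can be added without proving
  that the event is measurable.\<close>

definition tail_bound :: "nat \<Rightarrow> ('w \<Rightarrow> real) \<Rightarrow> real \<Rightarrow> real \<Rightarrow> bool" where
  "tail_bound N X e r \<longleftrightarrow> (\<exists>E\<in>sets (P N). {w \<in> space (P N). e \<le> \<bar>X w\<bar>} \<subseteq> E \<and> measure (P N) E \<le> r)"

text \<open>The constants come before \<open>N\<close>, \<open>h\<close>, \<open>d\<close> and
  \<open>e\<close>. The restriction to \<open>e\<close> at most 2d is where remainders free of
  \<open>e\<close> can be absorbed.\<close>

definition gauss_bound :: "(nat \<Rightarrow> ((nat \<Rightarrow> 'x) \<Rightarrow> real) \<Rightarrow> 'w \<Rightarrow> real) \<Rightarrow> bool" where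
  "gauss_bound D \<longleftrightarrow> (\<exists>B>0. \<exists>C>0. \<forall>N\<ge>1. \<forall>h d e. half_range h d \<longrightarrow> 0 < e \<longrightarrow> e \<le> 2 * d \<longrightarrow>
     tail_bound N (D N h) e (B * exp (- (C * real N * e\<^sup>2 / d\<^sup>2))))"

lemma tail_bound_mono: "tail_bound N X e r \<Longrightarrow> r \<le> r' \<Longrightarrow> tail_bound N X e r'"
  unfolding tail_bound_def by (meson order_trans)

lemma tail_bound_add:
  assumes "tail_bound N X (e / 2) r" "tail_bound N Y (e / 2) r'"
  shows "tail_bound N (\<lambda>w. X w + Y w) e (r + r')"
proof -
  obtain E where E: "E \<in> sets (P N)" "{w \<in> space (P N). e / 2 \<le> \<bar>X w\<bar>} \<subseteq> E" "measure (P N) E \<le> r"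
    using assms(1) by (auto simp: tail_bound_def)
  obtain E' where E': "E' \<in> sets (P N)" "{w \<in> space (P N). e / 2 \<le> \<bar>Y w\<bar>} \<subseteq> E'" "measure (P N) E' \<le> r'"
    using assms(2) by (auto simp: tail_bound_def)
  have "{w \<in> space (P N). e \<le> \<bar>X w + Y w\<bar>} \<subseteq> E \<union> E'"
  proof (rule subsetI, rule UnCI)
    fix w assume w: "w \<in> {w \<in> space (P N). e \<le> \<bar>X w + Y w\<bar>}" "w \<notin> E'"
    then have "\<not> e / 2 \<le> \<bar>Y w\<bar>" using E'(2) by auto
    moreover have "e \<le> \<bar>X w + Y w\<bar>" using w by simp
    ultimately have "e / 2 \<le> \<bar>X w\<bar>" by linarith
    then show "w \<in> E" using w E(2) by auto
  qed
  moreover have "measure (P N) (E \<union> E') \<le> r + r'"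
    using measure_Un_le[OF E(1) E'(1)] E(3) E'(3) by linarith
  ultimately show ?thesis
    unfolding tail_bound_def using E(1) E'(1) by (intro bexI[of _ "E \<union> E'"]) auto
qed

lemma gauss_boundI:
  assumes "0 < B" "0 < C"
    "\<And>N h d e. N \<ge> 1 \<Longrightarrow> half_range h d \<Longrightarrow> 0 < e \<Longrightarrow> e \<le> 2 * d \<Longrightarrow>
     tail_bound N (D N h) e (B * exp (- (C * real N * e\<^sup>2 / d\<^sup>2)))"
  shows "gauss_bound D"
  using assms unfolding gauss_bound_def by blast

lemma exp_scale_mono:
  fixes C C' d e :: real
  assumes "C \<le> C'"
  shows "exp (- (C' * real N * e\<^sup>2 / d\<^sup>2)) \<le> exp (- (C * real N * e\<^sup>2 / d\<^sup>2))"
proof -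
  have "C * (real N * e\<^sup>2 / d\<^sup>2) \<le> C' * (real N * e\<^sup>2 / d\<^sup>2)"
    using assms by (intro mult_right_mono) auto
  then show ?thesis by (simp add: mult.assoc)
qed

lemma gauss_bound_add:
  assumes "gauss_bound D" "gauss_bound D'"
  shows "gauss_bound (\<lambda>N h w. D N h w + D' N h w)"
proof -
  obtain B C where D: "0 < B" "0 < C"
    "\<And>N h d e. N \<ge> 1 \<Longrightarrow> half_range h d \<Longrightarrow> 0 < e \<Longrightarrow> e \<le> 2 * d \<Longrightarrow>
     tail_bound N (D N h) e (B * exp (- (C * real N * e\<^sup>2 / d\<^sup>2)))"
    using assms(1) unfolding gauss_bound_def by blast
  obtain B' C' where D': "0 < B'" "0 < C'"
    "\<And>N h d e. N \<ge> 1 \<Longrightarrow> half_range h d \<Longrightarrow> 0 < e \<Longrightarrow> e \<le> 2 * d \<Longrightarrow>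
     tail_bound N (D' N h) e (B' * exp (- (C' * real N * e\<^sup>2 / d\<^sup>2)))"
    using assms(2) unfolding gauss_bound_def by blast
  \<comment> \<open>\<open>tail_bound_add\<close> halves \<open>e\<close>, which divides its square
    by 4.\<close>
  let ?C = "min C C' / 4"
  show ?thesis
  proof (rule gauss_boundI[where B="B + B'" and C="?C"])
    fix N :: nat and h :: "(nat \<Rightarrow> 'x) \<Rightarrow> real" and d e :: real
    assume N: "1 \<le> N" and h: "half_range h d" and e: "0 < e" "e \<le> 2 * d"
    from e have e2: "0 < e / 2" "e / 2 \<le> 2 * d" by auto
    have sc: "exp (- (x * real N * (e / 2)\<^sup>2 / d\<^sup>2)) \<le> exp (- (?C * real N * e\<^sup>2 / d\<^sup>2))" if "min C C' \<le> x" for x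
    proof -
      have "exp (- (x * real N * (e / 2)\<^sup>2 / d\<^sup>2)) = exp (- (x / 4 * real N * e\<^sup>2 / d\<^sup>2))"
        by (simp add: power_divide)
      also have "\<dots> \<le> exp (- (?C * real N * e\<^sup>2 / d\<^sup>2))" using that by (intro exp_scale_mono) auto
      finally show ?thesis .
    qed
    have "B * exp (- (C * real N * (e / 2)\<^sup>2 / d\<^sup>2)) + B' * exp (- (C' * real N * (e / 2)\<^sup>2 / d\<^sup>2)) \<le>
        (B + B') * exp (- (?C * real N * e\<^sup>2 / d\<^sup>2))"
      using D(1) D'(1) unfolding distrib_right by (intro add_mono mult_left_mono sc) auto
    then show "tail_bound N (\<lambda>w. D N h w + D' N h w) e ((B + B') * exp (- (?C * real N * e\<^sup>2 / d\<^sup>2)))"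
      by (rule tail_bound_mono[OF tail_bound_add[OF D(3)[OF N h e2] D'(3)[OF N h e2]]])
  qed (use D D' in auto)
qed

text \<open>The exponentially small term does not depend on \<open>e\<close>; it is absorbed because only \<open>e \<le> 2 * d\<close>
  matters.\<close>

lemma gauss_boundI_small:
  assumes p: "exp_small p" and \<kappa>: "0 < \<kappa>"
    and D: "\<And>N h a d e. N \<ge> 1 \<Longrightarrow> h \<in> borel_measurable (path_space T) \<Longrightarrow>
       (\<And>x. x \<in> space (path_space T) \<Longrightarrow> a - d \<le> h x \<and> h x \<le> a + d) \<Longrightarrow> 0 < d \<Longrightarrow> 0 < e \<Longrightarrow>
     tail_bound N (D N h) e (2 * exp (- (\<kappa> * real N * e\<^sup>2 / d\<^sup>2)) + p N)"
  shows "gauss_bound D"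
proof -
  obtain B C where p: "0 < B" "0 < C" "\<And>N. N \<ge> 1 \<Longrightarrow> p N \<le> B * exp (- C * real N)"
    using p by (auto simp: exp_small_def)
  \<comment> \<open>From e \<le> 2d one has e^2 / d^2 \<le> 4, so exp(-C N) is at most exp(-(C/4) N
    e^2 / d^2).\<close>
  let ?C = "min \<kappa> (C / 4)"
  show ?thesis
  proof (rule gauss_boundI[where B="2 + B" and C="?C"])
    fix N :: nat and h :: "(nat \<Rightarrow> 'x) \<Rightarrow> real" and d e :: real
    assume N: "1 \<le> N" and h: "half_range h d" and e: "0 < e" "e \<le> 2 * d"
    have d: "0 < d" using e by simp
    have tb: "tail_bound N (D N h) e (2 * exp (- (\<kappa> * real N * e\<^sup>2 / d\<^sup>2)) + p N)"
      using h D[OF N _ _ d e(1), of h] unfolding half_range_def by blast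
    have "e\<^sup>2 \<le> (2 * d)\<^sup>2" using e by (intro power_mono) auto
    then have ed: "e\<^sup>2 / d\<^sup>2 \<le> 4" using d by (simp add: pos_divide_le_eq power_mult_distrib)
    have "C / 4 * real N * e\<^sup>2 / d\<^sup>2 = C / 4 * real N * (e\<^sup>2 / d\<^sup>2)" by simp
    also have "\<dots> \<le> C / 4 * real N * 4" using p ed by (intro mult_left_mono) auto
    finally have "exp (- C * real N) \<le> exp (- (C / 4 * real N * e\<^sup>2 / d\<^sup>2))" by simp
    also have "\<dots> \<le> exp (- (?C * real N * e\<^sup>2 / d\<^sup>2))" by (intro exp_scale_mono) auto
    finally have "B * exp (- C * real N) \<le> B * exp (- (?C * real N * e\<^sup>2 / d\<^sup>2))"
      using p(1) by (intro mult_left_mono) auto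
    moreover have "exp (- (\<kappa> * real N * e\<^sup>2 / d\<^sup>2)) \<le> exp (- (?C * real N * e\<^sup>2 / d\<^sup>2))"
      by (intro exp_scale_mono) auto
    ultimately have "2 * exp (- (\<kappa> * real N * e\<^sup>2 / d\<^sup>2)) + p N \<le> (2 + B) * exp (- (?C * real N * e\<^sup>2 / d\<^sup>2))"
      using p(3)[OF N] by (simp only: distrib_right)
    then show "tail_bound N (D N h) e ((2 + B) * exp (- (?C * real N * e\<^sup>2 / d\<^sup>2)))"
      by (rule tail_bound_mono[OF tb])
  qed (use p \<kappa> in auto)
qed

abbreviation nwgt :: "nat \<Rightarrow> 'w \<Rightarrow> nat \<Rightarrow> nat \<Rightarrow> real" where
  "nwgt N w s \<equiv> normalise N (weight S (\<xi> N w) (I N w) s)"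

text \<open>Here \<beta> is half the limit, and it is fixed before any test function or \<epsilon>
  appears.\<close>

lemma avg_lik_to_go_pos:
  assumes "t \<le> T"
  obtains \<beta> where "0 < \<beta>" "exp_small (\<lambda>N. measure (P N) {w \<in> space (P N). avg t (lik_to_go S t T) N w < \<beta>})"
proof -
  let ?l = "unnormalised_filter t (lik_to_go S t T) / norm_const t"
  have l: "0 < ?l"
    using assms norm_const_pos[of t] lik_to_go_bounds[of t]
    by (intro divide_pos_pos unnormalised_filter_pos[where c="K ^ (T - t)"] lik_to_go_abs measurable_lik_to_go) auto
  show ?thesis
    using l exp_conv_less[OF prob_spaces avg_lik_to_go_exp_conv[OF assms], of "?l / 2"]
    by (intro that[of "?l / 2"]) auto
qed

lemma gauss_exponent_eq:
  fixes d :: real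
  assumes "0 < d"
  shows "real N * (e * \<beta>)\<^sup>2 / (2 * (K * (2 * d * k))\<^sup>2) = \<beta>\<^sup>2 / (2 * (K * (2 * k))\<^sup>2) * real N * e\<^sup>2 / d\<^sup>2"
  by (simp add: power_mult_distrib mult_ac)

text \<open>Telescoping over time. Each added increment enlarges the factor and shrinks the rate,
  which is how the constants come to depend on \<open>T\<close>.\<close>

lemma smoothing_ratio_gauss_bound:
  assumes "t \<le> T"
  shows "gauss_bound (\<lambda>N h w. smoothing_ratio N (\<xi> N w) (nwgt N w) t h - joint_smoothing S T h)"
  using assms
proof (induction t)
  case 0
  obtain \<beta> where \<beta>: "0 < \<beta>" "exp_small (\<lambda>N. measure (P N) {w \<in> space (P N). avg 0 (lik_to_go S 0 T) N w < \<beta>})"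
    by (rule avg_lik_to_go_pos[of 0]) auto
  show ?case
  proof (rule gauss_boundI_small[OF \<beta>(2)])
    show "0 < \<beta>\<^sup>2 / (2 * (K * (2 * K ^ T))\<^sup>2)" using \<beta> K_pos by simp
    fix N :: nat and h :: "(nat \<Rightarrow> 'x) \<Rightarrow> real" and a d e :: real
    assume N: "1 \<le> N" and h: "h \<in> borel_measurable (path_space T)"
      "\<And>x. x \<in> space (path_space T) \<Longrightarrow> a - d \<le> h x \<and> h x \<le> a + d" and d: "0 < d" and e: "0 < e"
    interpret particles S T K N "P N" "\<xi> N" "I N" by (rule particles[OF N])
    have "wt w s = weight S (\<xi> N w) (I N w) s" for w s by (simp add: fun_eq_iff wt_def)
    then show "tail_bound N (\<lambda>w. smoothing_ratio N (\<xi> N w) (nwgt N w) 0 h - joint_smoothing S T h) e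
       (2 * exp (- (\<beta>\<^sup>2 / (2 * (K * (2 * K ^ T))\<^sup>2) * real N * e\<^sup>2 / d\<^sup>2)) +
         prob {w \<in> space (P N). avg 0 (lik_to_go S 0 T) N w < \<beta>})"
      unfolding tail_bound_def using initial_increment_bound[OF h d e \<beta>(1)] unfolding gauss_exponent_eq[OF d] avg_def
      by simp
  qed
next
  case (Suc t)
  have t: "t < T" using Suc.prems by simp
  let ?\<theta> = "adj_mult S (Suc t)"
  obtain \<beta> where \<beta>: "0 < \<beta>" "exp_small (\<lambda>N. measure (P N) {w \<in> space (P N). avg (Suc t) (lik_to_go S (Suc t) T) N w < \<beta>})"
    by (rule avg_lik_to_go_pos[of "Suc t"]) (use t in auto)
  have \<theta>: "exp_conv P (avg t ?\<theta>) (unnormalised_filter t ?\<theta> / norm_const t)"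
    using t by (intro avg_exp_conv[where c=K] adj_mult adj_bounded) auto
  have \<theta>pos: "0 < unnormalised_filter t ?\<theta> / norm_const t"
    using t norm_const_pos[of t]
    by (intro divide_pos_pos unnormalised_filter_pos[where c=K] adj_bounded adj_pos adj_mult) auto
  let ?d = "unnormalised_filter t ?\<theta> / norm_const t / 2"
  have small: "exp_small (\<lambda>N. measure (P N) {w \<in> space (P N). avg t ?\<theta> N w < ?d})"
    using \<theta>pos by (intro exp_conv_less[OF prob_spaces \<theta>]) auto
  have "gauss_bound (\<lambda>N h w. smoothing_ratio N (\<xi> N w) (nwgt N w) (Suc t) h - smoothing_ratio N (\<xi> N w) (nwgt N w) t h)"
  proof (rule gauss_boundI_small[OF exp_small_add[OF small \<beta>(2)]])
    show "0 < \<beta>\<^sup>2 / (2 * (K * (2 * K ^ (T - Suc t)))\<^sup>2)" using \<beta> K_pos by simp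
    fix N :: nat and h :: "(nat \<Rightarrow> 'x) \<Rightarrow> real" and a d e :: real
    assume N: "1 \<le> N" and h: "h \<in> borel_measurable (path_space T)"
      "\<And>x. x \<in> space (path_space T) \<Longrightarrow> a - d \<le> h x \<and> h x \<le> a + d" and d: "0 < d" and e: "0 < e"
    interpret particles S T K N "P N" "\<xi> N" "I N" by (rule particles[OF N])
    have wt: "wt w s = weight S (\<xi> N w) (I N w) s" for w s by (simp add: fun_eq_iff wt_def)
    have [measurable]: "avg t ?\<theta> N \<in> borel_measurable (P N)"
      using N t by (auto intro!: avg_measurable adj_mult)
    \<comment> \<open>The event without a selection law is contained in the event that the average
      of the multiplied weights is below half its positive limit.\<close>
    have "prob {w \<in> space (P N). (\<Sum>j=1..N. wt w t j * ?\<theta> (\<xi> N w t j)) \<le> 0} \<le>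
        prob {w \<in> space (P N). avg t ?\<theta> N w < ?d}"
    proof (intro finite_measure_mono subsetI)
      fix w assume w: "w \<in> {w \<in> space (P N). (\<Sum>j=1..N. wt w t j * ?\<theta> (\<xi> N w t j)) \<le> 0}"
      then have "avg t ?\<theta> N w \<le> 0" by (simp add: avg_def wt divide_nonpos_nonneg)
      then have "avg t ?\<theta> N w < ?d" by (rule order_le_less_trans) (use \<theta>pos in simp)
      then show "w \<in> {w \<in> space (P N). avg t ?\<theta> N w < ?d}" using w by simp
    qed measurable
    moreover obtain E where "E \<in> events"
      "{w \<in> space (P N). e \<le> \<bar>smoothing_ratio N (\<xi> N w) (nw w) (Suc t) h - smoothing_ratio N (\<xi> N w) (nw w) t h\<bar>} \<subseteq> E"
      "prob E \<le> 2 * exp (- (\<beta>\<^sup>2 / (2 * (K * (2 * K ^ (T - Suc t)))\<^sup>2) * real N * e\<^sup>2 / d\<^sup>2)) +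
      (prob {w \<in> space (P N). (\<Sum>j=1..N. wt w t j * ?\<theta> (\<xi> N w t j)) \<le> 0} +
       prob {w \<in> space (P N). avg (Suc t) (lik_to_go S (Suc t) T) N w < \<beta>})"
      using smoothing_increment_bound[OF t h d e \<beta>(1)] unfolding gauss_exponent_eq[OF d] avg_def
      unfolding wt by blast
    ultimately show "tail_bound N (\<lambda>w. smoothing_ratio N (\<xi> N w) (nwgt N w) (Suc t) h - smoothing_ratio N (\<xi> N w) (nwgt N w) t h) e
       (2 * exp (- (\<beta>\<^sup>2 / (2 * (K * (2 * K ^ (T - Suc t)))\<^sup>2) * real N * e\<^sup>2 / d\<^sup>2)) +
        (prob {w \<in> space (P N). avg t ?\<theta> N w < ?d} +
         prob {w \<in> space (P N). avg (Suc t) (lik_to_go S (Suc t) T) N w < \<beta>}))"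
      unfolding tail_bound_def wt by (intro bexI[of _ E]) auto
  qed
  from gauss_bound_add[OF this Suc.IH] t show ?case by simp
qed

text \<open>\<open>osc\<close> is a supremum of reals, so it is an upper bound only because
  \<open>h\<close> is bounded.\<close>

lemma osc_le:
  assumes h: "h \<in> bounded_measurable A" and x: "x \<in> space A" "y \<in> space A"
  shows "\<bar>h x - h y\<bar> \<le> osc (space A) h"
proof -
  obtain b where b: "\<And>x. x \<in> space A \<Longrightarrow> \<bar>h x\<bar> \<le> b"
    using h by (auto simp: bounded_measurable_def bounded_iff)
  have "bdd_above ((\<lambda>(x, x'). \<bar>h x - h x'\<bar>) ` (space A \<times> space A))"
  proof (rule bdd_aboveI2)
    fix p assume "p \<in> space A \<times> space A"
    then show "(\<lambda>(x, x'). \<bar>h x - h x'\<bar>) p \<le> 2 * b"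
      using b[of "fst p"] b[of "snd p"] by (auto simp: split_beta)
  qed
  from cSUP_upper[OF _ this, of "(x, y)"] x show ?thesis by (simp add: osc_def)
qed

theorem ffbs_deviation:
  "\<exists>B>0. \<exists>C>0. \<forall>N\<ge>1. \<forall>\<epsilon>>0. \<forall>h\<in>bounded_measurable (path_space T).
    measure (P N) {w \<in> space (P N).
      \<bar>ffbs_estimator S T N (\<xi> N w) (I N w) h - joint_smoothing S T h\<bar> \<ge> \<epsilon>}
    \<le> (if osc (space (path_space T)) h = 0 then 0
       else B * exp (- C * real N * \<epsilon>\<^sup>2 / (osc (space (path_space T)) h)\<^sup>2))"
proof -
  obtain B C where D: "0 < B" "0 < C"
    "\<And>N h d e. N \<ge> 1 \<Longrightarrow> half_range h d \<Longrightarrow> 0 < e \<Longrightarrow> e \<le> 2 * d \<Longrightarrow>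
     tail_bound N (\<lambda>w. smoothing_ratio N (\<xi> N w) (nwgt N w) T h - joint_smoothing S T h) e
       (B * exp (- (C * real N * e\<^sup>2 / d\<^sup>2)))"
    using smoothing_ratio_gauss_bound[OF order_refl] unfolding gauss_bound_def by blast
  show ?thesis
  proof (rule exI[of _ B], rule conjI, rule D(1), rule exI[of _ C], intro conjI D(2) allI impI ballI)
    fix N :: nat and e :: real and h :: "(nat \<Rightarrow> 'x) \<Rightarrow> real"
    assume N: "1 \<le> N" and e: "0 < e" and h: "h \<in> bounded_measurable (path_space T)"
    let ?d = "osc (space (path_space T)) h"
    let ?E = "{w \<in> space (P N). \<bar>ffbs_estimator S T N (\<xi> N w) (I N w) h - joint_smoothing S T h\<bar> \<ge> e}"
    interpret particles S T K N "P N" "\<xi> N" "I N" by (rule particles[OF N])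
    have wt: "wt w s = weight S (\<xi> N w) (I N w) s" for w s by (simp add: fun_eq_iff wt_def)
    \<comment> \<open>Any value of \<open>h\<close> can serve as the centre; the half-length is then
      the full oscillation, at the cost of a constant only.\<close>
    define a where "a = h (single T undefined)"
    have hm: "h \<in> borel_measurable (path_space T)" using h by (simp add: bounded_measurable_def)
    have hb: "a - ?d \<le> h x \<and> h x \<le> a + ?d" if "x \<in> space (path_space T)" for x
      using osc_le[OF h that single_in_space, of undefined] by (auto simp: a_def abs_le_iff)
    have hr: "half_range h ?d" using hm hb unfolding half_range_def by blast
    have est: "ffbs_estimator S T N (\<xi> N w) (I N w) h = smoothing_ratio N (\<xi> N w) (nwgt N w) T h" for w
      using ffbs_estimator_eq[OF hm, of w] smoothing_ratio_T[of N "nw w" "\<xi> N w" h] nw_prob[of T w]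
      by (simp add: wt)
    have range: "\<bar>ffbs_estimator S T N (\<xi> N w) (I N w) h - joint_smoothing S T h\<bar> \<le> 2 * ?d" for w
      using smoothing_ratio_between[OF order_refl hm hb, of N "nw w" "\<xi> N w"] nw_prob[of _ w]
        joint_smoothing_between[OF hm hb] unfolding est wt by (auto simp: abs_le_iff)
    show "prob ?E \<le> (if ?d = 0 then 0 else B * exp (- C * real N * e\<^sup>2 / ?d\<^sup>2))"
    \<comment> \<open>A test function of oscillation 0 always falls into the second case, where the
      event is empty.\<close>
    proof (cases "e \<le> 2 * ?d")
      case True
      obtain E where E: "E \<in> events" "?E \<subseteq> E" "prob E \<le> B * exp (- (C * real N * e\<^sup>2 / ?d\<^sup>2))"
        using D(3)[OF N hr e True] unfolding tail_bound_def est by blast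
      have "prob ?E \<le> prob E" using E by (intro finite_measure_mono)
      with E True e show ?thesis by simp
    next
      case False
      then have "?E = {}" using range by (auto simp: not_le) (meson leD order_le_less_trans)
      then show ?thesis using D(1) by (simp only: measure_empty) simp
    qed
  qed
qed

end

lemma SUP_sup_norm_bound:
  fixes f :: "nat \<Rightarrow> 'a \<Rightarrow> real"
  assumes "(SUP t\<in>A. sup_norm (f t)) < \<infinity>"
  obtains b where "\<And>t x. t \<in> A \<Longrightarrow> f t x \<le> b"
proof -
  let ?s = "SUP t\<in>A. sup_norm (f t)"
  have "f t x \<le> enn2real ?s" if "t \<in> A" for t x
  proof -
    have "ennreal \<bar>f t x\<bar> \<le> sup_norm (f t)" unfolding sup_norm_def by (rule SUP_upper) simp
    also have "\<dots> \<le> ?s" using that by (rule SUP_upper)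
    also have "?s = ennreal (enn2real ?s)" using assms by (simp add: less_top)
    finally have "\<bar>f t x\<bar> \<le> enn2real ?s" by (subst (asm) ennreal_le_iff) auto
    then show ?thesis by simp
  qed
  then show ?thesis by (rule that)
qed

theorem theorem5:
  fixes S :: "('x :: polish_space, 'y :: polish_space) smc_model"
    and T :: nat
    and P :: "nat \<Rightarrow> 'w measure"
    and \<xi> :: "nat \<Rightarrow> 'w \<Rightarrow> nat \<Rightarrow> nat \<Rightarrow> 'x"
    and I :: "nat \<Rightarrow> 'w \<Rightarrow> nat \<Rightarrow> nat \<Rightarrow> nat"
  assumes model: "standing_assumptions S T"
    and particles: "\<And>N. N \<ge> 1 \<Longrightarrow> particle_system S T N (P N) (\<xi> N) (I N)"
    and A1_pos: "\<And>t x. t \<in> {0..T} \<Longrightarrow> 0 < lik_at S t x"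
    and A1_bdd: "(SUP t\<in>{0..T}. sup_norm (lik_at S t)) < \<infinity>"
    and A2_adj: "(SUP t\<in>{1..T}. sup_norm (adj_mult S t)) < \<infinity>"
    and A2_weight0: "sup_norm (init_weight_fun S) < \<infinity>"
    and A2_weight: "(SUP t\<in>{1..T}. sup_norm (\<lambda>(x, x'). weight_fun S t x x')) < \<infinity>"
  shows "(\<exists>B>0. \<exists>C>0. \<forall>N\<ge>1. \<forall>\<epsilon>>0. \<forall>h\<in>bounded_measurable (path_space T).
            measure (P N) {w \<in> space (P N).
              \<bar>ffbs_estimator S T N (\<xi> N w) (I N w) h - joint_smoothing S T h\<bar> \<ge> \<epsilon>}
            \<le> (if osc (space (path_space T)) h = 0 then 0
               else B * exp (- C * real N * \<epsilon>\<^sup>2 / (osc (space (path_space T)) h)\<^sup>2)))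
         \<and> (\<forall>t\<in>{1..T}. tendsto_in_probability P
              (\<lambda>N w. (\<Sum>l=1..N. weight S (\<xi> N w) (I N w) t l * lik_to_go S t T (\<xi> N w t l)) / real N)
              (filter_expectation S (t - 1) (lik_to_go S (t - 1) T)
                 / filter_expectation S (t - 1) (adj_mult S t)))"
proof -
  obtain b1 where b1: "\<And>t x. t \<in> {0..T} \<Longrightarrow> lik_at S t x \<le> b1"
    using SUP_sup_norm_bound[OF A1_bdd] by blast
  obtain b2 where b2: "\<And>t x. t \<in> {1..T} \<Longrightarrow> adj_mult S t x \<le> b2"
    using SUP_sup_norm_bound[OF A2_adj] by blast
  \<comment> \<open>The bound at time 0 is phrased as a supremum over one index to fit
    \<open>SUP_sup_norm_bound\<close>.\<close>
  have "(SUP t\<in>{0::nat}. sup_norm (init_weight_fun S)) < \<infinity>" using A2_weight0 by simp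
  then obtain b3 where b3: "\<And>t x. t \<in> {0::nat} \<Longrightarrow> init_weight_fun S x \<le> b3"
    using SUP_sup_norm_bound[where f="\<lambda>_::nat. init_weight_fun S"] by blast
  obtain b4 where b4: "\<And>t p. t \<in> {1..T} \<Longrightarrow> (case p of (x, x') \<Rightarrow> weight_fun S t x x') \<le> b4"
    using SUP_sup_norm_bound[OF A2_weight] by blast
  let ?K = "max (max b1 b2) (max b3 b4)"
  interpret particle_sequence S T ?K P \<xi> I
  proof
    show "lik_at S t x \<le> ?K" if "t \<le> T" for t x using b1[of t x] that by auto
    show "adj_mult S t x \<le> ?K" if "1 \<le> t" "t \<le> T" for t x using b2[of t x] that by auto
    show "init_weight_fun S x \<le> ?K" for x using b3[of 0 x] by auto
    show "weight_fun S t x x' \<le> ?K" if "1 \<le> t" "t \<le> T" for t x x' using b4[of t "(x, x')"] that by auto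
  qed (use model particles A1_pos in auto)
  show ?thesis
    using ffbs_deviation avg_lik_to_go_tendsto by (intro conjI ballI)
qed

end
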